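(* Let $G$ be a finite group acting on a Frobenius cyclic poset $(\mathcal{X},\mathcal{X}_0)$, and let $R$ be a discrete valuation ring whose residue field has characteristic not dividing $n=|G|$ and which contains all $n$-th roots of unity. Let $\mathcal{F}=\mathcal{F}(\mathcal{X},\mathcal{X}_0)$. If the effective stabilizer $H_X=\{\beta\in G\mid\beta X\cong X\}$ of every $X\in\mathcal{X}$ is abelian, then every object of $\mathcal{F}^G$ is isomorphic to a direct sum of strongly indecomposable objects of the form $S_\lambda X$, where $X\in\mathcal{X}$ and $\lambda:H_X\to R^\times$ is a group homomorphism.
   Context: A reduced cocycle on a set $\mathcal{X}$ is a function $c:\mathcal{X}^3\to\mathbb{N}=\{0,1,2,\dots\}$ with $c(X,Y,Z)-c(W,Y,Z)+c(W,X,Z)-c(W,X,Y)=0$ and $c(X,X,Y)=0=c(X,Y,Y)$ for all $W,X,Y,Z\in\mathcal{X}$. A cyclic poset is a set with a reduced cocycle. Given a cyclic poset $(\mathcal{X},c)$ and a discrete valuation ring $R$ with uniformizer $u$, $\mathcal{P}(\mathcal{X})$ is the $R$-category with object set $\mathcal{X}$, in which each $\mathrm{Hom}(X,Y)$ is a free $R$-module of rank one on a generator $f_{XY}$ (the basic morphism), with $f_{XX}=\mathrm{id}$ and $f_{YZ}\circ f_{XY}=u^{c(X,Y,Z)}f_{XZ}$. Let $\operatorname{add}\mathcal{P}(\mathcal{X})$ be the additive category of finite (ordered) direct sums of objects of $\mathcal{X}$. Two elements $X,Y\in\mathcal{X}$ are isomorphic iff $c(X,Y,X)=0$. Let $\mathcal{X}_0\subseteq\mathcal{X}$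 be closed under isomorphism. The pair $(\mathcal{X},\mathcal{X}_0)$ is a Frobenius cyclic poset if, for every choice of $(R,u)$, $\operatorname{add}\mathcal{P}(\mathcal{X})$ admits the (necessarily unique) structure of a Frobenius category with $\mathcal{X}_0$ the set of indecomposable projective-injective objects; this Frobenius category is denoted $\mathcal{F}(\mathcal{X},\mathcal{X}_0)$. An action of $G$ on $(\mathcal{X},\mathcal{X}_0)$ is an action of $G$ on the set $\mathcal{X}$ with $c(\gamma X,\gamma Y,\gamma Z)=c(X,Y,Z)$ and $\gamma\mathcal{X}_0=\mathcal{X}_0$ for all $\gamma\in G$. It induces an $R$-linear action of $G$ on $\mathcal{F}$ with $\gamma(\bigoplus X_i)=\bigoplus\gamma X_i$ and $\gamma f_{XY}=f_{\gamma X,\gamma Y}$. The category $\mathcal{F}^G$: objects are pairs $(X,\xi)$ with $X\in\mathcal{F}$ and $\xi$ a family of isomorphisms $\xi_\gamma:\gamma X\to X$ ($\gamma\in G$) such that $\xi_{\alpha\beta}=\xi_\alpha\circ\alpha\xi_\beta$ for all $\alpha,\beta\in G$; a morphism $(X,\xi^X)\to(Y,\xi^Y)$ is a morphism $f:X\to Y$ in $\mathcal{F}$ with $f\circ\xi^X_\gamma=\xi^Y_\gamma\circ\gamma f$ for all $\gamma$. The object $S_\lambda X$: let $X\in\mathcal{X}$, $H=H_X$, $\lambda:H\to R^\times$ a homomorphism. Choose representatives $\sigma_i$ of the left cosets of $H$ in $G$, $G=\coprod\sigma_iH$. Then $S_\lambda X=(\bigoplus_i\sigma_iX,\xi^\lambda)$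 where, for $\gamma\in G$, $\xi^\lambda_\gamma:\gamma\bigoplus\sigma_iX\to\bigoplus\sigma_jX$ has component $\gamma\sigma_iX\to\sigma_jX$ equal to $\lambda(\eta_j)$ times the basic isomorphism $\gamma\sigma_iX\to\sigma_jX$, with $\sigma_j$ and $\eta_j\in H$ determined by $\gamma\sigma_i=\sigma_j\eta_j$ (other components zero). Up to isomorphism this does not depend on the choice of the $\sigma_i$. An object is strongly indecomposable if its endomorphism ring is local. *)

theory Defs
  imports "HOL-Algebra.Ring_Divisibility" "HOL-Algebra.Group_Action" "Jordan_Normal_Form.Matrix"
begin

section \<open>Categories with addition of morphisms\<close>

text \<open>Hom sets of different pairs of objects need not be disjoint, so composition must not
  depend on the objects: where it has to, the morphisms themselves carry source and target.\<close>

record ('o, 'm) add_cat =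
  cat_obj :: "'o set"
  cat_hom :: "'o \<Rightarrow> 'o \<Rightarrow> 'm set"
  cat_comp :: "'m \<Rightarrow> 'm \<Rightarrow> 'm"  (infixr \<open>\<circ>\<index>\<close> 70)
  cat_id :: "'o \<Rightarrow> 'm"
  cat_add :: "'m \<Rightarrow> 'm \<Rightarrow> 'm"
  cat_zero :: "'o \<Rightarrow> 'o \<Rightarrow> 'm"

definition category :: "('o, 'm) add_cat \<Rightarrow> bool" where
  "category C \<longleftrightarrow>
     (\<forall>A\<in>cat_obj C. cat_id C A \<in> cat_hom C A A) \<and>
     (\<forall>A\<in>cat_obj C. \<forall>B\<in>cat_obj C. \<forall>D\<in>cat_obj C. \<forall>f\<in>cat_hom C A B. \<forall>g\<in>cat_hom C B D.
        g \<circ>\<^bsub>C\<^esub> f \<in> cat_hom C A D) \<and>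
     (\<forall>A\<in>cat_obj C. \<forall>B\<in>cat_obj C. \<forall>f\<in>cat_hom C A B.
        f \<circ>\<^bsub>C\<^esub> cat_id C A = f \<and> cat_id C B \<circ>\<^bsub>C\<^esub> f = f) \<and>
     (\<forall>A\<in>cat_obj C. \<forall>B\<in>cat_obj C. \<forall>D\<in>cat_obj C. \<forall>E\<in>cat_obj C.
        \<forall>f\<in>cat_hom C A B. \<forall>g\<in>cat_hom C B D. \<forall>h\<in>cat_hom C D E.
        (h \<circ>\<^bsub>C\<^esub> g) \<circ>\<^bsub>C\<^esub> f = h \<circ>\<^bsub>C\<^esub> (g \<circ>\<^bsub>C\<^esub> f))"

definition preadditive :: "('o, 'm) add_cat \<Rightarrow> bool" where
  "preadditive C \<longleftrightarrow> category C \<and>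
     (\<forall>A\<in>cat_obj C. \<forall>B\<in>cat_obj C.
        comm_group \<lparr>carrier = cat_hom C A B, monoid.mult = cat_add C, one = cat_zero C A B\<rparr>) \<and>
     (\<forall>A\<in>cat_obj C. \<forall>B\<in>cat_obj C. \<forall>D\<in>cat_obj C.
        \<forall>f\<in>cat_hom C A B. \<forall>f'\<in>cat_hom C A B. \<forall>g\<in>cat_hom C B D. \<forall>g'\<in>cat_hom C B D.
        g \<circ>\<^bsub>C\<^esub> cat_add C f f' = cat_add C (g \<circ>\<^bsub>C\<^esub> f) (g \<circ>\<^bsub>C\<^esub> f') \<and>
        cat_add C g g' \<circ>\<^bsub>C\<^esub> f = cat_add C (g \<circ>\<^bsub>C\<^esub> f) (g' \<circ>\<^bsub>C\<^esub> f))"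

definition end_ring :: "('o, 'm) add_cat \<Rightarrow> 'o \<Rightarrow> 'm ring" where
  "end_ring C A = \<lparr>carrier = cat_hom C A A, monoid.mult = cat_comp C, one = cat_id C A,
     ring.zero = cat_zero C A A, ring.add = cat_add C\<rparr>"

definition cat_iso :: "('o, 'm) add_cat \<Rightarrow> 'o \<Rightarrow> 'o \<Rightarrow> 'm set" where
  "cat_iso C A B = {f \<in> cat_hom C A B. \<exists>g\<in>cat_hom C B A.
     g \<circ>\<^bsub>C\<^esub> f = cat_id C A \<and> f \<circ>\<^bsub>C\<^esub> g = cat_id C B}"

definition isomorphic :: "('o, 'm) add_cat \<Rightarrow> 'o \<Rightarrow> 'o \<Rightarrow> bool" where
  "isomorphic C A B \<longleftrightarrow> cat_iso C A B \<noteq> {}"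

definition zero_object :: "('o, 'm) add_cat \<Rightarrow> 'o \<Rightarrow> bool" where
  "zero_object C A \<longleftrightarrow> A \<in> cat_obj C \<and>
     (\<forall>B\<in>cat_obj C. (\<exists>!f. f \<in> cat_hom C A B) \<and> (\<exists>!f. f \<in> cat_hom C B A))"

text \<open>\<open>direct_sum C Bs A\<close>: the object \<open>A\<close> is a biproduct of the finite family \<open>Bs\<close>.\<close>

definition direct_sum :: "('o, 'm) add_cat \<Rightarrow> 'o list \<Rightarrow> 'o \<Rightarrow> bool" where
  "direct_sum C Bs A \<longleftrightarrow> A \<in> cat_obj C \<and> set Bs \<subseteq> cat_obj C \<and>
     (\<exists>\<iota> \<pi>.
        (\<forall>i<length Bs. \<iota> i \<in> cat_hom C (Bs ! i) A \<and> \<pi> i \<in> cat_hom C A (Bs ! i)) \<and>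
        (\<forall>i<length Bs. \<forall>j<length Bs. \<pi> j \<circ>\<^bsub>C\<^esub> \<iota> i =
           (if i = j then cat_id C (Bs ! i) else cat_zero C (Bs ! i) (Bs ! j))) \<and>
        (\<Oplus>\<^bsub>end_ring C A\<^esub> i \<in> {..<length Bs}. \<iota> i \<circ>\<^bsub>C\<^esub> \<pi> i) = cat_id C A)"

definition additive :: "('o, 'm) add_cat \<Rightarrow> bool" where
  "additive C \<longleftrightarrow> preadditive C \<and> (\<exists>Z. zero_object C Z) \<and>
     (\<forall>A\<in>cat_obj C. \<forall>B\<in>cat_obj C. \<exists>S. direct_sum C [A, B] S)"

definition indecomposable :: "('o, 'm) add_cat \<Rightarrow> 'o \<Rightarrow> bool" where
  "indecomposable C A \<longleftrightarrow> A \<in> cat_obj C \<and> \<not> zero_object C A \<and>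
     (\<forall>B D. direct_sum C [B, D] A \<longrightarrow> zero_object C B \<or> zero_object C D)"

definition local_ring :: "'a ring \<Rightarrow> bool" where
  "local_ring E \<longleftrightarrow> ring E \<and> \<one>\<^bsub>E\<^esub> \<noteq> \<zero>\<^bsub>E\<^esub> \<and>
     (\<forall>a \<in> carrier E - Units E. \<forall>b \<in> carrier E - Units E. a \<oplus>\<^bsub>E\<^esub> b \<notin> Units E)"

definition strongly_indecomposable :: "('o, 'm) add_cat \<Rightarrow> 'o \<Rightarrow> bool" where
  "strongly_indecomposable C A \<longleftrightarrow> A \<in> cat_obj C \<and> local_ring (end_ring C A)"


section \<open>Exact and Frobenius categories\<close>

definition is_kernel :: "('o, 'm) add_cat \<Rightarrow> 'o \<Rightarrow> 'o \<Rightarrow> 'o \<Rightarrow> 'm \<Rightarrow> 'm \<Rightarrow> bool" where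
  "is_kernel C A B D i p \<longleftrightarrow> p \<circ>\<^bsub>C\<^esub> i = cat_zero C A D \<and>
     (\<forall>T\<in>cat_obj C. \<forall>t\<in>cat_hom C T B. p \<circ>\<^bsub>C\<^esub> t = cat_zero C T D \<longrightarrow>
        (\<exists>!s. s \<in> cat_hom C T A \<and> i \<circ>\<^bsub>C\<^esub> s = t))"

definition is_cokernel :: "('o, 'm) add_cat \<Rightarrow> 'o \<Rightarrow> 'o \<Rightarrow> 'o \<Rightarrow> 'm \<Rightarrow> 'm \<Rightarrow> bool" where
  "is_cokernel C A B D i p \<longleftrightarrow> p \<circ>\<^bsub>C\<^esub> i = cat_zero C A D \<and>
     (\<forall>T\<in>cat_obj C. \<forall>t\<in>cat_hom C B T. t \<circ>\<^bsub>C\<^esub> i = cat_zero C A T \<longrightarrow>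
        (\<exists>!s. s \<in> cat_hom C D T \<and> s \<circ>\<^bsub>C\<^esub> p = t))"

text \<open>The square with \<open>i : A \<rightarrow> B\<close>, \<open>f : A \<rightarrow> A'\<close>, \<open>i' : A' \<rightarrow> B'\<close>, \<open>f' : B \<rightarrow> B'\<close>
  is a push-out; dually for pull-backs, with \<open>p : B \<rightarrow> D\<close>, \<open>f : D' \<rightarrow> D\<close>, \<open>p' : B' \<rightarrow> D'\<close>,
  \<open>f' : B' \<rightarrow> B\<close>.\<close>

definition pushout ::
  "('o, 'm) add_cat \<Rightarrow> 'o \<Rightarrow> 'o \<Rightarrow> 'o \<Rightarrow> 'm \<Rightarrow> 'm \<Rightarrow> 'm \<Rightarrow> 'm \<Rightarrow> bool" where
  "pushout C B A' B' i f i' f' \<longleftrightarrow>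
     i' \<in> cat_hom C A' B' \<and> f' \<in> cat_hom C B B' \<and> i' \<circ>\<^bsub>C\<^esub> f = f' \<circ>\<^bsub>C\<^esub> i \<and>
     (\<forall>T\<in>cat_obj C. \<forall>x\<in>cat_hom C A' T. \<forall>y\<in>cat_hom C B T. x \<circ>\<^bsub>C\<^esub> f = y \<circ>\<^bsub>C\<^esub> i \<longrightarrow>
        (\<exists>!z. z \<in> cat_hom C B' T \<and> z \<circ>\<^bsub>C\<^esub> i' = x \<and> z \<circ>\<^bsub>C\<^esub> f' = y))"

definition pullback ::
  "('o, 'm) add_cat \<Rightarrow> 'o \<Rightarrow> 'o \<Rightarrow> 'o \<Rightarrow> 'm \<Rightarrow> 'm \<Rightarrow> 'm \<Rightarrow> 'm \<Rightarrow> bool" where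
  "pullback C B D' B' p f p' f' \<longleftrightarrow>
     p' \<in> cat_hom C B' D' \<and> f' \<in> cat_hom C B' B \<and> f \<circ>\<^bsub>C\<^esub> p' = p \<circ>\<^bsub>C\<^esub> f' \<and>
     (\<forall>T\<in>cat_obj C. \<forall>x\<in>cat_hom C T D'. \<forall>y\<in>cat_hom C T B. f \<circ>\<^bsub>C\<^esub> x = p \<circ>\<^bsub>C\<^esub> y \<longrightarrow>
        (\<exists>!z. z \<in> cat_hom C T B' \<and> p' \<circ>\<^bsub>C\<^esub> z = x \<and> f' \<circ>\<^bsub>C\<^esub> z = y))"

text \<open>A candidate exact structure is a class \<open>\<E>\<close> of sequences \<open>A \<rightarrow> B \<rightarrow> D\<close>,
  given as tuples \<open>(A, B, D, i, p)\<close>.\<close>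

type_synonym ('o, 'm) seqs = "('o \<times> 'o \<times> 'o \<times> 'm \<times> 'm) set"

definition adm_mono :: "('o, 'm) seqs \<Rightarrow> 'o \<Rightarrow> 'o \<Rightarrow> 'm \<Rightarrow> bool" where
  "adm_mono \<E> A B i \<longleftrightarrow> (\<exists>D p. (A, B, D, i, p) \<in> \<E>)"

definition adm_epi :: "('o, 'm) seqs \<Rightarrow> 'o \<Rightarrow> 'o \<Rightarrow> 'm \<Rightarrow> bool" where
  "adm_epi \<E> B D p \<longleftrightarrow> (\<exists>A i. (A, B, D, i, p) \<in> \<E>)"

text \<open>Quillen's axioms, in the standard self-dual form of Keller and Buehler.\<close>

definition exact_structure :: "('o, 'm) add_cat \<Rightarrow> ('o, 'm) seqs \<Rightarrow> bool" where
  "exact_structure C \<E> \<longleftrightarrow> additive C \<and>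
     (\<forall>(A, B, D, i, p) \<in> \<E>.
        A \<in> cat_obj C \<and> B \<in> cat_obj C \<and> D \<in> cat_obj C \<and>
        i \<in> cat_hom C A B \<and> p \<in> cat_hom C B D \<and>
        is_kernel C A B D i p \<and> is_cokernel C A B D i p) \<and>
     (\<forall>(A, B, D, i, p) \<in> \<E>. \<forall>A'\<in>cat_obj C. \<forall>B'\<in>cat_obj C. \<forall>D'\<in>cat_obj C.
        \<forall>i'\<in>cat_hom C A' B'. \<forall>p'\<in>cat_hom C B' D'.
        \<forall>a\<in>cat_iso C A A'. \<forall>b\<in>cat_iso C B B'. \<forall>d\<in>cat_iso C D D'.
        i' \<circ>\<^bsub>C\<^esub> a = b \<circ>\<^bsub>C\<^esub> i \<and> p' \<circ>\<^bsub>C\<^esub> b = d \<circ>\<^bsub>C\<^esub> p \<longrightarrow> (A', B', D', i', p') \<in> \<E>) \<and>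
     (\<forall>A\<in>cat_obj C. adm_mono \<E> A A (cat_id C A) \<and> adm_epi \<E> A A (cat_id C A)) \<and>
     (\<forall>A B D i j. adm_mono \<E> A B i \<and> adm_mono \<E> B D j \<longrightarrow> adm_mono \<E> A D (j \<circ>\<^bsub>C\<^esub> i)) \<and>
     (\<forall>A B D p q. adm_epi \<E> A B p \<and> adm_epi \<E> B D q \<longrightarrow> adm_epi \<E> A D (q \<circ>\<^bsub>C\<^esub> p)) \<and>
     (\<forall>A B i. adm_mono \<E> A B i \<longrightarrow> (\<forall>A'\<in>cat_obj C. \<forall>f\<in>cat_hom C A A'.
        \<exists>B'\<in>cat_obj C. \<exists>i' f'. pushout C B A' B' i f i' f' \<and> adm_mono \<E> A' B' i')) \<and>
     (\<forall>B D p. adm_epi \<E> B D p \<longrightarrow> (\<forall>D'\<in>cat_obj C. \<forall>f\<in>cat_hom C D' D.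
        \<exists>B'\<in>cat_obj C. \<exists>p' f'. pullback C B D' B' p f p' f' \<and> adm_epi \<E> B' D' p'))"

definition projective :: "('o, 'm) add_cat \<Rightarrow> ('o, 'm) seqs \<Rightarrow> 'o \<Rightarrow> bool" where
  "projective C \<E> P \<longleftrightarrow> P \<in> cat_obj C \<and>
     (\<forall>B D p. adm_epi \<E> B D p \<longrightarrow>
        (\<forall>f\<in>cat_hom C P D. \<exists>g\<in>cat_hom C P B. p \<circ>\<^bsub>C\<^esub> g = f))"

definition injective :: "('o, 'm) add_cat \<Rightarrow> ('o, 'm) seqs \<Rightarrow> 'o \<Rightarrow> bool" where
  "injective C \<E> I \<longleftrightarrow> I \<in> cat_obj C \<and>
     (\<forall>A B i. adm_mono \<E> A B i \<longrightarrow>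
        (\<forall>f\<in>cat_hom C A I. \<exists>g\<in>cat_hom C B I. g \<circ>\<^bsub>C\<^esub> i = f))"

definition frobenius_structure :: "('o, 'm) add_cat \<Rightarrow> ('o, 'm) seqs \<Rightarrow> bool" where
  "frobenius_structure C \<E> \<longleftrightarrow> exact_structure C \<E> \<and>
     (\<forall>A\<in>cat_obj C. \<exists>P p. projective C \<E> P \<and> adm_epi \<E> P A p) \<and>
     (\<forall>A\<in>cat_obj C. \<exists>I i. injective C \<E> I \<and> adm_mono \<E> A I i) \<and>
     (\<forall>A\<in>cat_obj C. projective C \<E> A \<longleftrightarrow> injective C \<E> A)"


section \<open>Discrete valuation rings\<close>

definition discrete_valuation_ring :: "'r ring \<Rightarrow> bool" where
  "discrete_valuation_ring R \<longleftrightarrow>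
     principal_domain R \<and> \<not> field R \<and> (\<exists>!m. maximalideal m R)"

definition uniformizer :: "'r ring \<Rightarrow> 'r \<Rightarrow> bool" where
  "uniformizer R u \<longleftrightarrow> u \<in> carrier R \<and> maximalideal (PIdl\<^bsub>R\<^esub> u) R"

definition residue_field :: "'r ring \<Rightarrow> 'r set ring" where
  "residue_field R = R Quot (THE m. maximalideal m R)"

text \<open>\<open>group.ord\<close> is \<open>0\<close> on elements of infinite order.\<close>

definition ring_characteristic :: "'a ring \<Rightarrow> nat" where
  "ring_characteristic K = group.ord (add_monoid K) \<one>\<^bsub>K\<^esub>"

text \<open>If \<open>n\<close> is nonzero in the domain \<open>R\<close>, then there are exactly \<open>n\<close> roots of \<open>x^n = 1\<close> in an
  algebraic closure of its field of fractions, so that \<open>R\<close> contains all of them if and only if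
  it contains \<open>n\<close> of them.\<close>

definition contains_roots_of_unity :: "'r ring \<Rightarrow> nat \<Rightarrow> bool" where
  "contains_roots_of_unity R n \<longleftrightarrow> card {\<zeta> \<in> carrier R. \<zeta> [^]\<^bsub>R\<^esub> n = \<one>\<^bsub>R\<^esub>} = n"


section \<open>Cyclic posets\<close>

definition cyclic_poset :: "'x set \<Rightarrow> ('x \<Rightarrow> 'x \<Rightarrow> 'x \<Rightarrow> nat) \<Rightarrow> bool" where
  "cyclic_poset \<X> c \<longleftrightarrow>
     (\<forall>w\<in>\<X>. \<forall>x\<in>\<X>. \<forall>y\<in>\<X>. \<forall>z\<in>\<X>.
        int (c x y z) - int (c w y z) + int (c w x z) - int (c w x y) = 0) \<and>
     (\<forall>x\<in>\<X>. \<forall>y\<in>\<X>. c x x y = 0 \<and> c x y y = 0)"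

text \<open>Isomorphism of \<open>x\<close> and \<open>y\<close> as objects of the category \<open>\<P>(\<X>)\<close> (for any \<open>R\<close>).\<close>

definition cp_iso :: "('x \<Rightarrow> 'x \<Rightarrow> 'x \<Rightarrow> nat) \<Rightarrow> 'x \<Rightarrow> 'x \<Rightarrow> bool" where
  "cp_iso c x y \<longleftrightarrow> c x y x = 0"

text \<open>A morphism \<open>A\<^sub>0 \<oplus> \<dots> \<oplus> A\<^sub>n\<^sub>-\<^sub>1 \<rightarrow> B\<^sub>0 \<oplus> \<dots> \<oplus> B\<^sub>m\<^sub>-\<^sub>1\<close> of the additive hull of \<open>\<P>(\<X>)\<close> is
  an \<open>m \<times> n\<close> matrix over \<open>R\<close>. Its \<open>(j, i)\<close> entry \<open>r\<close> stands for the component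
  \<open>r f\<close> with \<open>f : A\<^sub>i \<rightarrow> B\<^sub>j\<close> the basic morphism. The objects enter composition
  only through the powers of \<open>u\<close>.\<close>

datatype ('x, 'r) mor = Mor (src: "'x list") (tgt: "'x list") (coeffs: "'r mat")

definition mor_comp ::
  "'r ring \<Rightarrow> 'r \<Rightarrow> ('x \<Rightarrow> 'x \<Rightarrow> 'x \<Rightarrow> nat) \<Rightarrow> ('x, 'r) mor \<Rightarrow> ('x, 'r) mor \<Rightarrow> ('x, 'r) mor" where
  "mor_comp R u c g f = Mor (src f) (tgt g)
     (mat (length (tgt g)) (length (src f)) (\<lambda>(k, i).
        \<Oplus>\<^bsub>R\<^esub> j \<in> {..<length (tgt f)}.
          u [^]\<^bsub>R\<^esub> c (src f ! i) (tgt f ! j) (tgt g ! k) \<otimes>\<^bsub>R\<^esub>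
          (coeffs g $$ (k, j) \<otimes>\<^bsub>R\<^esub> coeffs f $$ (j, i))))"

definition addP ::
  "'r ring \<Rightarrow> 'r \<Rightarrow> 'x set \<Rightarrow> ('x \<Rightarrow> 'x \<Rightarrow> 'x \<Rightarrow> nat) \<Rightarrow> ('x list, ('x, 'r) mor) add_cat" where
  "addP R u \<X> c = \<lparr>
     cat_obj = lists \<X>,
     cat_hom = (\<lambda>A B. {Mor A B M | M.
        M \<in> carrier_mat (length B) (length A) \<and> elements_mat M \<subseteq> carrier R}),
     cat_comp = mor_comp R u c,
     cat_id = (\<lambda>A. Mor A A (mat (length A) (length A)
        (\<lambda>(j, i). if j = i then \<one>\<^bsub>R\<^esub> else \<zero>\<^bsub>R\<^esub>))),
     cat_add = (\<lambda>f g. Mor (src f) (tgt f) (mat (length (tgt f)) (length (src f))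
        (\<lambda>(j, i). coeffs f $$ (j, i) \<oplus>\<^bsub>R\<^esub> coeffs g $$ (j, i)))),
     cat_zero = (\<lambda>A B. Mor A B (mat (length B) (length A) (\<lambda>_. \<zero>\<^bsub>R\<^esub>)))\<rparr>"

text \<open>HOL cannot quantify over the type carrying the discrete valuation ring inside a formula,
  so \<open>R\<close> ranges over all discrete valuation rings with carrier in the type \<open>'r\<close>.\<close>

definition frobenius_cyclic_poset ::
  "'r itself \<Rightarrow> 'x set \<Rightarrow> ('x \<Rightarrow> 'x \<Rightarrow> 'x \<Rightarrow> nat) \<Rightarrow> 'x set \<Rightarrow> bool" where
  "frobenius_cyclic_poset TYPE('r) \<X> c \<X>\<^sub>0 \<longleftrightarrow>
     cyclic_poset \<X> c \<and> \<X>\<^sub>0 \<subseteq> \<X> \<and>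
     (\<forall>x\<in>\<X>\<^sub>0. \<forall>y\<in>\<X>. cp_iso c x y \<longrightarrow> y \<in> \<X>\<^sub>0) \<and>
     (\<forall>(R :: 'r ring) u. discrete_valuation_ring R \<and> uniformizer R u \<longrightarrow>
        (\<exists>\<E>. frobenius_structure (addP R u \<X> c) \<E> \<and>
           (\<forall>A\<in>cat_obj (addP R u \<X> c).
              indecomposable (addP R u \<X> c) A \<and>
              projective (addP R u \<X> c) \<E> A \<and> injective (addP R u \<X> c) \<E> A \<longleftrightarrow>
              (\<exists>x\<in>\<X>\<^sub>0. isomorphic (addP R u \<X> c) A [x]))))"


section \<open>Group actions and equivariant objects\<close>

definition cp_action ::
  "'g monoid \<Rightarrow> 'x set \<Rightarrow> ('x \<Rightarrow> 'x \<Rightarrow> 'x \<Rightarrow> nat) \<Rightarrow> 'x set \<Rightarrow> ('g \<Rightarrow> 'x \<Rightarrow> 'x) \<Rightarrow> bool" where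
  "cp_action G \<X> c \<X>\<^sub>0 \<phi> \<longleftrightarrow> group_action G \<X> \<phi> \<and>
     (\<forall>\<gamma>\<in>carrier G. \<forall>x\<in>\<X>. \<forall>y\<in>\<X>. \<forall>z\<in>\<X>. c (\<phi> \<gamma> x) (\<phi> \<gamma> y) (\<phi> \<gamma> z) = c x y z) \<and>
     (\<forall>\<gamma>\<in>carrier G. \<phi> \<gamma> ` \<X>\<^sub>0 = \<X>\<^sub>0)"

text \<open>The induced action on the additive hull is \<open>map (\<phi> \<gamma>)\<close> on objects; on morphisms it maps
  basic morphisms to basic morphisms and therefore keeps the coefficients.\<close>

definition act_mor :: "('g \<Rightarrow> 'x \<Rightarrow> 'x) \<Rightarrow> 'g \<Rightarrow> ('x, 'r) mor \<Rightarrow> ('x, 'r) mor" where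
  "act_mor \<phi> \<gamma> f = Mor (map (\<phi> \<gamma>) (src f)) (map (\<phi> \<gamma>) (tgt f)) (coeffs f)"

definition equivariant_cat ::
  "'g monoid \<Rightarrow> ('g \<Rightarrow> 'o \<Rightarrow> 'o) \<Rightarrow> ('g \<Rightarrow> 'm \<Rightarrow> 'm) \<Rightarrow> ('o, 'm) add_cat \<Rightarrow>
     ('o \<times> ('g \<Rightarrow> 'm), 'm) add_cat" where
  "equivariant_cat G aO aM C = \<lparr>
     cat_obj = {(A, \<xi>). A \<in> cat_obj C \<and>
        \<xi> \<in> (\<Pi>\<^sub>E \<gamma>\<in>carrier G. cat_iso C (aO \<gamma> A) A) \<and>
        (\<forall>\<alpha>\<in>carrier G. \<forall>\<beta>\<in>carrier G. \<xi> (\<alpha> \<otimes>\<^bsub>G\<^esub> \<beta>) = \<xi> \<alpha> \<circ>\<^bsub>C\<^esub> aM \<alpha> (\<xi> \<beta>))},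
     cat_hom = (\<lambda>(A, \<xi>) (B, \<eta>). {f \<in> cat_hom C A B.
        \<forall>\<gamma>\<in>carrier G. f \<circ>\<^bsub>C\<^esub> \<xi> \<gamma> = \<eta> \<gamma> \<circ>\<^bsub>C\<^esub> aM \<gamma> f}),
     cat_comp = cat_comp C,
     cat_id = (\<lambda>(A, \<xi>). cat_id C A),
     cat_add = cat_add C,
     cat_zero = (\<lambda>(A, \<xi>) (B, \<eta>). cat_zero C A B)\<rparr>"

abbreviation FG ::
  "'r ring \<Rightarrow> 'r \<Rightarrow> 'x set \<Rightarrow> ('x \<Rightarrow> 'x \<Rightarrow> 'x \<Rightarrow> nat) \<Rightarrow> 'g monoid \<Rightarrow> ('g \<Rightarrow> 'x \<Rightarrow> 'x) \<Rightarrow>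
     ('x list \<times> ('g \<Rightarrow> ('x, 'r) mor), ('x, 'r) mor) add_cat" where
  "FG R u \<X> c G \<phi> \<equiv> equivariant_cat G (\<lambda>\<gamma>. map (\<phi> \<gamma>)) (act_mor \<phi>) (addP R u \<X> c)"

definition eff_stabilizer ::
  "'g monoid \<Rightarrow> ('x \<Rightarrow> 'x \<Rightarrow> 'x \<Rightarrow> nat) \<Rightarrow> ('g \<Rightarrow> 'x \<Rightarrow> 'x) \<Rightarrow> 'x \<Rightarrow> 'g set" where
  "eff_stabilizer G c \<phi> x = {\<beta> \<in> carrier G. cp_iso c (\<phi> \<beta> x) x}"

text \<open>\<open>G\<close> is the disjoint union of the left cosets \<open>\<sigma> ! i <# H\<close>.\<close>

definition left_coset_reps :: "'g monoid \<Rightarrow> 'g set \<Rightarrow> 'g list \<Rightarrow> bool" where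
  "left_coset_reps G H \<sigma> \<longleftrightarrow> set \<sigma> \<subseteq> carrier G \<and>
     (\<forall>\<gamma>\<in>carrier G. \<exists>!i. i < length \<sigma> \<and> \<gamma> \<in> \<sigma> ! i <#\<^bsub>G\<^esub> H)"

definition S_obj ::
  "'r ring \<Rightarrow> 'g monoid \<Rightarrow> ('x \<Rightarrow> 'x \<Rightarrow> 'x \<Rightarrow> nat) \<Rightarrow> ('g \<Rightarrow> 'x \<Rightarrow> 'x) \<Rightarrow> 'g list \<Rightarrow> ('g \<Rightarrow> 'r) \<Rightarrow> 'x \<Rightarrow>
     'x list \<times> ('g \<Rightarrow> ('x, 'r) mor)" where
  "S_obj R G c \<phi> \<sigma> \<theta> x =
     (let A = map (\<lambda>s. \<phi> s x) \<sigma>; H = eff_stabilizer G c \<phi> x in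
      (A, \<lambda>\<gamma>\<in>carrier G. Mor (map (\<phi> \<gamma>) A) A (mat (length \<sigma>) (length \<sigma>) (\<lambda>(j, i).
         let \<eta> = inv\<^bsub>G\<^esub> (\<sigma> ! j) \<otimes>\<^bsub>G\<^esub> (\<gamma> \<otimes>\<^bsub>G\<^esub> \<sigma> ! i)
         in if \<eta> \<in> H then \<theta> \<eta> else \<zero>\<^bsub>R\<^esub>))))"

end

theory Submission
  imports Defs
begin

text \<open>
  Every object \<open>(A, \<xi>)\<close> of the equivariant category splits off an induced object \<open>S\<^sub>\<lambda> x\<close>, with a
  complement that has fewer components than \<open>A\<close>; iterating this gives the decomposition. Let \<open>x\<close> be
  a component of \<open>A\<close> and \<open>H\<close> its effective stabilizer.

  \<^item> The group \<open>H\<close> acts \<open>R\<close>-linearly on the morphisms \<open>x \<rightarrow> A\<close>: an element \<open>h\<close> sends \<open>a\<close> to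
    \<open>\<xi>\<^sub>h \<circ> h a\<close>, composed with the basic isomorphism \<open>x \<rightarrow> h x\<close>. As \<open>H\<close> is abelian, these are
    commuting operators of order dividing \<open>n = |G|\<close>. Since \<open>n\<close> is invertible and \<open>R\<close> has enough
    roots of unity, every such morphism is a sum of common eigenvectors. For the inclusion of \<open>x\<close>, one
    of them, say \<open>b\<close>, lies outside the radical (\<open>common_eigenvector\<close>), and the eigenvalues form the
    character \<open>\<lambda>\<close> of \<open>H\<close> (\<open>exists_eigenmorphism\<close>).

  \<^item> By Frobenius reciprocity, the eigenvector \<open>b\<close> is the same as an equivariant morphism
    \<open>\<iota> : S\<^sub>\<lambda> x \<rightarrow> A\<close> (\<open>emb_eqv\<close>). The components of \<open>S\<^sub>\<lambda> x\<close> are pairwise non-isomorphic, and each of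
    them is mapped isomorphically to some component of \<open>A\<close>; hence \<open>\<iota>\<close> has a retraction
    (\<open>emb_rows\<close>). Averaging makes the retraction equivariant (\<open>equivariant_retraction\<close>), and its
    kernel is isomorphic to the sum of the remaining components of \<open>A\<close> (\<open>splitting\<close>).

  \<^item> All diagonal entries of an equivariant endomorphism of \<open>S\<^sub>\<lambda> x\<close> are equal, and they are units if
    and only if the endomorphism is invertible. So the endomorphism ring is local because \<open>R\<close> is
    (\<open>S_strongly_indecomposable\<close>).

  Invertibility in the additive hull is always obtained in the same way. A composite of morphisms
  between isomorphic elements of \<open>\<X>\<close> that passes through a non-isomorphic one is divisible by \<open>u\<close>.
  Therefore the morphisms without invertible components form an ideal, the radical, and \<open>1 + f\<close> is
  invertible for every radical endomorphism \<open>f\<close> (\<open>one_plus_rad_invertible\<close>).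
\<close>

section \<open>Roots of unity in a domain\<close>

text \<open>Each root splits off a linear factor. Bounding the finite sets of roots, instead of the set of all
  roots, gives an induction that works over an infinite ring.\<close>

lemma (in UP_domain) card_roots_le_deg:
  assumes "f \<in> carrier P" "f \<noteq> \<zero>\<^bsub>P\<^esub>" "finite Z"
    and "Z \<subseteq> {a \<in> carrier R. eval R R id a f = \<zero>}"
  shows "card Z \<le> deg R f"
  using assms
proof (induction "deg R f" arbitrary: f Z)
  case 0
  have "(\<Oplus>i\<in>{..deg R f}. id (coeff P f i) \<otimes> x [^] i) \<noteq> \<zero>" for x
    using 0(1,2,3) lcoeff_nonzero_nonzero[of f] by simp
  then have "eval R R id x f \<noteq> \<zero>" for x
    using 0 unfolding eval_def P_def by simp
  with 0(5) have "Z = {}" by blast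
  then show ?case by simp
next
  case (Suc d)
  show ?case
  proof (cases "Z = {}")
    case False
    then obtain a where a: "a \<in> Z" by blast
    with Suc.prems have [simp]: "a \<in> carrier R" and a0: "eval R R id a f = \<zero>" by auto
    have nt: "carrier R \<noteq> {\<zero>}"
      by (metis R.one_zeroI R.zero_not_one)
    let ?l = "monom P \<one>\<^bsub>R\<^esub> 1 \<ominus>\<^bsub>P\<^esub> monom P a 0"
    obtain q where q: "q \<in> carrier P" and "f = ?l \<otimes>\<^bsub>P\<^esub> q \<oplus>\<^bsub>P\<^esub> monom P (eval R R id a f) 0"
      using remainder_theorem[OF Suc.prems(1) \<open>a \<in> carrier R\<close> nt] by auto
    then have f: "f = ?l \<otimes>\<^bsub>P\<^esub> q" by (simp add: a0)
    have dl: "deg R ?l = 1" by (simp add: deg_minus_eq)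
    have l0: "?l \<noteq> \<zero>\<^bsub>P\<^esub>" using dl by (metis deg_zero zero_neq_one)
    have q0: "q \<noteq> \<zero>\<^bsub>P\<^esub>" using Suc by (auto simp: f)
    have dq: "deg R q = d"
      using Suc(2) dl deg_mult[OF l0 q0 _ q] by (simp add: f)
    have "Z - {a} \<subseteq> {b \<in> carrier R. eval R R id b q = \<zero>}"
      using Suc.prems(4) q by (auto simp: f evalRR_simps R.integral_iff)
    then have "card (Z - {a}) \<le> d"
      using Suc(1)[OF _ q q0] Suc.prems(3) dq by blast
    then show ?thesis
      using Suc(2) a Suc.prems(3) by (simp add: card_Diff_singleton)
  qed simp
qed

context domain
begin

lemma card_roots_of_unity_le:
  assumes "0 < (k::nat)" "finite Z" "Z \<subseteq> {\<zeta> \<in> carrier R. \<zeta> [^] k = \<one>}"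
  shows "card Z \<le> k"
proof -
  let ?f = "monom (UP R) \<one> k \<ominus>\<^bsub>UP R\<^esub> monom (UP R) \<one> 0"
  interpret R: UP_domain R "UP R" by unfold_locales
  have deg: "deg R ?f = k" using assms(1) by (simp add: R.deg_minus_eq)
  have "?f \<noteq> \<zero>\<^bsub>UP R\<^esub>" using assms(1) deg by (auto simp: R.deg_nzero_nzero)
  moreover have "Z \<subseteq> {a \<in> carrier R. eval R R id a ?f = \<zero>}"
    using assms(3) by (auto simp: R.evalRR_simps)
  ultimately show ?thesis
    using R.card_roots_le_deg[of ?f Z] assms(2) deg by simp
qed

text \<open>The roots of unity form a group on which \<open>\<zeta> \<mapsto> \<zeta> [^] k\<close> is not constantly \<open>\<one>\<close>; multiplying
  the sum by some \<open>\<omega> [^] k \<noteq> \<one>\<close> only permutes its terms.\<close>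

lemma sum_powers_roots_of_unity:
  assumes card: "card {\<zeta> \<in> carrier R. \<zeta> [^] n = \<one>} = n" and "0 < k" "k < n"
  shows "(\<Oplus>\<zeta>\<in>{\<zeta> \<in> carrier R. \<zeta> [^] n = \<one>}. \<zeta> [^] k) = \<zero>"
proof -
  let ?Z = "{\<zeta> \<in> carrier R. \<zeta> [^] n = \<one>}"
  from assms have fin: "finite ?Z" by (metis card.infinite not_less0)
  obtain \<omega> where w: "\<omega> \<in> ?Z" "\<omega> [^] k \<noteq> \<one>"
    using card_roots_of_unity_le[OF assms(2) fin] assms(3) card by fastforce
  let ?s = "\<Oplus>\<zeta>\<in>?Z. \<zeta> [^] k"
  have [simp]: "\<omega> \<in> carrier R" "\<omega> \<noteq> \<zero>"
    using w assms by (auto simp: nat_pow_zero)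
  have s: "?s \<in> carrier R" by (rule finsum_closed) auto
  have inj: "inj_on (\<lambda>\<zeta>. \<omega> \<otimes> \<zeta>) ?Z"
    by (auto simp: inj_on_def m_lcancel)
  moreover have "(\<lambda>\<zeta>. \<omega> \<otimes> \<zeta>) ` ?Z \<subseteq> ?Z"
    using w by (auto simp: nat_pow_distrib)
  ultimately have img: "(\<lambda>\<zeta>. \<omega> \<otimes> \<zeta>) ` ?Z = ?Z"
    using fin by (simp add: endo_inj_surj)
  have "?s = (\<Oplus>\<zeta>\<in>(\<lambda>\<zeta>. \<omega> \<otimes> \<zeta>) ` ?Z. \<zeta> [^] k)" by (simp add: img)
  also have "\<dots> = (\<Oplus>\<zeta>\<in>?Z. (\<omega> \<otimes> \<zeta>) [^] k)"
    by (rule finsum_reindex) (use inj in auto)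
  also have "\<dots> = (\<Oplus>\<zeta>\<in>?Z. \<omega> [^] k \<otimes> \<zeta> [^] k)"
    by (rule finsum_cong') (auto simp: nat_pow_distrib)
  also have "\<dots> = \<omega> [^] k \<otimes> ?s"
    by (rule finsum_rdistr[symmetric]) (use fin in auto)
  finally have "(\<omega> [^] k \<ominus> \<one>) \<otimes> ?s = \<zero>"
    using s by (simp add: a_minus_def l_distr l_minus r_neg)
  moreover have "\<omega> [^] k \<ominus> \<one> \<noteq> \<zero>" using w by simp
  ultimately show ?thesis using s integral by fastforce
qed

end

section \<open>Finite sums in abelian groups and modules\<close>

text \<open>Used for composition with a fixed morphism and for the action of a group element.\<close>

lemma finsum_additive:
  assumes "abelian_group M" "abelian_group N" "finite I" "\<And>i. i \<in> I \<Longrightarrow> f i \<in> carrier M"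
    and cl: "\<And>x. x \<in> carrier M \<Longrightarrow> h x \<in> carrier N"
    and add: "\<And>x y. x \<in> carrier M \<Longrightarrow> y \<in> carrier M \<Longrightarrow> h (x \<oplus>\<^bsub>M\<^esub> y) = h x \<oplus>\<^bsub>N\<^esub> h y"
  shows "h (\<Oplus>\<^bsub>M\<^esub>i\<in>I. f i) = (\<Oplus>\<^bsub>N\<^esub>i\<in>I. h (f i))"
proof -
  interpret M: abelian_group M by fact
  interpret N: abelian_group N by fact
  have h0: "h \<zero>\<^bsub>M\<^esub> = \<zero>\<^bsub>N\<^esub>"
    using add[of "\<zero>\<^bsub>M\<^esub>" "\<zero>\<^bsub>M\<^esub>"] cl[of "\<zero>\<^bsub>M\<^esub>"] by (metis M.add.l_one M.zero_closed N.add.r_cancel_one')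
  show ?thesis
    using assms(3,4)
    by (induction I rule: finite_induct) (simp_all add: h0 M.finsum_insert N.finsum_insert add cl Pi_def)
qed

lemma (in abelian_monoid) finsum_swap:
  assumes "finite I" "finite J" "\<And>i j. i \<in> I \<Longrightarrow> j \<in> J \<Longrightarrow> f i j \<in> carrier G"
  shows "(\<Oplus>i\<in>I. \<Oplus>j\<in>J. f i j) = (\<Oplus>j\<in>J. \<Oplus>i\<in>I. f i j)"
  using assms(1,3)
proof (induction I rule: finite_induct)
  case (insert x F)
  then have "(\<Oplus>j\<in>J. \<Oplus>i\<in>insert x F. f i j) = (\<Oplus>j\<in>J. f x j \<oplus> (\<Oplus>i\<in>F. f i j))"
    by (intro finsum_cong') (auto intro!: finsum_closed simp: finsum_insert)
  also have "\<dots> = (\<Oplus>j\<in>J. f x j) \<oplus> (\<Oplus>j\<in>J. \<Oplus>i\<in>F. f i j)"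
    using insert by (intro finsum_addf) (auto intro!: finsum_closed)
  finally show ?case
    using insert by (subst finsum_insert) (auto intro!: finsum_closed)
qed simp

lemma (in abelian_monoid) finsum_cyclic_shift:
  assumes "\<And>k. k \<le> n \<Longrightarrow> f k \<in> carrier G" "f n = f 0"
  shows "(\<Oplus>k\<in>{..<n}. f (Suc k)) = (\<Oplus>k\<in>{..<n}. f k)"
proof (cases n)
  case (Suc m)
  have "(\<Oplus>k\<in>{..<n}. f (Suc k)) = f n \<oplus> (\<Oplus>k\<in>{..<m}. f (Suc k))"
    using assms Suc by (simp add: lessThan_Suc finsum_insert Pi_def)
  moreover have "{..<n} = insert 0 (Suc ` {..<m})"
    using Suc lessThan_Suc_eq_insert_0 by blast
  moreover have "(\<Oplus>k\<in>Suc ` {..<m}. f k) = (\<Oplus>k\<in>{..<m}. f (Suc k))"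
    using assms Suc by (intro finsum_reindex) auto
  moreover have "(\<Oplus>k\<in>insert 0 (Suc ` {..<m}). f k) = f 0 \<oplus> (\<Oplus>k\<in>Suc ` {..<m}. f k)"
    using assms Suc by (intro finsum_insert) auto
  ultimately show ?thesis using assms(2) by simp
qed simp

lemma (in module) finsum_smult_rdistr:
  assumes "finite A" "f \<in> A \<rightarrow> carrier R" "x \<in> carrier M"
  shows "(\<Oplus>\<^bsub>R\<^esub>i\<in>A. f i) \<odot>\<^bsub>M\<^esub> x = (\<Oplus>\<^bsub>M\<^esub>i\<in>A. f i \<odot>\<^bsub>M\<^esub> x)"
  using assms
  by (induction A rule: finite_induct) (simp_all add: Pi_def smult_l_distr)

section \<open>Common eigenvectors of commuting operators of finite order\<close>

text \<open>For \<open>T\<close> with \<open>T\<^sup>n = 1\<close> and a root of unity \<open>\<zeta>\<close> the vector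
  \<open>\<Sum>k<n. \<zeta>\<^sup>k T\<^sup>k a\<close> is an eigenvector of \<open>T\<close>, and these vectors sum up to \<open>n a\<close>.
  As \<open>n\<close> is invertible, they cannot all lie in a submodule that does not contain \<open>a\<close>. Since
  they are obtained from \<open>a\<close> by operators commuting with the others, \<open>a\<close> can be improved for
  one operator at a time.\<close>

locale operators_of_finite_order = module R M + domain R
  for R (structure) and M (structure) +
  fixes n :: nat and I :: "'i set" and T :: "'i \<Rightarrow> 'c \<Rightarrow> 'c"
  assumes n_pos: "0 < n" and n_unit: "[n] \<cdot>\<^bsub>R\<^esub> \<one>\<^bsub>R\<^esub> \<in> Units R"
    and roots: "card {\<zeta> \<in> carrier R. \<zeta> [^]\<^bsub>R\<^esub> n = \<one>\<^bsub>R\<^esub>} = n"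
    and T_closed: "h \<in> I \<Longrightarrow> x \<in> carrier M \<Longrightarrow> T h x \<in> carrier M"
    and T_add: "h \<in> I \<Longrightarrow> x \<in> carrier M \<Longrightarrow> y \<in> carrier M \<Longrightarrow> T h (x \<oplus>\<^bsub>M\<^esub> y) = T h x \<oplus>\<^bsub>M\<^esub> T h y"
    and T_smult: "h \<in> I \<Longrightarrow> r \<in> carrier R \<Longrightarrow> x \<in> carrier M \<Longrightarrow> T h (r \<odot>\<^bsub>M\<^esub> x) = r \<odot>\<^bsub>M\<^esub> T h x"
    and T_commute: "h \<in> I \<Longrightarrow> k \<in> I \<Longrightarrow> x \<in> carrier M \<Longrightarrow> T h (T k x) = T k (T h x)"
    and T_order: "h \<in> I \<Longrightarrow> x \<in> carrier M \<Longrightarrow> (T h ^^ n) x = x"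
begin

text \<open>Up to the factor \<open>n\<close>, the projection to the eigenspace of \<open>T h\<close> for the eigenvalue \<open>\<zeta>\<^sup>-\<^sup>1\<close>.\<close>

definition eig :: "'i \<Rightarrow> 'a \<Rightarrow> 'c \<Rightarrow> 'c" where
  "eig h \<zeta> a = (\<Oplus>\<^bsub>M\<^esub>k\<in>{..<n}. \<zeta> [^]\<^bsub>R\<^esub> k \<odot>\<^bsub>M\<^esub> (T h ^^ k) a)"

lemma T_pow_closed: "h \<in> I \<Longrightarrow> x \<in> carrier M \<Longrightarrow> (T h ^^ k) x \<in> carrier M"
  by (induction k) (auto simp: T_closed)

lemma T_finsum:
  assumes "h \<in> I" "finite K" "\<And>k. k \<in> K \<Longrightarrow> f k \<in> carrier M"
  shows "T h (\<Oplus>\<^bsub>M\<^esub>k\<in>K. f k) = (\<Oplus>\<^bsub>M\<^esub>k\<in>K. T h (f k))"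
proof -
  have "abelian_group M" by unfold_locales
  then show ?thesis
    by (intro finsum_additive[where h = "T h"]) (use assms in \<open>auto simp: T_closed T_add\<close>)
qed

lemma eig_closed:
  "h \<in> I \<Longrightarrow> \<zeta> \<in> carrier R \<Longrightarrow> a \<in> carrier M \<Longrightarrow> eig h \<zeta> a \<in> carrier M"
  unfolding eig_def by (rule M.finsum_closed) (auto simp: T_pow_closed)

text \<open>The operator \<open>\<zeta> T\<close> shifts the index in the defining sum by one, which changes nothing because
  \<open>\<zeta>\<^sup>n T\<^sup>n = 1\<close>. The power \<open>\<zeta>\<^sup>n\<^sup>-\<^sup>1\<close> is \<open>\<zeta>\<^sup>-\<^sup>1\<close>.\<close>

lemma T_eig:
  assumes "h \<in> I" "\<zeta> \<in> carrier R" "\<zeta> [^]\<^bsub>R\<^esub> n = \<one>\<^bsub>R\<^esub>" "a \<in> carrier M"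
  shows "T h (eig h \<zeta> a) = \<zeta> [^]\<^bsub>R\<^esub> (n - 1) \<odot>\<^bsub>M\<^esub> eig h \<zeta> a"
proof -
  let ?f = "\<lambda>k. \<zeta> [^]\<^bsub>R\<^esub> k \<odot>\<^bsub>M\<^esub> (T h ^^ k) a"
  have f: "?f k \<in> carrier M" for k using assms T_pow_closed by simp
  have e: "eig h \<zeta> a \<in> carrier M" using assms eig_closed by blast
  have "\<zeta> \<odot>\<^bsub>M\<^esub> T h (eig h \<zeta> a) = (\<Oplus>\<^bsub>M\<^esub>k\<in>{..<n}. \<zeta> \<odot>\<^bsub>M\<^esub> T h (?f k))"
    unfolding eig_def using assms f T_closed by (simp add: T_finsum finsum_smult_ldistr)
  also have "\<dots> = (\<Oplus>\<^bsub>M\<^esub>k\<in>{..<n}. ?f (Suc k))"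
    using assms T_pow_closed[OF assms(1,4)] f
    by (intro M.finsum_cong') (auto simp: T_smult T_closed m_comm simp flip: smult_assoc1)
  also have "\<dots> = eig h \<zeta> a"
    unfolding eig_def using f assms by (intro M.finsum_cyclic_shift) (auto simp: T_order)
  finally have 1: "\<zeta> \<odot>\<^bsub>M\<^esub> T h (eig h \<zeta> a) = eig h \<zeta> a" .
  have "\<zeta> [^]\<^bsub>R\<^esub> (n - 1) \<otimes>\<^bsub>R\<^esub> \<zeta> = \<one>\<^bsub>R\<^esub>"
    using assms(3) n_pos by (metis R.nat_pow_Suc Suc_diff_1)
  then have "T h (eig h \<zeta> a) = (\<zeta> [^]\<^bsub>R\<^esub> (n - 1) \<otimes>\<^bsub>R\<^esub> \<zeta>) \<odot>\<^bsub>M\<^esub> T h (eig h \<zeta> a)"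
    using e assms T_closed by simp
  then show ?thesis
    using 1 e assms T_closed by (simp add: smult_assoc1)
qed

text \<open>The power sums of the roots of unity vanish except for \<open>k = 0\<close>, which contributes \<open>n a\<close>.\<close>

lemma sum_eig:
  assumes "h \<in> I" "a \<in> carrier M"
  shows "(\<Oplus>\<^bsub>M\<^esub>\<zeta>\<in>{\<zeta> \<in> carrier R. \<zeta> [^]\<^bsub>R\<^esub> n = \<one>\<^bsub>R\<^esub>}. eig h \<zeta> a) = ([n] \<cdot>\<^bsub>R\<^esub> \<one>\<^bsub>R\<^esub>) \<odot>\<^bsub>M\<^esub> a"
proof -
  let ?Z = "{\<zeta> \<in> carrier R. \<zeta> [^]\<^bsub>R\<^esub> n = \<one>\<^bsub>R\<^esub>}"
  let ?b = "\<lambda>k. (T h ^^ k) a"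
  have card: "card ?Z = n" by (rule roots)
  with n_pos have fin: "finite ?Z" by (metis card.infinite less_irrefl)
  have b: "?b k \<in> carrier M" for k using assms T_pow_closed by simp
  have "(\<Oplus>\<^bsub>M\<^esub>\<zeta>\<in>?Z. eig h \<zeta> a) = (\<Oplus>\<^bsub>M\<^esub>k\<in>{..<n}. \<Oplus>\<^bsub>M\<^esub>\<zeta>\<in>?Z. \<zeta> [^]\<^bsub>R\<^esub> k \<odot>\<^bsub>M\<^esub> ?b k)"
    unfolding eig_def using fin b by (intro M.finsum_swap) auto
  also have "\<dots> = (\<Oplus>\<^bsub>M\<^esub>k\<in>{..<n}. (\<Oplus>\<^bsub>R\<^esub>\<zeta>\<in>?Z. \<zeta> [^]\<^bsub>R\<^esub> k) \<odot>\<^bsub>M\<^esub> ?b k)"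
    using fin b by (intro M.finsum_cong') (auto intro!: finsum_smult_rdistr[symmetric] R.finsum_closed)
  also have "\<dots> = (\<Oplus>\<^bsub>M\<^esub>k\<in>{..<n}. if k = 0 then ([n] \<cdot>\<^bsub>R\<^esub> \<one>\<^bsub>R\<^esub>) \<odot>\<^bsub>M\<^esub> a else \<zero>\<^bsub>M\<^esub>)"
    using b assms(2) card roots
    by (intro M.finsum_cong') (auto simp: sum_powers_roots_of_unity R.add.finprod_const)
  also have "\<dots> = ([n] \<cdot>\<^bsub>R\<^esub> \<one>\<^bsub>R\<^esub>) \<odot>\<^bsub>M\<^esub> a"
    using n_pos assms(2) M.add.finprod_singleton_swap[of 0 "{..<n}" "\<lambda>_. ([n] \<cdot>\<^bsub>R\<^esub> \<one>\<^bsub>R\<^esub>) \<odot>\<^bsub>M\<^esub> a"]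
    by simp
  finally show ?thesis .
qed

lemma eig_keeps_eigenvectors:
  assumes "h \<in> I" "k \<in> I" "\<zeta> \<in> carrier R" "a \<in> carrier M" "r \<in> carrier R" "T k a = r \<odot>\<^bsub>M\<^esub> a"
  shows "T k (eig h \<zeta> a) = r \<odot>\<^bsub>M\<^esub> eig h \<zeta> a"
proof -
  have "T k ((T h ^^ i) a) = r \<odot>\<^bsub>M\<^esub> (T h ^^ i) a" for i
    by (induction i) (use assms in \<open>auto simp: T_commute[of k h] T_pow_closed T_smult\<close>)
  then show ?thesis
    unfolding eig_def using assms T_pow_closed[OF assms(1,4)] T_closed
    by (simp add: T_finsum finsum_smult_ldistr T_smult)
      (intro M.finsum_cong', auto simp: m_comm simp flip: smult_assoc1)
qed

lemma common_eigenvector: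
  assumes "submodule N R M" "a \<in> carrier M - N" "finite J" "J \<subseteq> I"
  shows "\<exists>b\<in>carrier M - N. \<forall>h\<in>J. \<exists>\<zeta>\<in>Units R. T h b = \<zeta> \<odot>\<^bsub>M\<^esub> b"
  using assms(3,4)
proof (induction J rule: finite_induct)
  case empty
  then show ?case using assms(2) by blast
next
  case (insert h J)
  then obtain b where b: "b \<in> carrier M - N" "\<forall>h\<in>J. \<exists>\<zeta>\<in>Units R. T h b = \<zeta> \<odot>\<^bsub>M\<^esub> b" by auto
  let ?Z = "{\<zeta> \<in> carrier R. \<zeta> [^]\<^bsub>R\<^esub> n = \<one>\<^bsub>R\<^esub>}"
  have "\<exists>\<zeta>\<in>?Z. eig h \<zeta> b \<notin> N"
  proof (rule ccontr)
    assume "\<not> ?thesis"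
    then have N: "eig h \<zeta> b \<in> N" if "\<zeta> \<in> ?Z" for \<zeta> using that by blast
    have "(\<Oplus>\<^bsub>M\<^esub>\<zeta>\<in>K. eig h \<zeta> b) \<in> N" if "finite K" "K \<subseteq> ?Z" for K
      using that
    proof (induction K rule: finite_induct)
      case empty
      then show ?case
        using subgroup.one_closed[OF submodule.axioms(1)[OF assms(1)]] by simp
    next
      case (insert \<zeta> K)
      have "eig h \<xi> b \<in> carrier M" if "\<xi> \<in> insert \<zeta> K" for \<xi>
        using that insert.prems \<open>insert h J \<subseteq> I\<close> b(1) by (intro eig_closed) auto
      then have "(\<Oplus>\<^bsub>M\<^esub>\<zeta>\<in>insert \<zeta> K. eig h \<zeta> b) = eig h \<zeta> b \<oplus>\<^bsub>M\<^esub> (\<Oplus>\<^bsub>M\<^esub>\<zeta>\<in>K. eig h \<zeta> b)"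
        using insert.hyps by (intro M.finsum_insert) auto
      moreover have "(\<Oplus>\<^bsub>M\<^esub>\<zeta>\<in>K. eig h \<zeta> b) \<in> N"
        using insert.IH insert.prems by simp
      moreover have "eig h \<zeta> b \<in> N"
        using N insert.prems by simp
      ultimately show ?case
        using submoduleE(5)[OF assms(1)] by simp
    qed
    moreover have "finite ?Z"
      using roots n_pos by (metis card.infinite less_irrefl)
    ultimately have "(\<Oplus>\<^bsub>M\<^esub>\<zeta>\<in>?Z. eig h \<zeta> b) \<in> N" by simp
    then have "([n] \<cdot>\<^bsub>R\<^esub> \<one>\<^bsub>R\<^esub>) \<odot>\<^bsub>M\<^esub> b \<in> N"
      using sum_eig[of h b] insert.prems b(1) by simp
    then have "inv\<^bsub>R\<^esub> ([n] \<cdot>\<^bsub>R\<^esub> \<one>\<^bsub>R\<^esub>) \<odot>\<^bsub>M\<^esub> (([n] \<cdot>\<^bsub>R\<^esub> \<one>\<^bsub>R\<^esub>) \<odot>\<^bsub>M\<^esub> b) \<in> N"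
      by (rule submoduleE(4)[OF assms(1) R.Units_inv_closed[OF n_unit]])
    moreover have "inv\<^bsub>R\<^esub> ([n] \<cdot>\<^bsub>R\<^esub> \<one>\<^bsub>R\<^esub>) \<odot>\<^bsub>M\<^esub> (([n] \<cdot>\<^bsub>R\<^esub> \<one>\<^bsub>R\<^esub>) \<odot>\<^bsub>M\<^esub> b) = b"
      using smult_assoc1[of "inv\<^bsub>R\<^esub> ([n] \<cdot>\<^bsub>R\<^esub> \<one>\<^bsub>R\<^esub>)" "[n] \<cdot>\<^bsub>R\<^esub> \<one>\<^bsub>R\<^esub>" b] n_unit b(1)
      by (simp add: R.Units_inv_closed R.Units_l_inv)
    ultimately show False using b(1) by simp
  qed
  then obtain \<zeta> where z: "\<zeta> \<in> carrier R" "\<zeta> [^]\<^bsub>R\<^esub> n = \<one>\<^bsub>R\<^esub>" "eig h \<zeta> b \<notin> N" by blast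
  have h: "h \<in> I" "J \<subseteq> I" using insert.prems by auto
  have "\<zeta> [^]\<^bsub>R\<^esub> (n - 1) \<otimes>\<^bsub>R\<^esub> \<zeta> = \<one>\<^bsub>R\<^esub>"
    using z(2) n_pos R.nat_pow_Suc[of \<zeta> "n - 1"] by simp
  then have u: "\<zeta> [^]\<^bsub>R\<^esub> (n - 1) \<in> Units R"
    using z(1) R.m_comm[of "\<zeta> [^]\<^bsub>R\<^esub> (n - 1)" \<zeta>] unfolding Units_def by auto
  have "\<exists>\<zeta>'\<in>Units R. T k (eig h \<zeta> b) = \<zeta>' \<odot>\<^bsub>M\<^esub> eig h \<zeta> b" if "k \<in> insert h J" for k
  proof (cases "k = h")
    case True
    then show ?thesis using u T_eig[of h \<zeta> b] h z b(1) by auto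
  next
    case False
    then obtain r where r: "r \<in> Units R" "T k b = r \<odot>\<^bsub>M\<^esub> b" using \<open>k \<in> insert h J\<close> b(2) by auto
    moreover have "k \<in> I" using False \<open>k \<in> insert h J\<close> h by auto
    ultimately have "T k (eig h \<zeta> b) = r \<odot>\<^bsub>M\<^esub> eig h \<zeta> b"
      using eig_keeps_eigenvectors[of h k \<zeta> b r] h(1) z(1) b(1) R.Units_closed[OF r(1)] by simp
    then show ?thesis using r by blast
  qed
  then show ?case
    using z b(1) h eig_closed[of h \<zeta> b] by (intro bexI[of _ "eig h \<zeta> b"]) auto
qed

end

section \<open>Discrete valuation rings\<close>

context
  fixes R :: "'r ring" (structure)
  assumes dvr: "discrete_valuation_ring R"
begin

text \<open>A nonzero nonunit has an irreducible divisor, and irreducible elements of a principal domain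
  generate maximal ideals; there is only one of these.\<close>

lemma nonunit_iff_maximalideal:
  assumes "maximalideal m R" "a \<in> carrier R"
  shows "a \<notin> Units R \<longleftrightarrow> a \<in> m"
proof -
  interpret principal_domain R using dvr by (simp add: discrete_valuation_ring_def)
  interpret m: maximalideal m R by fact
  have uniq: "m' = m" if "maximalideal m' R" for m'
    using dvr that assms(1) unfolding discrete_valuation_ring_def by blast
  show ?thesis
  proof
    assume nu: "a \<notin> Units R"
    show "a \<in> m"
    proof (cases "a = \<zero>")
      case False
      then obtain p where p: "p \<in> carrier R" "ring_irreducible p" "p divides a"
        using exists_irreducible_divisor nu assms(2) by blast
      then have "PIdl p = m" using irreducible_imp_maximalideal uniq by blast
      then have "p \<in> m" using cgenideal_self p(1) by blast
      moreover obtain b where "b \<in> carrier R" "a = p \<otimes> b" using p(3) by (auto simp: factor_def)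
      ultimately show ?thesis using m.I_r_closed by simp
    qed simp
  next
    assume "a \<in> m"
    then show "a \<notin> Units R"
      using m.I_r_closed[of a "inv a"] m.one_imp_carrier m.I_notcarr assms(2)
      by (metis Units_inv_closed Units_r_inv)
  qed
qed

lemma nonunits_add_closed:
  assumes "a \<in> carrier R" "b \<in> carrier R" "a \<notin> Units R" "b \<notin> Units R"
  shows "a \<oplus> b \<notin> Units R"
proof -
  obtain m where m: "maximalideal m R" using dvr by (auto simp: discrete_valuation_ring_def)
  interpret m: maximalideal m R by fact
  have "a \<oplus> b \<in> m"
    using assms nonunit_iff_maximalideal[OF m]
    by (intro additive_subgroup.a_closed[OF m.additive_subgroup_axioms]) auto
  then show ?thesis
    using nonunit_iff_maximalideal[OF m, of "a \<oplus> b"] assms(1,2) m.ring_axioms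
    by (simp add: ring.ring_simprules(1))
qed

lemma uniformizer_nonunit: "uniformizer R u \<Longrightarrow> u \<notin> Units R"
proof -
  interpret principal_domain R using dvr by (simp add: discrete_valuation_ring_def)
  show "uniformizer R u \<Longrightarrow> u \<notin> Units R"
    using nonunit_iff_maximalideal[of "PIdl u" u] cgenideal_self[of u] unfolding uniformizer_def by blast
qed

text \<open>The residue field sees \<open>n\<close> as a nonzero element, so that \<open>n\<close> lies outside the
  maximal ideal.\<close>

lemma of_nat_unit:
  assumes "\<not> ring_characteristic (residue_field R) dvd n"
  shows "[n] \<cdot> \<one> \<in> Units R"
proof (rule ccontr)
  assume nu: "[n] \<cdot> \<one> \<notin> Units R"
  interpret principal_domain R using dvr by (simp add: discrete_valuation_ring_def)
  define m where "m = (THE m. maximalideal m R)"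
  have m: "maximalideal m R"
    unfolding m_def by (rule theI') (use dvr in \<open>simp add: discrete_valuation_ring_def\<close>)
  then interpret m: maximalideal m R .
  have "ring_hom_ring R (R Quot m) ((+>) m)"
    by (rule m.rcos_ring_hom_ring)
  then interpret h: ring_hom_ring R "R Quot m" "(+>) m" .
  have "[n] \<cdot> \<one> \<in> m"
    using nu nonunit_iff_maximalideal[OF m add.nat_pow_closed[OF one_closed, of n]] by simp
  then have "m +> ([n] \<cdot> \<one>) = m" by (rule m.a_rcos_const)
  then have 0: "m +> ([n] \<cdot> \<one>) = \<zero>\<^bsub>R Quot m\<^esub>"
    unfolding FactRing_def ring.simps .
  have "m +> ([k] \<cdot> \<one>) = [k] \<cdot>\<^bsub>R Quot m\<^esub> \<one>\<^bsub>R Quot m\<^esub>" for k :: nat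
  proof (induction k)
    case 0
    show ?case using h.hom_zero by (simp only: add.nat_pow_0 h.S.add.nat_pow_0)
  next
    case (Suc k)
    have "m +> ([k] \<cdot> \<one> \<oplus> \<one>) = (m +> ([k] \<cdot> \<one>)) \<oplus>\<^bsub>R Quot m\<^esub> (m +> \<one>)"
      by (rule h.hom_add) auto
    then show ?case using Suc h.hom_one by (simp only: add.nat_pow_Suc h.S.add.nat_pow_Suc)
  qed
  with 0 have "[n] \<cdot>\<^bsub>R Quot m\<^esub> \<one>\<^bsub>R Quot m\<^esub> = \<zero>\<^bsub>R Quot m\<^esub>" by metis
  then have "group.ord (add_monoid (R Quot m)) \<one>\<^bsub>R Quot m\<^esub> dvd n"
    using h.S.add.pow_eq_id[OF h.S.one_closed, of n] by metis
  moreover have "\<not> group.ord (add_monoid (R Quot m)) \<one>\<^bsub>R Quot m\<^esub> dvd n"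
    using assms unfolding ring_characteristic_def residue_field_def m_def .
  ultimately show False by (rule notE[rotated])
qed

end

section \<open>The additive hull of a cyclic poset\<close>

(* The condition A \<in> lists \<X> stays atomic: unfolding it to a statement about all
   members of A would hide it from the simplification rules below. *)
declare in_listsD [rule del] in_listsI [rule del]
declare elements_matD [rule del] elements_matI [rule del]

lemma (in abelian_monoid) finsum_single:
  assumes "finite I" "k \<in> I" "f k \<in> carrier G" "\<And>i. i \<in> I \<Longrightarrow> i \<noteq> k \<Longrightarrow> f i = \<zero>"
  shows "(\<Oplus>i\<in>I. f i) = f k"
proof -
  have "(\<Oplus>i\<in>I. f i) = (\<Oplus>i\<in>I. if k = i then f k else \<zero>)"
    using assms by (intro finsum_cong') auto
  also have "\<dots> = f k"
    using finsum_singleton[of k I "\<lambda>_. f k"] assms by simp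
  finally show ?thesis .
qed

lemma category_id:
  assumes "category C" "A \<in> cat_obj C" "B \<in> cat_obj C" "f \<in> cat_hom C A B"
  shows "f \<circ>\<^bsub>C\<^esub> cat_id C A = f" "cat_id C B \<circ>\<^bsub>C\<^esub> f = f"
  using assms unfolding category_def by blast+

lemma category_assoc:
  assumes "category C" "A \<in> cat_obj C" "B \<in> cat_obj C" "D \<in> cat_obj C" "E \<in> cat_obj C"
    and "f \<in> cat_hom C A B" "g \<in> cat_hom C B D" "h \<in> cat_hom C D E"
  shows "(h \<circ>\<^bsub>C\<^esub> g) \<circ>\<^bsub>C\<^esub> f = h \<circ>\<^bsub>C\<^esub> (g \<circ>\<^bsub>C\<^esub> f)"
  using assms unfolding category_def by blast

lemma preadditive_distrib:
  assumes "preadditive C" "A \<in> cat_obj C" "B \<in> cat_obj C" "D \<in> cat_obj C"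
    and "f \<in> cat_hom C A B" "f' \<in> cat_hom C A B" "g \<in> cat_hom C B D" "g' \<in> cat_hom C B D"
  shows "g \<circ>\<^bsub>C\<^esub> cat_add C f f' = cat_add C (g \<circ>\<^bsub>C\<^esub> f) (g \<circ>\<^bsub>C\<^esub> f')"
    and "cat_add C g g' \<circ>\<^bsub>C\<^esub> f = cat_add C (g \<circ>\<^bsub>C\<^esub> f) (g' \<circ>\<^bsub>C\<^esub> f)"
  using assms unfolding preadditive_def by blast+

text \<open>Locality of \<open>R\<close> is expressed by its nonunits being closed under addition. The axioms of a
  preadditive category, for instance associativity of the twisted matrix product, are part of
  every Frobenius structure.\<close>

locale cyclic_hull = domain R for R :: "'r ring" (structure) +
  fixes u :: 'r and \<X> :: "'x set" and c :: "'x \<Rightarrow> 'x \<Rightarrow> 'x \<Rightarrow> nat"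
  assumes cp: "cyclic_poset \<X> c" and preadd: "preadditive (addP R u \<X> c)"
    and u_closed: "u \<in> carrier R" and u_nonunit: "u \<notin> Units R"
    and nonunit_add: "\<lbrakk>a \<in> carrier R; b \<in> carrier R; a \<notin> Units R; b \<notin> Units R\<rbrakk> \<Longrightarrow> a \<oplus> b \<notin> Units R"
begin

subsection \<open>Isomorphic elements\<close>

lemma cocycle:
  "\<lbrakk>w \<in> \<X>; x \<in> \<X>; y \<in> \<X>; z \<in> \<X>\<rbrakk> \<Longrightarrow> c x y z + c w x z = c w y z + c w x y"
proof -
  assume a: "w \<in> \<X>" "x \<in> \<X>" "y \<in> \<X>" "z \<in> \<X>"
  then have "int (c x y z) - int (c w y z) + int (c w x z) - int (c w x y) = 0"
    using cp unfolding cyclic_poset_def by blast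
  then show ?thesis by linarith
qed

lemma cocycle_diag [simp]: "x \<in> \<X> \<Longrightarrow> y \<in> \<X> \<Longrightarrow> c x x y = 0" "x \<in> \<X> \<Longrightarrow> y \<in> \<X> \<Longrightarrow> c x y y = 0"
  using cp unfolding cyclic_poset_def by auto

lemma iso_refl [simp]: "x \<in> \<X> \<Longrightarrow> cp_iso c x x"
  by (simp add: cp_iso_def)

lemma iso_sym: "x \<in> \<X> \<Longrightarrow> y \<in> \<X> \<Longrightarrow> cp_iso c x y \<Longrightarrow> cp_iso c y x"
  using cocycle[of y x y x] by (simp add: cp_iso_def)

text \<open>The exponent \<open>c x y z\<close> measures how far the composite of the basic morphisms \<open>x \<rightarrow> y \<rightarrow> z\<close> is from
  being basic. It vanishes if one of the two is an isomorphism, and it is that of a round trip if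
  the composite goes between isomorphic elements.\<close>

lemma cocycle_iso12: "\<lbrakk>x \<in> \<X>; y \<in> \<X>; z \<in> \<X>; cp_iso c x y\<rbrakk> \<Longrightarrow> c x y z = 0"
  using cocycle[of y x y z] iso_sym[of x y] by (simp add: cp_iso_def)

lemma cocycle_iso23: "\<lbrakk>x \<in> \<X>; y \<in> \<X>; z \<in> \<X>; cp_iso c y z\<rbrakk> \<Longrightarrow> c x y z = 0"
  using cocycle[of x y z y] by (simp add: cp_iso_def)

lemma cocycle_iso13: "\<lbrakk>x \<in> \<X>; y \<in> \<X>; z \<in> \<X>; cp_iso c x z\<rbrakk> \<Longrightarrow> c x y z = c x y x"
  using cocycle[of x y z x] cocycle_iso23[of y z x] iso_sym[of x z] by (simp add: cp_iso_def)

lemma iso_trans: "\<lbrakk>x \<in> \<X>; y \<in> \<X>; z \<in> \<X>; cp_iso c x y; cp_iso c y z\<rbrakk> \<Longrightarrow> cp_iso c x z"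
  using cocycle[of x y z x] cocycle_iso12[of y z x] cocycle_iso12[of x y z]
  by (simp add: cp_iso_def)

subsection \<open>Morphisms and their entries\<close>

abbreviation C :: "('x list, ('x, 'r) mor) add_cat" where "C \<equiv> addP R u \<X> c"

abbreviation cmp :: "('x, 'r) mor \<Rightarrow> ('x, 'r) mor \<Rightarrow> ('x, 'r) mor" (infixr "\<star>" 70) where
  "g \<star> f \<equiv> mor_comp R u c g f"

abbreviation ent :: "('x, 'r) mor \<Rightarrow> nat \<Rightarrow> nat \<Rightarrow> 'r" where
  "ent f j i \<equiv> coeffs f $$ (j, i)"

text \<open>The morphisms of the additive hull, whatever their source and target. Since a morphism carries
  both of them, most conditions become equations that the simplifier can decide.\<close>

definition Ar :: "('x, 'r) mor set" where
  "Ar = {f. src f \<in> lists \<X> \<and> tgt f \<in> lists \<X> \<and>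
     coeffs f \<in> carrier_mat (length (tgt f)) (length (src f)) \<and> elements_mat (coeffs f) \<subseteq> carrier R}"

definition mk :: "'x list \<Rightarrow> 'x list \<Rightarrow> (nat \<Rightarrow> nat \<Rightarrow> 'r) \<Rightarrow> ('x, 'r) mor" where
  "mk A B F = Mor A B (mat (length B) (length A) (\<lambda>(j, i). F j i))"

definition ide :: "'x list \<Rightarrow> ('x, 'r) mor" where
  "ide A = mk A A (\<lambda>j i. if j = i then \<one> else \<zero>)"

definition null :: "'x list \<Rightarrow> 'x list \<Rightarrow> ('x, 'r) mor" where
  "null A B = mk A B (\<lambda>_ _. \<zero>)"

definition plus :: "('x, 'r) mor \<Rightarrow> ('x, 'r) mor \<Rightarrow> ('x, 'r) mor" (infixl "\<boxplus>" 65) where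
  "f \<boxplus> g = mk (src f) (tgt f) (\<lambda>j i. ent f j i \<oplus> ent g j i)"

definition scal :: "'r \<Rightarrow> ('x, 'r) mor \<Rightarrow> ('x, 'r) mor" where
  "scal r f = mk (src f) (tgt f) (\<lambda>j i. r \<otimes> ent f j i)"

lemma mk_simps [simp]:
  "src (mk A B F) = A" "tgt (mk A B F) = B"
  "j < length B \<Longrightarrow> i < length A \<Longrightarrow> ent (mk A B F) j i = F j i"
  by (simp_all add: mk_def)

lemma Ar_mk [intro]:
  assumes "A \<in> lists \<X>" "B \<in> lists \<X>"
    and "\<And>j i. j < length B \<Longrightarrow> i < length A \<Longrightarrow> F j i \<in> carrier R"
  shows "mk A B F \<in> Ar"
  using assms by (auto simp: Ar_def mk_def elements_mat_def)

lemma Ar_src [simp]: "f \<in> Ar \<Longrightarrow> src f \<in> lists \<X>"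
  and Ar_tgt [simp]: "f \<in> Ar \<Longrightarrow> tgt f \<in> lists \<X>"
  by (simp_all add: Ar_def)

lemma nth_lists [simp]: "A \<in> lists \<X> \<Longrightarrow> i < length A \<Longrightarrow> A ! i \<in> \<X>"
  by (simp add: in_lists_conv_set)

lemma ent_closed [simp]:
  assumes "f \<in> Ar" "j < length (tgt f)" "i < length (src f)"
  shows "ent f j i \<in> carrier R"
proof -
  have "ent f j i \<in> elements_mat (coeffs f)"
    using assms unfolding Ar_def by (intro elements_matI) auto
  then show ?thesis using assms unfolding Ar_def by blast
qed

lemma mor_eqI:
  assumes "f \<in> Ar" "g \<in> Ar" "src f = src g" "tgt f = tgt g"
    and "\<And>j i. j < length (tgt g) \<Longrightarrow> i < length (src g) \<Longrightarrow> ent f j i = ent g j i"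
  shows "f = g"
  using assms unfolding Ar_def by (intro mor.expand) auto

lemma hom_iff:
  "A \<in> lists \<X> \<Longrightarrow> B \<in> lists \<X> \<Longrightarrow> f \<in> cat_hom C A B \<longleftrightarrow> f \<in> Ar \<and> src f = A \<and> tgt f = B"
proof -
  assume "A \<in> lists \<X>" "B \<in> lists \<X>"
  moreover have "f \<in> cat_hom C A B \<longleftrightarrow> (\<exists>M. f = Mor A B M \<and>
      M \<in> carrier_mat (length B) (length A) \<and> elements_mat M \<subseteq> carrier R)"
    by (simp add: addP_def)
  moreover have "(\<exists>M. f = Mor A B M \<and> P M) \<longleftrightarrow> src f = A \<and> tgt f = B \<and> P (coeffs f)" for P
    by (cases f) auto
  ultimately show ?thesis
    unfolding Ar_def by auto
qed

lemma C_simps [simp]: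
  "cat_obj C = lists \<X>" "cat_comp C = (\<star>)" "cat_id C A = ide A" "cat_zero C A B = null A B"
  "cat_add C f g = f \<boxplus> g"
  by (simp_all add: addP_def ide_def null_def plus_def mk_def split_def)

lemma ide_simps [simp]: "src (ide A) = A" "tgt (ide A) = A"
  "j < length A \<Longrightarrow> i < length A \<Longrightarrow> ent (ide A) j i = (if j = i then \<one> else \<zero>)"
  "A \<in> lists \<X> \<Longrightarrow> ide A \<in> Ar"
  by (auto simp: ide_def)

lemma null_simps [simp]: "src (null A B) = A" "tgt (null A B) = B"
  "j < length B \<Longrightarrow> i < length A \<Longrightarrow> ent (null A B) j i = \<zero>"
  "A \<in> lists \<X> \<Longrightarrow> B \<in> lists \<X> \<Longrightarrow> null A B \<in> Ar"
  by (auto simp: null_def)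

lemma plus_simps [simp]: "src (f \<boxplus> g) = src f" "tgt (f \<boxplus> g) = tgt f"
  "j < length (tgt f) \<Longrightarrow> i < length (src f) \<Longrightarrow> ent (f \<boxplus> g) j i = ent f j i \<oplus> ent g j i"
  by (auto simp: plus_def)

lemma plus_Ar [simp]: "\<lbrakk>f \<in> Ar; g \<in> Ar; src g = src f; tgt g = tgt f\<rbrakk> \<Longrightarrow> f \<boxplus> g \<in> Ar"
  unfolding plus_def by (rule Ar_mk) (auto intro: ent_closed)

lemma scal_simps [simp]: "src (scal r f) = src f" "tgt (scal r f) = tgt f"
  "j < length (tgt f) \<Longrightarrow> i < length (src f) \<Longrightarrow> ent (scal r f) j i = r \<otimes> ent f j i"
  "f \<in> Ar \<Longrightarrow> r \<in> carrier R \<Longrightarrow> scal r f \<in> Ar"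
  unfolding scal_def by (auto intro!: Ar_mk)

lemma comp_simps [simp]: "src (g \<star> f) = src f" "tgt (g \<star> f) = tgt g"
  by (simp_all add: mor_comp_def)

lemma ent_comp:
  "k < length (tgt g) \<Longrightarrow> i < length (src f) \<Longrightarrow> ent (g \<star> f) k i =
     (\<Oplus>j\<in>{..<length (tgt f)}. u [^] c (src f ! i) (tgt f ! j) (tgt g ! k) \<otimes> (ent g k j \<otimes> ent f j i))"
  by (simp add: mor_comp_def)

lemma comp_Ar [simp]:
  assumes "f \<in> Ar" "g \<in> Ar" "src g = tgt f"
  shows "g \<star> f \<in> Ar"
proof -
  have "g \<star> f = mk (src f) (tgt g) (\<lambda>k i. ent (g \<star> f) k i)"
    by (auto simp: mk_def mor_comp_def intro!: eq_matI)
  also have "\<dots> \<in> Ar"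
    using assms u_closed by (intro Ar_mk) (auto simp: ent_comp intro!: finsum_closed)
  finally show ?thesis .
qed

text \<open>In most products below, at most one intermediate summand contributes to a given entry.\<close>

lemma ent_comp_single:
  assumes "f \<in> Ar" "g \<in> Ar" "src g = tgt f" "k < length (tgt g)" "i < length (src f)"
    and "j < length (tgt f)"
    and "\<And>j'. j' < length (tgt f) \<Longrightarrow> j' \<noteq> j \<Longrightarrow> ent g k j' = \<zero> \<or> ent f j' i = \<zero>"
  shows "ent (g \<star> f) k i =
    u [^] c (src f ! i) (tgt f ! j) (tgt g ! k) \<otimes> (ent g k j \<otimes> ent f j i)"
  unfolding ent_comp[OF assms(4,5)]
proof (rule finsum_single)
  fix j' assume j': "j' \<in> {..<length (tgt f)}" "j' \<noteq> j"
  then have "ent g k j' \<in> carrier R" "ent f j' i \<in> carrier R" using assms by auto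
  then show "u [^] c (src f ! i) (tgt f ! j') (tgt g ! k) \<otimes> (ent g k j' \<otimes> ent f j' i) = \<zero>"
    using assms(7)[of j'] j' u_closed by auto
qed (use assms u_closed in auto)

lemma category: "category C"
  using preadd by (simp add: preadditive_def)

lemma comp_ide [simp]:
  "f \<in> Ar \<Longrightarrow> A = src f \<Longrightarrow> f \<star> ide A = f"
  "f \<in> Ar \<Longrightarrow> B = tgt f \<Longrightarrow> ide B \<star> f = f"
  using category_id[OF category, of "src f" "tgt f" f] by (simp_all add: hom_iff)

lemma comp_assoc [simp]:
  "\<lbrakk>f \<in> Ar; g \<in> Ar; h \<in> Ar; src g = tgt f; src h = tgt g\<rbrakk> \<Longrightarrow> (h \<star> g) \<star> f = h \<star> (g \<star> f)"
  using category_assoc[OF category, of "src f" "tgt f" "tgt g" "tgt h" f g h] by (simp add: hom_iff)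

lemma comp_plus_right:
  "\<lbrakk>f \<in> Ar; f' \<in> Ar; g \<in> Ar; src g = tgt f; src f' = src f; tgt f' = tgt f\<rbrakk>
    \<Longrightarrow> g \<star> (f \<boxplus> f') = (g \<star> f) \<boxplus> (g \<star> f')"
  using preadditive_distrib(1)[OF preadd, of "src f" "tgt f" "tgt g" f f' g g] by (simp add: hom_iff)

lemma comp_plus_left:
  "\<lbrakk>f \<in> Ar; g \<in> Ar; g' \<in> Ar; src g = tgt f; src g' = src g; tgt g' = tgt g\<rbrakk>
    \<Longrightarrow> (g \<boxplus> g') \<star> f = (g \<star> f) \<boxplus> (g' \<star> f)"
  using preadditive_distrib(2)[OF preadd, of "src f" "tgt f" "tgt g" f f g g'] by (simp add: hom_iff)

lemma comp_scal_left:
  assumes "f \<in> Ar" "g \<in> Ar" "src g = tgt f" "r \<in> carrier R"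
  shows "scal r g \<star> f = scal r (g \<star> f)"
proof (rule mor_eqI)
  fix k i assume "k < length (tgt (scal r (g \<star> f)))" "i < length (src (scal r (g \<star> f)))"
  then have ki: "k < length (tgt g)" "i < length (src f)" by simp_all
  then have "ent (scal r (g \<star> f)) k i = r \<otimes> ent (g \<star> f) k i" by simp
  also have "\<dots> = (\<Oplus>j\<in>{..<length (tgt f)}.
      r \<otimes> (u [^] c (src f ! i) (tgt f ! j) (tgt g ! k) \<otimes> (ent g k j \<otimes> ent f j i)))"
    unfolding ent_comp[OF ki] using ki assms u_closed by (intro finsum_rdistr) auto
  also have "\<dots> = ent (scal r g \<star> f) k i"
    using ki assms u_closed by (subst ent_comp) (auto intro!: finsum_cong' simp: m_ac)
  finally show "ent (scal r g \<star> f) k i = ent (scal r (g \<star> f)) k i" ..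
qed (use assms in auto)

lemma comp_scal_right:
  assumes "f \<in> Ar" "g \<in> Ar" "src g = tgt f" "r \<in> carrier R"
  shows "g \<star> scal r f = scal r (g \<star> f)"
proof (rule mor_eqI)
  fix k i assume "k < length (tgt (scal r (g \<star> f)))" "i < length (src (scal r (g \<star> f)))"
  then have ki: "k < length (tgt g)" "i < length (src f)" by simp_all
  then have "ent (scal r (g \<star> f)) k i = r \<otimes> ent (g \<star> f) k i" by simp
  also have "\<dots> = (\<Oplus>j\<in>{..<length (tgt f)}.
      r \<otimes> (u [^] c (src f ! i) (tgt f ! j) (tgt g ! k) \<otimes> (ent g k j \<otimes> ent f j i)))"
    unfolding ent_comp[OF ki] using ki assms u_closed by (intro finsum_rdistr) auto
  also have "\<dots> = ent (g \<star> scal r f) k i"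
    using ki assms u_closed by (subst ent_comp) (auto intro!: finsum_cong' simp: m_ac)
  finally show "ent (g \<star> scal r f) k i = ent (scal r (g \<star> f)) k i" ..
qed (use assms in auto)

lemma plus_assoc: "\<lbrakk>f \<in> Ar; g \<in> Ar; h \<in> Ar; src g = src f; tgt g = tgt f; src h = src f; tgt h = tgt f\<rbrakk>
    \<Longrightarrow> (f \<boxplus> g) \<boxplus> h = f \<boxplus> (g \<boxplus> h)"
  by (rule mor_eqI) (auto simp: a_assoc)

lemma plus_null [simp]:
  "\<lbrakk>f \<in> Ar; A = src f; B = tgt f\<rbrakk> \<Longrightarrow> f \<boxplus> null A B = f"
  "\<lbrakk>f \<in> Ar; A = src f; B = tgt f\<rbrakk> \<Longrightarrow> null A B \<boxplus> f = f"
  by (auto intro!: mor_eqI)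

lemma comp_null [simp]:
  "\<lbrakk>g \<in> Ar; src g = B; A \<in> lists \<X>\<rbrakk> \<Longrightarrow> g \<star> null A B = null A (tgt g)"
  "\<lbrakk>f \<in> Ar; tgt f = A; B \<in> lists \<X>\<rbrakk> \<Longrightarrow> null A B \<star> f = null (src f) B"
proof -
  assume a: "g \<in> Ar" "src g = B" "A \<in> lists \<X>"
  have "scal \<zero> (null A B) = null A B" "scal \<zero> (g \<star> null A B) = null A (tgt g)"
    using a by (auto intro!: mor_eqI)
  then show "g \<star> null A B = null A (tgt g)"
    using comp_scal_right[of "null A B" g \<zero>] a Ar_src[OF a(1)] by simp
next
  assume a: "f \<in> Ar" "tgt f = A" "B \<in> lists \<X>"
  have "scal \<zero> (null A B) = null A B" "scal \<zero> (null A B \<star> f) = null (src f) B"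
    using a by (auto intro!: mor_eqI)
  then show "null A B \<star> f = null (src f) B"
    using comp_scal_left[of f "null A B" \<zero>] a Ar_tgt[OF a(1)] by simp
qed

subsection \<open>Hom modules\<close>

text \<open>The multiplicative fields of the record have no meaning for a module.\<close>

definition Hom :: "'x list \<Rightarrow> 'x list \<Rightarrow> ('r, ('x, 'r) mor) module" where
  "Hom A B = \<lparr>carrier = cat_hom C A B, monoid.mult = undefined, one = undefined,
     ring.zero = null A B, ring.add = (\<boxplus>), smult = scal\<rparr>"

lemma Hom_simps [simp]:
  "carrier (Hom A B) = cat_hom C A B" "\<zero>\<^bsub>Hom A B\<^esub> = null A B" "add (Hom A B) = (\<boxplus>)" "smult (Hom A B) = scal"
  by (simp_all add: Hom_def)

lemma Hom_module:
  assumes "A \<in> lists \<X>" "B \<in> lists \<X>"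
  shows "module R (Hom A B)"
proof (rule moduleI)
  show "abelian_group (Hom A B)"
  proof (rule abelian_groupI)
    fix f assume "f \<in> carrier (Hom A B)"
    then have "scal (\<ominus> \<one>) f \<in> carrier (Hom A B)" "scal (\<ominus> \<one>) f \<oplus>\<^bsub>Hom A B\<^esub> f = \<zero>\<^bsub>Hom A B\<^esub>"
      using assms by (auto simp: hom_iff l_minus l_neg intro!: mor_eqI)
    then show "\<exists>g\<in>carrier (Hom A B). g \<oplus>\<^bsub>Hom A B\<^esub> f = \<zero>\<^bsub>Hom A B\<^esub>" by blast
  qed (use assms in \<open>auto simp: hom_iff a_ac intro!: mor_eqI\<close>)
qed (use assms is_cring in \<open>auto simp: hom_iff l_distr r_distr m_assoc intro!: mor_eqI\<close>)

abbreviation msum :: "'x list \<Rightarrow> 'x list \<Rightarrow> ('i \<Rightarrow> ('x, 'r) mor) \<Rightarrow> 'i set \<Rightarrow> ('x, 'r) mor" where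
  "msum A B F I \<equiv> finsum (Hom A B) F I"

lemma msum_closed:
  assumes "A \<in> lists \<X>" "B \<in> lists \<X>" "\<And>i. i \<in> I \<Longrightarrow> F i \<in> Ar \<and> src (F i) = A \<and> tgt (F i) = B"
  shows "msum A B F I \<in> Ar" "src (msum A B F I) = A" "tgt (msum A B F I) = B"
proof -
  interpret module R "Hom A B" using assms Hom_module by blast
  have "finsum (Hom A B) F I \<in> carrier (Hom A B)"
    using assms by (intro M.finsum_closed) (auto simp: hom_iff)
  then show "msum A B F I \<in> Ar" "src (msum A B F I) = A" "tgt (msum A B F I) = B"
    using assms by (auto simp: hom_iff)
qed

lemma msum_comp:
  assumes "A \<in> lists \<X>" "B \<in> lists \<X>" "finite I"
    and "\<And>i. i \<in> I \<Longrightarrow> F i \<in> Ar \<and> src (F i) = A \<and> tgt (F i) = B"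
  shows "g \<in> Ar \<Longrightarrow> src g = B \<Longrightarrow> g \<star> msum A B F I = msum A (tgt g) (\<lambda>i. g \<star> F i) I"
    and "f \<in> Ar \<Longrightarrow> tgt f = A \<Longrightarrow> msum A B F I \<star> f = msum (src f) B (\<lambda>i. F i \<star> f) I"
proof -
  assume g: "g \<in> Ar" "src g = B"
  show "g \<star> msum A B F I = msum A (tgt g) (\<lambda>i. g \<star> F i) I"
    by (rule finsum_additive[where h = "\<lambda>x. g \<star> x"])
      (use assms g module.axioms(2)[OF Hom_module] in \<open>auto simp: hom_iff comp_plus_right\<close>)
next
  assume f: "f \<in> Ar" "tgt f = A"
  show "msum A B F I \<star> f = msum (src f) B (\<lambda>i. F i \<star> f) I"
    by (rule finsum_additive[where h = "\<lambda>x. x \<star> f"])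
      (use assms f module.axioms(2)[OF Hom_module] in \<open>auto simp: hom_iff comp_plus_left\<close>)
qed

subsection \<open>Coordinate inclusions and projections\<close>

text \<open>A list of indices of components of \<open>A\<close> spans a sub-sum of \<open>A\<close>.\<close>

abbreviation sub :: "'x list \<Rightarrow> nat list \<Rightarrow> 'x list" where
  "sub A ks \<equiv> map ((!) A) ks"

definition inc :: "'x list \<Rightarrow> nat list \<Rightarrow> ('x, 'r) mor" where
  "inc A ks = mk (sub A ks) A (\<lambda>j k. if j = ks ! k then \<one> else \<zero>)"

definition prj :: "'x list \<Rightarrow> nat list \<Rightarrow> ('x, 'r) mor" where
  "prj A ks = mk A (sub A ks) (\<lambda>k i. if i = ks ! k then \<one> else \<zero>)"

lemma nth_less [simp]: "set ks \<subseteq> {..<n} \<Longrightarrow> k < length ks \<Longrightarrow> ks ! k < n" for n :: nat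
  by (meson lessThan_iff nth_mem subsetD)

lemma sub_lists [simp]: "A \<in> lists \<X> \<Longrightarrow> set ks \<subseteq> {..<length A} \<Longrightarrow> sub A ks \<in> lists \<X>"
  by (induction ks) auto

lemma inc_simps [simp]:
  "src (inc A ks) = sub A ks" "tgt (inc A ks) = A"
  "j < length A \<Longrightarrow> k < length ks \<Longrightarrow> ent (inc A ks) j k = (if j = ks ! k then \<one> else \<zero>)"
  "A \<in> lists \<X> \<Longrightarrow> set ks \<subseteq> {..<length A} \<Longrightarrow> inc A ks \<in> Ar"
  by (auto simp: inc_def)

lemma prj_simps [simp]:
  "src (prj A ks) = A" "tgt (prj A ks) = sub A ks"
  "k < length ks \<Longrightarrow> i < length A \<Longrightarrow> ent (prj A ks) k i = (if i = ks ! k then \<one> else \<zero>)"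
  "A \<in> lists \<X> \<Longrightarrow> set ks \<subseteq> {..<length A} \<Longrightarrow> prj A ks \<in> Ar"
  by (auto simp: prj_def)

lemma ent_comp_inc [simp]:
  assumes "f \<in> Ar" "src f = A" "set ks \<subseteq> {..<length A}" "j < length (tgt f)" "k < length ks"
  shows "ent (f \<star> inc A ks) j k = ent f j (ks ! k)"
proof -
  have A: "A \<in> lists \<X>" using Ar_src[OF assms(1)] assms(2) by simp
  have k: "ks ! k < length A" using assms(3,5) by simp
  show ?thesis
    using assms A k Ar_tgt[OF assms(1)] by (subst ent_comp_single[where j = "ks ! k"]) auto
qed

lemma ent_prj_comp [simp]:
  assumes "f \<in> Ar" "tgt f = A" "set ks \<subseteq> {..<length A}" "i < length (src f)" "k < length ks"
  shows "ent (prj A ks \<star> f) k i = ent f (ks ! k) i"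
proof -
  have A: "A \<in> lists \<X>" using Ar_tgt[OF assms(1)] assms(2) by simp
  have k: "ks ! k < length A" using assms(3,5) by simp
  show ?thesis
    using assms A k Ar_src[OF assms(1)] by (subst ent_comp_single[where j = "ks ! k"]) auto
qed

lemma prj_inc:
  assumes "A \<in> lists \<X>" "set ks \<subseteq> {..<length A}" "distinct ks"
  shows "prj A ks \<star> inc A ks = ide (sub A ks)"
proof (rule mor_eqI)
  fix j k assume "j < length (tgt (ide (sub A ks)))" "k < length (src (ide (sub A ks)))"
  moreover from this have "ks ! j < length A" using assms(2) by simp
  ultimately show "ent (prj A ks \<star> inc A ks) j k = ent (ide (sub A ks)) j k"
    using assms by (auto simp: nth_eq_iff_index_eq)
qed (use assms in auto)

lemma prj_inc_disjoint:
  assumes "A \<in> lists \<X>" "set ks \<subseteq> {..<length A}" "set ls \<subseteq> {..<length A}" "set ks \<inter> set ls = {}"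
  shows "prj A ks \<star> inc A ls = null (sub A ls) (sub A ks)"
proof (rule mor_eqI)
  fix j k assume "j < length (tgt (null (sub A ls) (sub A ks)))" "k < length (src (null (sub A ls) (sub A ks)))"
  then have "j < length ks" "k < length ls" by auto
  moreover from this have "ks ! j \<noteq> ls ! k"
    using assms(4) by (metis disjoint_iff nth_mem)
  ultimately show "ent (prj A ks \<star> inc A ls) j k = ent (null (sub A ls) (sub A ks)) j k"
    using assms by auto
qed (use assms in auto)

lemma ent_inc_prj:
  assumes "A \<in> lists \<X>" "set ks \<subseteq> {..<length A}" "distinct ks" "j < length A" "i < length A"
  shows "ent (inc A ks \<star> prj A ks) j i = (if i = j \<and> i \<in> set ks then \<one> else \<zero>)"
proof (cases "i \<in> set ks")
  case True
  then obtain k where k: "k < length ks" "i = ks ! k" by (metis in_set_conv_nth)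
  then have "ent (inc A ks \<star> prj A ks) j i = u [^] c (A ! i) (A ! i) (A ! j) \<otimes>
      (ent (inc A ks) j k \<otimes> ent (prj A ks) k i)"
    using assms by (subst ent_comp_single[where j = k]) (auto simp: nth_eq_iff_index_eq)
  then show ?thesis using k assms by auto
next
  case False
  then have "ent (inc A ks \<star> prj A ks) j i = (\<Oplus>k\<in>{..<length ks}. \<zero>)"
    using assms u_closed by (intro trans[OF ent_comp finsum_cong']) auto
  then show ?thesis using False by simp
qed

lemma inc_prj_partition:
  assumes "A \<in> lists \<X>" "set ks \<subseteq> {..<length A}" "set ls \<subseteq> {..<length A}"
    and "set ks \<inter> set ls = {}" "{..<length A} \<subseteq> set ks \<union> set ls" "distinct ks" "distinct ls"
  shows "(inc A ks \<star> prj A ks) \<boxplus> (inc A ls \<star> prj A ls) = ide A"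
  by (rule mor_eqI) (use assms in \<open>auto simp: ent_inc_prj\<close>)

subsection \<open>Radical morphisms\<close>

text \<open>The Jacobson radical of the additive hull: no component between isomorphic summands is an
  isomorphism.\<close>

definition rad :: "('x, 'r) mor \<Rightarrow> bool" where
  "rad f \<longleftrightarrow> (\<forall>i<length (src f). \<forall>j<length (tgt f).
     cp_iso c (src f ! i) (tgt f ! j) \<longrightarrow> ent f j i \<notin> Units R)"

lemma nonunit_mult:
  assumes "a \<in> carrier R" "b \<in> carrier R" "a \<notin> Units R \<or> b \<notin> Units R"
  shows "a \<otimes> b \<notin> Units R"
  using assms unit_factor[of a b] unit_factor[of b a] m_comm[of a b] by auto

lemma zero_nonunit [simp]: "\<zero> \<notin> Units R"
  by (metis Units_r_inv Units_inv_closed l_null zero_not_one)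

lemma u_pow_nonunit: "0 < k \<Longrightarrow> u [^] (k::nat) \<notin> Units R"
  using nonunit_mult[of "u [^] (k - 1)" u] u_closed u_nonunit nat_pow_Suc[of u "k - 1"] by simp

lemma nonunit_finsum:
  assumes "finite I" "\<And>i. i \<in> I \<Longrightarrow> f i \<in> carrier R \<and> f i \<notin> Units R"
  shows "(\<Oplus>i\<in>I. f i) \<notin> Units R"
  using assms
  by (induction I rule: finite_induct) (auto simp: nonunit_add Pi_def)

text \<open>A path between isomorphic summands through a summand that is not isomorphic to them
  contributes a positive power of \<open>u\<close>; this is why composition can be read off modulo the
  maximal ideal one isomorphism class at a time.\<close>

lemma u_pow_cocycle_nonunit:
  assumes "x \<in> \<X>" "y \<in> \<X>" "z \<in> \<X>" "cp_iso c x z" "\<not> cp_iso c x y"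
  shows "u [^] c x y z \<notin> Units R"
  using assms cocycle_iso13[of x y z] by (intro u_pow_nonunit) (auto simp: cp_iso_def)

lemma rad_comp_right:
  assumes "f \<in> Ar" "g \<in> Ar" "src g = tgt f" "rad f"
  shows "rad (g \<star> f)"
  unfolding rad_def
proof (intro allI impI)
  fix i k assume "i < length (src (g \<star> f))" "k < length (tgt (g \<star> f))"
    and iso: "cp_iso c (src (g \<star> f) ! i) (tgt (g \<star> f) ! k)"
  then have ik: "i < length (src f)" "k < length (tgt g)" by simp_all
  show "ent (g \<star> f) k i \<notin> Units R"
    unfolding ent_comp[OF ik(2,1)]
  proof (rule nonunit_finsum)
    fix j assume "j \<in> {..<length (tgt f)}"
    then have j: "j < length (tgt f)" by simp
    let ?w = "u [^] c (src f ! i) (tgt f ! j) (tgt g ! k)"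
    have X: "src f ! i \<in> \<X>" "tgt f ! j \<in> \<X>" "tgt g ! k \<in> \<X>" using assms ik j by auto
    have cl: "ent g k j \<in> carrier R" "ent f j i \<in> carrier R" "?w \<in> carrier R"
      using assms ik j u_closed by auto
    have "?w \<notin> Units R \<or> ent f j i \<notin> Units R"
      using assms(4) ik j iso u_pow_cocycle_nonunit[OF X] unfolding rad_def by auto
    then show "?w \<otimes> (ent g k j \<otimes> ent f j i) \<in> carrier R \<and> ?w \<otimes> (ent g k j \<otimes> ent f j i) \<notin> Units R"
      using cl nonunit_mult by auto
  qed simp
qed

lemma rad_comp_left:
  assumes "f \<in> Ar" "g \<in> Ar" "src g = tgt f" "rad g"
  shows "rad (g \<star> f)"
  unfolding rad_def
proof (intro allI impI)
  fix i k assume "i < length (src (g \<star> f))" "k < length (tgt (g \<star> f))"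
    and iso: "cp_iso c (src (g \<star> f) ! i) (tgt (g \<star> f) ! k)"
  then have ik: "i < length (src f)" "k < length (tgt g)" by simp_all
  show "ent (g \<star> f) k i \<notin> Units R"
    unfolding ent_comp[OF ik(2,1)]
  proof (rule nonunit_finsum)
    fix j assume "j \<in> {..<length (tgt f)}"
    then have j: "j < length (tgt f)" by simp
    let ?w = "u [^] c (src f ! i) (tgt f ! j) (tgt g ! k)"
    have X: "src f ! i \<in> \<X>" "tgt f ! j \<in> \<X>" "tgt g ! k \<in> \<X>" using assms ik j by auto
    have cl: "ent g k j \<in> carrier R" "ent f j i \<in> carrier R" "?w \<in> carrier R"
      using assms ik j u_closed by auto
    have "cp_iso c (tgt f ! j) (tgt g ! k)" if "cp_iso c (src f ! i) (tgt f ! j)"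
      using that iso X iso_sym iso_trans by (metis comp_simps)
    then have "?w \<notin> Units R \<or> ent g k j \<notin> Units R"
      using assms(3,4) ik j iso u_pow_cocycle_nonunit[OF X] unfolding rad_def by auto
    then show "?w \<otimes> (ent g k j \<otimes> ent f j i) \<in> carrier R \<and> ?w \<otimes> (ent g k j \<otimes> ent f j i) \<notin> Units R"
      using cl nonunit_mult by auto
  qed simp
qed

lemma rad_plus:
  assumes "f \<in> Ar" "g \<in> Ar" "src g = src f" "tgt g = tgt f" "rad f" "rad g"
  shows "rad (f \<boxplus> g)"
  using assms nonunit_add unfolding rad_def by simp

lemma rad_scal: "f \<in> Ar \<Longrightarrow> r \<in> carrier R \<Longrightarrow> rad f \<Longrightarrow> rad (scal r f)"
  using nonunit_mult unfolding rad_def by simp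

lemma not_rad_ide: "A \<in> lists \<X> \<Longrightarrow> A \<noteq> [] \<Longrightarrow> \<not> rad (ide A)"
  unfolding rad_def by (auto intro!: exI[of _ 0])

subsection \<open>Invertible morphisms\<close>

lemma comp_cancel:
  "\<lbrakk>g \<star> f = h; f \<in> Ar; g \<in> Ar; z \<in> Ar; src g = tgt f; src f = tgt z\<rbrakk> \<Longrightarrow> g \<star> f \<star> z = h \<star> z"
  using comp_assoc by metis

definition inverse_of :: "('x, 'r) mor \<Rightarrow> ('x, 'r) mor \<Rightarrow> bool" where
  "inverse_of f g \<longleftrightarrow> f \<in> Ar \<and> g \<in> Ar \<and> src g = tgt f \<and> tgt g = src f \<and>
     g \<star> f = ide (src f) \<and> f \<star> g = ide (tgt f)"

lemma cat_iso_iff: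
  assumes "A \<in> lists \<X>" "B \<in> lists \<X>"
  shows "f \<in> cat_iso C A B \<longleftrightarrow> src f = A \<and> tgt f = B \<and> (\<exists>g. inverse_of f g)"
proof
  assume "f \<in> cat_iso C A B"
  then obtain g where "f \<in> cat_hom C A B" "g \<in> cat_hom C B A" "g \<star> f = ide A" "f \<star> g = ide B"
    unfolding cat_iso_def by auto
  then show "src f = A \<and> tgt f = B \<and> (\<exists>g. inverse_of f g)"
    using assms by (auto simp: hom_iff inverse_of_def intro!: exI[of _ g])
next
  assume a: "src f = A \<and> tgt f = B \<and> (\<exists>g. inverse_of f g)"
  then obtain g where "inverse_of f g" by blast
  then show "f \<in> cat_iso C A B"
    using a assms unfolding cat_iso_def by (auto simp: hom_iff inverse_of_def intro!: bexI[of _ g])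
qed

lemma inverse_of_comp:
  assumes "inverse_of f f'" "inverse_of g g'" "src g = tgt f"
  shows "inverse_of (g \<star> f) (f' \<star> g')"
proof -
  have "g' \<star> g \<star> f = f" "f \<star> f' \<star> g' = g'"
    using assms comp_cancel[of g' g _ f] comp_cancel[of f f' _ g'] by (simp_all add: inverse_of_def)
  then show ?thesis using assms by (simp add: inverse_of_def)
qed

text \<open>A morphism that becomes invertible after a composition on each side has a left and a right inverse.\<close>

lemma inverse_of_left_right:
  assumes "f \<in> Ar" "inverse_of (g \<star> f) a" "inverse_of (f \<star> h) b"
    and "g \<in> Ar" "h \<in> Ar" "src g = tgt f" "src f = tgt h"
  shows "\<exists>f'. inverse_of f f'"
proof -
  let ?l = "a \<star> g" and ?r = "h \<star> b"
  have l: "?l \<in> Ar" "src ?l = tgt f" "tgt ?l = src f" "?l \<star> f = ide (src f)"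
    using assms by (auto simp: inverse_of_def)
  have r: "?r \<in> Ar" "src ?r = tgt f" "tgt ?r = src f" "f \<star> ?r = ide (tgt f)"
    using assms unfolding inverse_of_def by (auto simp flip: comp_assoc)
  have "?l = ?l \<star> (f \<star> ?r)" unfolding r(4) using l by simp
  also have "\<dots> = (?l \<star> f) \<star> ?r" by (rule comp_assoc[symmetric]) (use assms l r in auto)
  also have "\<dots> = ?r" unfolding l(4) using r by simp
  finally have "?l = ?r" .
  with l r assms(1) show ?thesis unfolding inverse_of_def by metis
qed

text \<open>Jacobson's formula: \<open>(1 + g h)\<^sup>-\<^sup>1 = 1 - g (1 + h g)\<^sup>-\<^sup>1 h\<close>. For a morphism factoring over
  a single element of \<open>\<X>\<close>, the inner inverse is an inverse in \<open>R\<close>.\<close>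

lemma one_plus_factoring_invertible:
  assumes "g \<in> Ar" "h \<in> Ar" "src g = [x]" "tgt h = [x]" "tgt g = src h"
    and "\<one> \<oplus> ent (h \<star> g) 0 0 \<in> Units R"
  shows "\<exists>w. inverse_of (ide (src h) \<boxplus> (g \<star> h)) w"
proof -
  let ?A = "src h"
  define r where "r = ent (h \<star> g) 0 0"
  have unit: "\<one> \<oplus> r \<in> Units R" using assms(6) by (simp add: r_def)
  define s where "s = \<ominus> (inv (\<one> \<oplus> r))"
  have x: "[x] \<in> lists \<X>" using Ar_src[OF assms(1)] assms(3) by simp
  have r: "r \<in> carrier R" using assms by (simp add: r_def)
  have s: "s \<in> carrier R" using unit by (simp add: s_def)
  have "h \<star> g = scal r (ide [x])"
    by (rule mor_eqI) (use assms x r in \<open>auto simp: r_def\<close>)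
  then have hg: "h \<star> g \<star> h = scal r h"
    using comp_cancel[of h g _ h] assms x r by (simp add: comp_scal_left)
  let ?e = "g \<star> h"
  have ee: "?e \<star> ?e = scal r ?e"
    using assms hg r by (simp add: comp_scal_right)
  have A: "?A \<in> lists \<X>" "?e \<in> Ar" "ide ?A \<in> Ar" "src ?e = ?A" "tgt ?e = ?A" using assms by auto
  have "s \<otimes> (\<one> \<oplus> r) = \<ominus> \<one>"
    using unit r by (simp add: s_def l_minus)
  moreover have "\<one> \<oplus> s \<otimes> (\<one> \<oplus> r) = \<one> \<oplus> s \<oplus> s \<otimes> r"
    using r s by (simp add: r_distr a_assoc)
  ultimately have key: "\<one> \<oplus> s \<oplus> s \<otimes> r = \<zero>" using r_neg[OF one_closed] by simp
  have z: "t \<oplus> (s \<otimes> t \<oplus> s \<otimes> (r \<otimes> t)) = \<zero>" if "t \<in> carrier R" for t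
  proof -
    have "t \<oplus> (s \<otimes> t \<oplus> s \<otimes> (r \<otimes> t)) = (\<one> \<oplus> s \<oplus> s \<otimes> r) \<otimes> t"
      using that r s by (simp add: l_distr m_assoc a_assoc)
    then show ?thesis using key that by simp
  qed
  have ee': "?e \<star> scal s ?e = scal s (scal r ?e)" "scal s ?e \<star> ?e = scal s (scal r ?e)"
    using A r s ee by (simp_all only: comp_scal_right comp_scal_left)
  have sA: "scal s ?e \<in> Ar" "src (scal s ?e) = ?A" "tgt (scal s ?e) = ?A" "scal s (scal r ?e) \<in> Ar"
      "src (scal s (scal r ?e)) = ?A" "tgt (scal s (scal r ?e)) = ?A"
    using A r s by auto
  have "(ide ?A \<boxplus> ?e) \<star> (ide ?A \<boxplus> scal s ?e) = (ide ?A \<boxplus> ?e) \<boxplus> (scal s ?e \<boxplus> scal s (scal r ?e))"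
    using A sA ee' by (simp add: comp_plus_left comp_plus_right del: comp_assoc)
  moreover have "(ide ?A \<boxplus> scal s ?e) \<star> (ide ?A \<boxplus> ?e) = (ide ?A \<boxplus> scal s ?e) \<boxplus> (?e \<boxplus> scal s (scal r ?e))"
    using A sA ee' by (simp add: comp_plus_left comp_plus_right del: comp_assoc)
  moreover have "(a \<oplus> t) \<oplus> (s \<otimes> t \<oplus> s \<otimes> (r \<otimes> t)) = a" "(a \<oplus> s \<otimes> t) \<oplus> (t \<oplus> s \<otimes> (r \<otimes> t)) = a"
    if at: "a \<in> carrier R" "t \<in> carrier R" for a t
  proof -
    have "a \<oplus> (t \<oplus> (s \<otimes> t \<oplus> s \<otimes> (r \<otimes> t))) = a" using z[OF at(2)] at by simp
    then show "(a \<oplus> t) \<oplus> (s \<otimes> t \<oplus> s \<otimes> (r \<otimes> t)) = a" "(a \<oplus> s \<otimes> t) \<oplus> (t \<oplus> s \<otimes> (r \<otimes> t)) = a"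
      using at r s by (simp_all add: a_ac)
  qed
  then have "(ide ?A \<boxplus> ?e) \<boxplus> (scal s ?e \<boxplus> scal s (scal r ?e)) = ide ?A"
    "(ide ?A \<boxplus> scal s ?e) \<boxplus> (?e \<boxplus> scal s (scal r ?e)) = ide ?A"
    using A sA by (auto intro!: mor_eqI)
  ultimately have "inverse_of (ide ?A \<boxplus> ?e) (ide ?A \<boxplus> scal s ?e)"
    using A sA by (simp add: inverse_of_def)
  then show ?thesis by blast
qed

text \<open>Writing \<open>f\<close> as the sum of its columns, \<open>1 + f\<close> is a product of factors of the form treated
  above: if \<open>w\<close> inverts \<open>1 + f\<^sub>k\<close>, where \<open>f\<^sub>k\<close> consists of the first \<open>k\<close> columns of \<open>f\<close>, then
  \<open>1 + f\<^sub>k\<^sub>+\<^sub>1 = (1 + f\<^sub>k) (1 + w f e\<^sub>k p\<^sub>k)\<close>.\<close>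

lemma one_plus_rad_invertible:
  assumes f: "f \<in> Ar" "src f = A" "tgt f = A" "rad f"
  shows "\<exists>w. inverse_of (ide A \<boxplus> f) w"
proof -
  define D where "D k = mk A A (\<lambda>j i. if i = j \<and> i < k then \<one> else \<zero>)" for k
  have A: "A \<in> lists \<X>" using f by auto
  have D: "D k \<in> Ar" "src (D k) = A" "tgt (D k) = A" for k
    using A by (auto simp: D_def)
  have "\<exists>w. inverse_of (ide A \<boxplus> (f \<star> D k)) w" if "k \<le> length A" for k
    using that
  proof (induction k)
    case 0
    have "D 0 = null A A" by (simp add: D_def null_def)
    then have "ide A \<boxplus> (f \<star> D 0) = ide A" using f A by simp
    moreover have "inverse_of (ide A) (ide A)" using A by (simp add: inverse_of_def)
    ultimately show ?case by metis
  next
    case (Suc k)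
    then obtain w where w: "inverse_of (ide A \<boxplus> (f \<star> D k)) w" by auto
    have wA: "w \<in> Ar" "src w = A" "tgt w = A"
      using w by (auto simp: inverse_of_def)
    let ?e = "inc A [k]" and ?p = "prj A [k]"
    have k: "set [k] \<subseteq> {..<length A}" "k < length A" using Suc.prems by auto
    have e: "?e \<in> Ar" "src ?e = [A ! k]" "tgt ?e = A" and p: "?p \<in> Ar" "src ?p = A" "tgt ?p = [A ! k]"
      using A k by (simp_all del: set_simps)
    have Dk: "D (Suc k) = D k \<boxplus> (?e \<star> ?p)"
      by (rule mor_eqI) (use D e p A k in \<open>auto simp: D_def ent_inc_prj\<close>)
    let ?g = "w \<star> f \<star> ?e"
    have g: "?g \<in> Ar" "src ?g = [A ! k]" "tgt ?g = A" using wA f e by auto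
    have "rad (?p \<star> ?g)"
      using f e p wA by (intro rad_comp_right rad_comp_left) auto
    then have "ent (?p \<star> ?g) 0 0 \<notin> Units R"
      using e p A k unfolding rad_def by auto
    moreover have r: "ent (?p \<star> ?g) 0 0 \<in> carrier R"
      using g p by (intro ent_closed) auto
    ultimately have "\<one> \<oplus> ent (?p \<star> ?g) 0 0 \<in> Units R"
      using nonunit_add[of "\<one> \<oplus> ent (?p \<star> ?g) 0 0" "\<ominus> ent (?p \<star> ?g) 0 0"]
        nonunit_mult[of "\<ominus> \<one>" "ent (?p \<star> ?g) 0 0"]
      by (auto simp: a_assoc r_neg l_minus)
    then obtain v where v: "inverse_of (ide A \<boxplus> (?g \<star> ?p)) v"
      using one_plus_factoring_invertible[of ?g ?p "A ! k"] g p by auto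
    have "(ide A \<boxplus> (f \<star> D k)) \<star> (?g \<star> ?p) = ((ide A \<boxplus> (f \<star> D k)) \<star> w) \<star> (f \<star> ?e \<star> ?p)"
      using wA f e p D A by simp
    also have "\<dots> = f \<star> ?e \<star> ?p"
      using w wA f e p D A by (simp add: inverse_of_def)
    finally have "(ide A \<boxplus> (f \<star> D k)) \<star> (ide A \<boxplus> (?g \<star> ?p)) = ide A \<boxplus> (f \<star> D (Suc k))"
      unfolding Dk using wA f e p D A
      by (simp add: comp_plus_left comp_plus_right plus_assoc)
    moreover have "inverse_of ((ide A \<boxplus> (f \<star> D k)) \<star> (ide A \<boxplus> (?g \<star> ?p))) (v \<star> w)"
      using v w g p f D by (intro inverse_of_comp) auto
    ultimately show ?case by metis
  qed
  moreover have "D (length A) = ide A" unfolding D_def ide_def mk_def by (auto intro!: eq_matI)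
  ultimately show ?thesis using f by force
qed

text \<open>Rescaling by the inverses of the diagonal entries turns \<open>f\<close> into the identity plus a radical
  morphism, from the left as well as from the right.\<close>

lemma unit_diagonal_invertible:
  assumes f: "f \<in> Ar" "length (tgt f) = length (src f)"
    and iso: "\<And>i. i < length (src f) \<Longrightarrow> cp_iso c (src f ! i) (tgt f ! i)"
    and diag: "\<And>i. i < length (src f) \<Longrightarrow> ent f i i \<in> Units R"
    and noniso: "\<And>i j. i < length (src f) \<Longrightarrow> j < length (src f) \<Longrightarrow> i \<noteq> j \<Longrightarrow> \<not> cp_iso c (src f ! i) (src f ! j)"
  shows "\<exists>g. inverse_of f g"
proof -
  define t where "t = mk (tgt f) (src f) (\<lambda>j i. if j = i then inv (ent f i i) else \<zero>)"
  have t: "t \<in> Ar" "src t = tgt f" "tgt t = src f"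
    using f diag by (auto simp: t_def)
  have X: "src f ! i \<in> \<X>" "tgt f ! i \<in> \<X>" if "i < length (src f)" for i
    using that f by auto
  have iso': "cp_iso c (tgt f ! i) (src f ! i)" if "i < length (src f)" for i
    using that iso X iso_sym by blast
  have noniso': "\<not> cp_iso c (tgt f ! i) (tgt f ! j)" if "i < length (src f)" "j < length (src f)" "i \<noteq> j" for i j
    using noniso[of i j] that iso iso' X iso_trans by metis
  have one_plus_rad: "\<exists>w. inverse_of h w" if h: "h \<in> Ar" "src h = A" "tgt h = A"
      "\<And>i. i < length A \<Longrightarrow> ent h i i = \<one>"
      "\<And>i j. i < length A \<Longrightarrow> j < length A \<Longrightarrow> i \<noteq> j \<Longrightarrow> \<not> cp_iso c (A ! i) (A ! j)" for h A
  proof -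
    define h0 where "h0 = mk A A (\<lambda>j i. if j = i then \<zero> else ent h j i)"
    have A: "A \<in> lists \<X>" using h by auto
    have h0: "h0 \<in> Ar" "src h0 = A" "tgt h0 = A" using h A by (auto simp: h0_def)
    have "h = ide A \<boxplus> h0" by (rule mor_eqI) (use h A h0 in \<open>auto simp: h0_def\<close>)
    moreover have "rad h0" unfolding rad_def using h A by (auto simp: h0_def)
    ultimately show ?thesis using one_plus_rad_invertible[OF h0] by simp
  qed
  have "ent (t \<star> f) i i = \<one>" if "i < length (src f)" for i
    using that f t diag iso X
    by (subst ent_comp_single[where j = i]) (auto simp: t_def cocycle_iso12)
  then obtain a where a: "inverse_of (t \<star> f) a"
    using one_plus_rad[of "t \<star> f" "src f"] t f noniso by auto
  have "ent (f \<star> t) i i = \<one>" if "i < length (src f)" for i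
    using that f t diag iso' X
    by (subst ent_comp_single[where j = i]) (auto simp: t_def cocycle_iso12)
  then obtain b where "inverse_of (f \<star> t) b"
    using one_plus_rad[of "f \<star> t" "tgt f"] t f noniso' by auto
  then show ?thesis using inverse_of_left_right[OF f(1) a] t by auto
qed

end

section \<open>Preadditive categories\<close>

lemma preadditive_hom_group:
  "\<lbrakk>preadditive C; A \<in> cat_obj C; B \<in> cat_obj C\<rbrakk> \<Longrightarrow>
    comm_group \<lparr>carrier = cat_hom C A B, monoid.mult = cat_add C, one = cat_zero C A B\<rparr>"
  unfolding preadditive_def by blast

lemma category_comp:
  "\<lbrakk>category C; A \<in> cat_obj C; B \<in> cat_obj C; D \<in> cat_obj C; f \<in> cat_hom C A B; g \<in> cat_hom C B D\<rbrakk>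
    \<Longrightarrow> g \<circ>\<^bsub>C\<^esub> f \<in> cat_hom C A D"
  unfolding category_def by blast

text \<open>A composite with zero is idempotent for the addition of its hom group.\<close>

lemma preadditive_comp_zero:
  assumes C: "preadditive C" "A \<in> cat_obj C" "B \<in> cat_obj C" "D \<in> cat_obj C"
  shows "g \<in> cat_hom C B D \<Longrightarrow> g \<circ>\<^bsub>C\<^esub> cat_zero C A B = cat_zero C A D"
    and "f \<in> cat_hom C A B \<Longrightarrow> cat_zero C B D \<circ>\<^bsub>C\<^esub> f = cat_zero C A D"
proof -
  have cat: "category C" using C by (simp add: preadditive_def)
  interpret AB: comm_group "\<lparr>carrier = cat_hom C A B, monoid.mult = cat_add C, one = cat_zero C A B\<rparr>"
    by (rule preadditive_hom_group) fact+
  interpret BD: comm_group "\<lparr>carrier = cat_hom C B D, monoid.mult = cat_add C, one = cat_zero C B D\<rparr>"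
    by (rule preadditive_hom_group) fact+
  interpret AD: comm_group "\<lparr>carrier = cat_hom C A D, monoid.mult = cat_add C, one = cat_zero C A D\<rparr>"
    by (rule preadditive_hom_group) fact+
  have idem: "x = cat_zero C A D" if "x \<in> cat_hom C A D" "cat_add C x x = x" for x
    using that AD.r_cancel_one'[of x x] by simp
  have zAB: "cat_zero C A B \<in> cat_hom C A B" "cat_add C (cat_zero C A B) (cat_zero C A B) = cat_zero C A B"
    using AB.one_closed AB.l_one[OF AB.one_closed] by simp_all
  have zBD: "cat_zero C B D \<in> cat_hom C B D" "cat_add C (cat_zero C B D) (cat_zero C B D) = cat_zero C B D"
    using BD.one_closed BD.l_one[OF BD.one_closed] by simp_all
  show "g \<circ>\<^bsub>C\<^esub> cat_zero C A B = cat_zero C A D" if g: "g \<in> cat_hom C B D"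
    using preadditive_distrib(1)[OF C zAB(1) zAB(1) g g] zAB(2) category_comp[OF cat C(2-4) zAB(1) g]
    by (intro idem) simp_all
  show "cat_zero C B D \<circ>\<^bsub>C\<^esub> f = cat_zero C A D" if f: "f \<in> cat_hom C A B"
    using preadditive_distrib(2)[OF C f f zBD(1) zBD(1)] zBD(2) category_comp[OF cat C(2-4) f zBD(1)]
    by (intro idem) simp_all
qed

lemma end_ring_simps [simp]:
  "carrier (end_ring C A) = cat_hom C A A" "monoid.mult (end_ring C A) = cat_comp C"
  "one (end_ring C A) = cat_id C A" "ring.zero (end_ring C A) = cat_zero C A A"
  "ring.add (end_ring C A) = cat_add C"
  by (simp_all add: end_ring_def)

lemma end_ring_ring:
  assumes "preadditive C" "A \<in> cat_obj C"
  shows "ring (end_ring C A)"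
proof -
  have cat: "category C" using assms by (simp add: preadditive_def)
  have "comm_group \<lparr>carrier = cat_hom C A A, monoid.mult = cat_add C, one = cat_zero C A A\<rparr>"
    using assms by (intro preadditive_hom_group)
  then have "abelian_group (end_ring C A)"
    by (simp add: end_ring_def abelian_group_def abelian_group_axioms_def abelian_monoid_def comm_group_def)
  moreover have "monoid (end_ring C A)"
  proof (rule monoidI)
    show "\<one>\<^bsub>end_ring C A\<^esub> \<in> carrier (end_ring C A)"
      using cat assms unfolding category_def by simp
  qed (simp_all add: category_comp[OF cat assms(2) assms(2) assms(2)] category_id[OF cat assms(2) assms(2)]
      category_assoc[OF cat assms(2) assms(2) assms(2) assms(2)])
  ultimately show ?thesis
    using preadditive_distrib[OF assms(1) assms(2) assms(2) assms(2)]
    by (intro ringI) simp_all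
qed

text \<open>Splitting off one summand after the other builds a biproduct of finitely many objects.\<close>

lemma direct_sum_Cons:
  assumes C: "preadditive C" and A: "A \<in> cat_obj C" and S: "S \<in> cat_obj C"
    and \<iota>: "\<iota> \<in> cat_hom C S A" and \<pi>: "\<pi> \<in> cat_hom C A S" and \<pi>\<iota>: "\<pi> \<circ>\<^bsub>C\<^esub> \<iota> = cat_id C S"
    and \<kappa>: "\<kappa> \<in> cat_hom C A' A" and p: "p \<in> cat_hom C A A'" and p\<kappa>: "p \<circ>\<^bsub>C\<^esub> \<kappa> = cat_id C A'"
    and p\<iota>: "p \<circ>\<^bsub>C\<^esub> \<iota> = cat_zero C S A'" and \<pi>\<kappa>: "\<pi> \<circ>\<^bsub>C\<^esub> \<kappa> = cat_zero C A' S"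
    and sum: "cat_add C (\<iota> \<circ>\<^bsub>C\<^esub> \<pi>) (\<kappa> \<circ>\<^bsub>C\<^esub> p) = cat_id C A"
    and Bs: "direct_sum C Bs A'"
  shows "direct_sum C (S # Bs) A"
proof -
  have cat: "category C" using C by (simp add: preadditive_def)
  have A': "A' \<in> cat_obj C" and Bs_obj: "set Bs \<subseteq> cat_obj C"
    using Bs by (auto simp: direct_sum_def)
  let ?n = "length Bs"
  have obj: "Bs ! i \<in> cat_obj C" if "i < ?n" for i using that Bs_obj by auto
  obtain i0 p0 where 0: "\<And>i. i < ?n \<Longrightarrow> i0 i \<in> cat_hom C (Bs ! i) A' \<and> p0 i \<in> cat_hom C A' (Bs ! i)"
      "\<And>i j. i < ?n \<Longrightarrow> j < ?n \<Longrightarrow> p0 j \<circ>\<^bsub>C\<^esub> i0 i =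
         (if i = j then cat_id C (Bs ! i) else cat_zero C (Bs ! i) (Bs ! j))"
    and s0: "(\<Oplus>\<^bsub>end_ring C A'\<^esub> i \<in> {..<?n}. i0 i \<circ>\<^bsub>C\<^esub> p0 i) = cat_id C A'"
    using Bs unfolding direct_sum_def by blast
  note comp = category_comp[OF cat] and assoc = category_assoc[OF cat] and id = category_id[OF cat]
    and zero = preadditive_comp_zero[OF C]
  define i1 where "i1 = case_nat \<iota> (\<lambda>i. \<kappa> \<circ>\<^bsub>C\<^esub> i0 i)"
  define p1 where "p1 = case_nat \<pi> (\<lambda>i. p0 i \<circ>\<^bsub>C\<^esub> p)"
  have hom0: "i1 i \<in> cat_hom C ((S # Bs) ! i) A" "p1 i \<in> cat_hom C A ((S # Bs) ! i)"
    if "i < length (S # Bs)" for i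
    using that 0(1) \<iota> \<pi> comp[OF obj A' A _ \<kappa>] comp[OF A A' obj p]
    by (auto simp: i1_def p1_def split: nat.split)
  have pk: "p \<circ>\<^bsub>C\<^esub> (\<kappa> \<circ>\<^bsub>C\<^esub> f) = f" if "B \<in> cat_obj C" "f \<in> cat_hom C B A'" for B f
    using assoc[OF that(1) A' A A' that(2) \<kappa> p] p\<kappa> id(2)[OF that(1) A' that(2)] by simp
  have orth: "p1 j \<circ>\<^bsub>C\<^esub> i1 i =
      (if i = j then cat_id C ((S # Bs) ! i) else cat_zero C ((S # Bs) ! i) ((S # Bs) ! j))"
    if ij: "i < length (S # Bs)" "j < length (S # Bs)" for i j
  proof (cases i)
    case i: 0
    show ?thesis
    proof (cases j)
      case 0
      then show ?thesis using i \<pi>\<iota> by (simp add: i1_def p1_def)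
    next
      case (Suc j')
      then have j': "j' < ?n" using ij by simp
      have "(p0 j' \<circ>\<^bsub>C\<^esub> p) \<circ>\<^bsub>C\<^esub> \<iota> = p0 j' \<circ>\<^bsub>C\<^esub> cat_zero C S A'"
        using assoc[OF S A A' obj[OF j'] \<iota> p] 0(1)[OF j'] p\<iota> by simp
      also have "\<dots> = cat_zero C S (Bs ! j')"
        using zero(1)[OF S A' obj[OF j']] 0(1)[OF j'] by simp
      finally show ?thesis using i Suc by (simp add: i1_def p1_def)
    qed
  next
    case (Suc i')
    then have i': "i' < ?n" using ij by simp
    show ?thesis
    proof (cases j)
      case j: 0
      have "\<pi> \<circ>\<^bsub>C\<^esub> (\<kappa> \<circ>\<^bsub>C\<^esub> i0 i') = cat_zero C A' S \<circ>\<^bsub>C\<^esub> i0 i'"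
        using assoc[OF obj[OF i'] A' A S _ \<kappa> \<pi>] 0(1)[OF i'] \<pi>\<kappa> by simp
      also have "\<dots> = cat_zero C (Bs ! i') S"
        using zero(2)[OF obj[OF i'] A' S] 0(1)[OF i'] by simp
      finally show ?thesis using j Suc by (simp add: i1_def p1_def)
    next
      case j: (Suc j')
      then have j': "j' < ?n" using ij by simp
      have "(p0 j' \<circ>\<^bsub>C\<^esub> p) \<circ>\<^bsub>C\<^esub> (\<kappa> \<circ>\<^bsub>C\<^esub> i0 i') = p0 j' \<circ>\<^bsub>C\<^esub> (p \<circ>\<^bsub>C\<^esub> (\<kappa> \<circ>\<^bsub>C\<^esub> i0 i'))"
        using 0(1)[OF j'] 0(1)[OF i'] comp[OF obj[OF i'] A' A _ \<kappa>]
        by (intro assoc[OF obj[OF i'] A A' obj[OF j'] _ p]) auto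
      also have "\<dots> = p0 j' \<circ>\<^bsub>C\<^esub> i0 i'"
        using pk[OF obj[OF i']] 0(1)[OF i'] by simp
      finally show ?thesis using j Suc 0(2)[OF i' j'] by (simp add: i1_def p1_def)
    qed
  qed
  interpret E: ring "end_ring C A" by (rule end_ring_ring) fact+
  interpret E': ring "end_ring C A'" by (rule end_ring_ring) fact+
  have ip: "i0 i \<circ>\<^bsub>C\<^esub> p0 i \<in> cat_hom C A' A'" if "i < ?n" for i
    using comp[OF A' obj[OF that] A'] 0(1)[OF that] by blast
  have sandwich: "\<kappa> \<circ>\<^bsub>C\<^esub> (f \<circ>\<^bsub>C\<^esub> p) \<in> cat_hom C A A" if "f \<in> cat_hom C A' A'" for f
    using comp[OF A A' A comp[OF A A' A' p that] \<kappa>] .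
  have "i1 (Suc i) \<circ>\<^bsub>C\<^esub> p1 (Suc i) = \<kappa> \<circ>\<^bsub>C\<^esub> ((i0 i \<circ>\<^bsub>C\<^esub> p0 i) \<circ>\<^bsub>C\<^esub> p)" if i: "i < ?n" for i
  proof -
    have m: "i0 i \<in> cat_hom C (Bs ! i) A'" "p0 i \<in> cat_hom C A' (Bs ! i)" using 0(1)[OF i] by auto
    have "(\<kappa> \<circ>\<^bsub>C\<^esub> i0 i) \<circ>\<^bsub>C\<^esub> (p0 i \<circ>\<^bsub>C\<^esub> p) = \<kappa> \<circ>\<^bsub>C\<^esub> (i0 i \<circ>\<^bsub>C\<^esub> (p0 i \<circ>\<^bsub>C\<^esub> p))"
      by (rule assoc[OF A obj[OF i] A' A comp[OF A A' obj[OF i] p m(2)] m(1) \<kappa>])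
    also have "i0 i \<circ>\<^bsub>C\<^esub> (p0 i \<circ>\<^bsub>C\<^esub> p) = (i0 i \<circ>\<^bsub>C\<^esub> p0 i) \<circ>\<^bsub>C\<^esub> p"
      by (rule assoc[OF A A' obj[OF i] A' p m(2) m(1), symmetric])
    finally show ?thesis by (simp add: i1_def p1_def)
  qed
  then have "(\<Oplus>\<^bsub>end_ring C A\<^esub> i \<in> {..<?n}. i1 (Suc i) \<circ>\<^bsub>C\<^esub> p1 (Suc i)) =
      (\<Oplus>\<^bsub>end_ring C A\<^esub> i \<in> {..<?n}. \<kappa> \<circ>\<^bsub>C\<^esub> ((i0 i \<circ>\<^bsub>C\<^esub> p0 i) \<circ>\<^bsub>C\<^esub> p))"
    using ip sandwich by (intro E.finsum_cong') auto
  also have "\<dots> = \<kappa> \<circ>\<^bsub>C\<^esub> ((\<Oplus>\<^bsub>end_ring C A'\<^esub> i \<in> {..<?n}. i0 i \<circ>\<^bsub>C\<^esub> p0 i) \<circ>\<^bsub>C\<^esub> p)"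
  proof (rule finsum_additive[where h = "\<lambda>f. \<kappa> \<circ>\<^bsub>C\<^esub> (f \<circ>\<^bsub>C\<^esub> p)", symmetric])
    fix f g assume "f \<in> carrier (end_ring C A')" "g \<in> carrier (end_ring C A')"
    then have fg: "f \<in> cat_hom C A' A'" "g \<in> cat_hom C A' A'" by simp_all
    show "\<kappa> \<circ>\<^bsub>C\<^esub> ((f \<oplus>\<^bsub>end_ring C A'\<^esub> g) \<circ>\<^bsub>C\<^esub> p) =
        (\<kappa> \<circ>\<^bsub>C\<^esub> (f \<circ>\<^bsub>C\<^esub> p)) \<oplus>\<^bsub>end_ring C A\<^esub> (\<kappa> \<circ>\<^bsub>C\<^esub> (g \<circ>\<^bsub>C\<^esub> p))"
      using preadditive_distrib(2)[OF C A A' A' p p fg]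
        preadditive_distrib(1)[OF C A A' A comp[OF A A' A' p fg(1)] comp[OF A A' A' p fg(2)] \<kappa> \<kappa>] by simp
  qed (use ip sandwich E.abelian_group_axioms E'.abelian_group_axioms in auto)
  also have "\<dots> = \<kappa> \<circ>\<^bsub>C\<^esub> p"
    using s0 id(2)[OF A A' p] by simp
  finally have tail: "(\<Oplus>\<^bsub>end_ring C A\<^esub> i \<in> {..<?n}. i1 (Suc i) \<circ>\<^bsub>C\<^esub> p1 (Suc i)) = \<kappa> \<circ>\<^bsub>C\<^esub> p" .
  have cl: "i1 i \<circ>\<^bsub>C\<^esub> p1 i \<in> cat_hom C A A" if "i < Suc ?n" for i
    using hom0[of i] that obj S comp[OF A _ A] by (cases i) auto
  have "(\<Oplus>\<^bsub>end_ring C A\<^esub> i \<in> {..<length (S # Bs)}. i1 i \<circ>\<^bsub>C\<^esub> p1 i) =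
      (\<Oplus>\<^bsub>end_ring C A\<^esub> i \<in> insert 0 (Suc ` {..<?n}). i1 i \<circ>\<^bsub>C\<^esub> p1 i)"
    by (simp add: lessThan_Suc_eq_insert_0)
  also have "\<dots> = (i1 0 \<circ>\<^bsub>C\<^esub> p1 0) \<oplus>\<^bsub>end_ring C A\<^esub> (\<Oplus>\<^bsub>end_ring C A\<^esub> i \<in> Suc ` {..<?n}. i1 i \<circ>\<^bsub>C\<^esub> p1 i)"
    using cl by (intro E.finsum_insert) auto
  also have "(\<Oplus>\<^bsub>end_ring C A\<^esub> i \<in> Suc ` {..<?n}. i1 i \<circ>\<^bsub>C\<^esub> p1 i) =
      (\<Oplus>\<^bsub>end_ring C A\<^esub> i \<in> {..<?n}. i1 (Suc i) \<circ>\<^bsub>C\<^esub> p1 (Suc i))"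
    using cl by (intro E.finsum_reindex) auto
  finally have total: "(\<Oplus>\<^bsub>end_ring C A\<^esub> i \<in> {..<length (S # Bs)}. i1 i \<circ>\<^bsub>C\<^esub> p1 i) = cat_id C A"
    using tail sum by (simp add: i1_def p1_def)
  show ?thesis
    unfolding direct_sum_def using A S Bs_obj hom0 orth total
    by (intro conjI exI[of _ i1] exI[of _ p1] allI impI) auto
qed

section \<open>Equivariant objects\<close>

locale cyclic_action = cyclic_hull R u \<X> c + G: group G
  for R :: "'r ring" (structure) and u :: 'r and \<X> :: "'x set" and c :: "'x \<Rightarrow> 'x \<Rightarrow> 'x \<Rightarrow> nat"
    and G :: "'g monoid" +
  fixes \<phi> :: "'g \<Rightarrow> 'x \<Rightarrow> 'x"
  assumes action: "group_action G \<X> \<phi>"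
    and c_invariant: "\<lbrakk>\<gamma> \<in> carrier G; x \<in> \<X>; y \<in> \<X>; z \<in> \<X>\<rbrakk> \<Longrightarrow> c (\<phi> \<gamma> x) (\<phi> \<gamma> y) (\<phi> \<gamma> z) = c x y z"
    and G_finite: "finite (carrier G)"
    and order_unit: "[order G] \<cdot> \<one> \<in> Units R"
begin

abbreviation act :: "'g \<Rightarrow> ('x, 'r) mor \<Rightarrow> ('x, 'r) mor" where "act \<equiv> act_mor \<phi>"

abbreviation \<FF>G where "\<FF>G \<equiv> FG R u \<X> c G \<phi>"

lemma \<phi>_closed [simp]: "\<gamma> \<in> carrier G \<Longrightarrow> x \<in> \<X> \<Longrightarrow> \<phi> \<gamma> x \<in> \<X>"
  using group_action.element_image[OF action] by blast

lemma \<phi>_mult: "\<alpha> \<in> carrier G \<Longrightarrow> \<beta> \<in> carrier G \<Longrightarrow> x \<in> \<X> \<Longrightarrow> \<phi> (\<alpha> \<otimes>\<^bsub>G\<^esub> \<beta>) x = \<phi> \<alpha> (\<phi> \<beta> x)"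
  using group_action.composition_rule[OF action] by blast

lemma \<phi>_one [simp]: "x \<in> \<X> \<Longrightarrow> \<phi> \<one>\<^bsub>G\<^esub> x = x"
  by (simp add: group_action.id_eq_one[OF action, symmetric])

lemma \<phi>_iso: "\<gamma> \<in> carrier G \<Longrightarrow> x \<in> \<X> \<Longrightarrow> y \<in> \<X> \<Longrightarrow> cp_iso c (\<phi> \<gamma> x) (\<phi> \<gamma> y) \<longleftrightarrow> cp_iso c x y"
  by (simp add: cp_iso_def c_invariant)

lemma map_\<phi>_lists [simp]: "\<gamma> \<in> carrier G \<Longrightarrow> A \<in> lists \<X> \<Longrightarrow> map (\<phi> \<gamma>) A \<in> lists \<X>"
  by (induction A) auto

lemma map_\<phi>_mult:
  "\<alpha> \<in> carrier G \<Longrightarrow> \<beta> \<in> carrier G \<Longrightarrow> A \<in> lists \<X> \<Longrightarrow> map (\<phi> (\<alpha> \<otimes>\<^bsub>G\<^esub> \<beta>)) A = map (\<phi> \<alpha>) (map (\<phi> \<beta>) A)"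
  by (induction A) (auto simp: \<phi>_mult)

lemma map_\<phi>_one [simp]: "A \<in> lists \<X> \<Longrightarrow> map (\<phi> \<one>\<^bsub>G\<^esub>) A = A"
  by (induction A) auto

lemma act_simps [simp]:
  "src (act \<gamma> f) = map (\<phi> \<gamma>) (src f)" "tgt (act \<gamma> f) = map (\<phi> \<gamma>) (tgt f)"
  "coeffs (act \<gamma> f) = coeffs f"
  by (simp_all add: act_mor_def)

lemma act_Ar [simp]: "\<gamma> \<in> carrier G \<Longrightarrow> f \<in> Ar \<Longrightarrow> act \<gamma> f \<in> Ar"
  unfolding Ar_def by simp

lemma act_comp:
  assumes "\<gamma> \<in> carrier G" "f \<in> Ar" "g \<in> Ar" "src g = tgt f"
  shows "act \<gamma> (g \<star> f) = act \<gamma> g \<star> act \<gamma> f"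
proof (rule mor_eqI)
  fix k i assume "k < length (tgt (act \<gamma> g \<star> act \<gamma> f))" "i < length (src (act \<gamma> g \<star> act \<gamma> f))"
  then have ki: "k < length (tgt g)" "i < length (src f)" by simp_all
  show "ent (act \<gamma> (g \<star> f)) k i = ent (act \<gamma> g \<star> act \<gamma> f) k i"
    using assms ki u_closed by (simp add: ent_comp) (intro finsum_cong', auto simp: c_invariant)
qed (use assms in simp_all)

lemma act_ide [simp]: "act \<gamma> (ide A) = ide (map (\<phi> \<gamma>) A)"
  by (simp add: act_mor_def ide_def mk_def)

lemma act_null [simp]: "act \<gamma> (null A B) = null (map (\<phi> \<gamma>) A) (map (\<phi> \<gamma>) B)"
  by (simp add: act_mor_def null_def mk_def)

lemma act_plus: "act \<gamma> (f \<boxplus> g) = act \<gamma> f \<boxplus> act \<gamma> g"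
  by (simp add: act_mor_def plus_def mk_def)

lemma act_scal: "act \<gamma> (scal r f) = scal r (act \<gamma> f)"
  by (simp add: act_mor_def scal_def mk_def)

lemma act_one [simp]: "f \<in> Ar \<Longrightarrow> act \<one>\<^bsub>G\<^esub> f = f"
  by (cases f) (simp add: act_mor_def, metis Ar_src Ar_tgt map_\<phi>_one mor.sel(1,2))

lemma act_mult:
  "\<alpha> \<in> carrier G \<Longrightarrow> \<beta> \<in> carrier G \<Longrightarrow> f \<in> Ar \<Longrightarrow> act (\<alpha> \<otimes>\<^bsub>G\<^esub> \<beta>) f = act \<alpha> (act \<beta> f)"
  unfolding act_mor_def by (simp add: map_\<phi>_mult)

lemma rad_act: "\<gamma> \<in> carrier G \<Longrightarrow> f \<in> Ar \<Longrightarrow> rad (act \<gamma> f) \<longleftrightarrow> rad f"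
  by (simp add: rad_def \<phi>_iso)

subsection \<open>Objects and morphisms of the equivariant category\<close>

text \<open>Given the cocycle condition, all \<open>\<xi>\<^sub>\<gamma>\<close> are isomorphisms if and only if \<open>\<xi>\<close> is normalized by
  \<open>\<xi>\<^sub>1 = 1\<close>, a condition that is easier to verify.\<close>

definition eqobj :: "'x list \<Rightarrow> ('g \<Rightarrow> ('x, 'r) mor) \<Rightarrow> bool" where
  "eqobj A \<xi> \<longleftrightarrow> A \<in> lists \<X> \<and>
     (\<forall>\<gamma>\<in>carrier G. \<xi> \<gamma> \<in> Ar \<and> src (\<xi> \<gamma>) = map (\<phi> \<gamma>) A \<and> tgt (\<xi> \<gamma>) = A) \<and> \<xi> \<one>\<^bsub>G\<^esub> = ide A \<and>
     (\<forall>\<alpha>\<in>carrier G. \<forall>\<beta>\<in>carrier G. \<xi> (\<alpha> \<otimes>\<^bsub>G\<^esub> \<beta>) = \<xi> \<alpha> \<star> act \<alpha> (\<xi> \<beta>))"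

lemma eqobjD:
  assumes "eqobj A \<xi>"
  shows "A \<in> lists \<X>" "\<gamma> \<in> carrier G \<Longrightarrow> \<xi> \<gamma> \<in> Ar" "\<gamma> \<in> carrier G \<Longrightarrow> src (\<xi> \<gamma>) = map (\<phi> \<gamma>) A"
    "\<gamma> \<in> carrier G \<Longrightarrow> tgt (\<xi> \<gamma>) = A" "\<xi> \<one>\<^bsub>G\<^esub> = ide A"
    "\<alpha> \<in> carrier G \<Longrightarrow> \<beta> \<in> carrier G \<Longrightarrow> \<xi> (\<alpha> \<otimes>\<^bsub>G\<^esub> \<beta>) = \<xi> \<alpha> \<star> act \<alpha> (\<xi> \<beta>)"
  using assms by (auto simp: eqobj_def)

text \<open>The cocycle condition for \<open>\<gamma>\<close> and its inverse, in both orders; in the second order it has to be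
  translated by \<open>\<gamma>\<close>.\<close>

lemma eqobj_inverse:
  assumes "eqobj A \<xi>" "\<gamma> \<in> carrier G"
  shows "inverse_of (\<xi> \<gamma>) (act \<gamma> (\<xi> (inv\<^bsub>G\<^esub> \<gamma>)))"
proof -
  note D = eqobjD[OF assms(1)]
  have i: "inv\<^bsub>G\<^esub> \<gamma> \<in> carrier G" using assms by simp
  have m: "map (\<phi> \<gamma>) (map (\<phi> (inv\<^bsub>G\<^esub> \<gamma>)) A) = A"
    using map_\<phi>_mult[OF assms(2) i D(1)] assms(2) D(1) by (simp del: map_map)
  have "\<xi> \<gamma> \<star> act \<gamma> (\<xi> (inv\<^bsub>G\<^esub> \<gamma>)) = ide A"
    using D(6)[OF assms(2) i] D(5) assms(2) by simp
  moreover have "act \<gamma> (\<xi> (inv\<^bsub>G\<^esub> \<gamma>)) \<star> \<xi> \<gamma> = ide (map (\<phi> \<gamma>) A)"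
  proof -
    have "act \<gamma> (\<xi> (inv\<^bsub>G\<^esub> \<gamma>)) \<star> \<xi> \<gamma> = act \<gamma> (\<xi> (inv\<^bsub>G\<^esub> \<gamma>)) \<star> act \<gamma> (act (inv\<^bsub>G\<^esub> \<gamma>) (\<xi> \<gamma>))"
      using act_mult[OF assms(2) i D(2)[OF assms(2)]] assms(2) D(2)[OF assms(2)] by simp
    also have "\<dots> = act \<gamma> (\<xi> (inv\<^bsub>G\<^esub> \<gamma>) \<star> act (inv\<^bsub>G\<^esub> \<gamma>) (\<xi> \<gamma>))"
      using assms(2) i D(2-4) by (intro act_comp[symmetric]) simp_all
    also have "\<xi> (inv\<^bsub>G\<^esub> \<gamma>) \<star> act (inv\<^bsub>G\<^esub> \<gamma>) (\<xi> \<gamma>) = ide A"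
      using D(6)[OF i assms(2), symmetric] D(5) assms(2) by simp
    also have "act \<gamma> (ide A) = ide (map (\<phi> \<gamma>) A)" by simp
    finally show ?thesis .
  qed
  ultimately show ?thesis
    using D(2-4)[OF assms(2)] D(2-4)[OF i] m assms(2) by (simp add: inverse_of_def del: map_map)
qed

lemma eqobj_iff:
  "(A, \<xi>) \<in> cat_obj \<FF>G \<longleftrightarrow> eqobj A \<xi> \<and> \<xi> \<in> extensional (carrier G)"
proof
  assume "(A, \<xi>) \<in> cat_obj \<FF>G"
  then have A: "A \<in> lists \<X>" and ext: "\<xi> \<in> extensional (carrier G)"
    and iso: "\<And>\<gamma>. \<gamma> \<in> carrier G \<Longrightarrow> \<xi> \<gamma> \<in> cat_iso C (map (\<phi> \<gamma>) A) A"
    and cocyc: "\<And>\<alpha> \<beta>. \<alpha> \<in> carrier G \<Longrightarrow> \<beta> \<in> carrier G \<Longrightarrow> \<xi> (\<alpha> \<otimes>\<^bsub>G\<^esub> \<beta>) = \<xi> \<alpha> \<star> act \<alpha> (\<xi> \<beta>)"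
    by (auto simp: equivariant_cat_def PiE_def)
  have inv: "src (\<xi> \<gamma>) = map (\<phi> \<gamma>) A \<and> tgt (\<xi> \<gamma>) = A \<and> (\<exists>g. inverse_of (\<xi> \<gamma>) g)" if "\<gamma> \<in> carrier G" for \<gamma>
    using iso[OF that] cat_iso_iff[of "map (\<phi> \<gamma>) A" A] that A by simp
  then have Ar: "\<xi> \<gamma> \<in> Ar" if "\<gamma> \<in> carrier G" for \<gamma> using that by (auto simp: inverse_of_def)
  \<comment> \<open>The isomorphism \<open>\<xi> \<one>\<close> is idempotent.\<close>
  obtain g where g: "inverse_of (\<xi> \<one>\<^bsub>G\<^esub>) g" using inv[of "\<one>\<^bsub>G\<^esub>"] by auto
  have "\<xi> \<one>\<^bsub>G\<^esub> = \<xi> \<one>\<^bsub>G\<^esub> \<star> \<xi> \<one>\<^bsub>G\<^esub>"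
    using cocyc[of "\<one>\<^bsub>G\<^esub>" "\<one>\<^bsub>G\<^esub>"] Ar[of "\<one>\<^bsub>G\<^esub>"] by simp
  then have "g \<star> \<xi> \<one>\<^bsub>G\<^esub> = g \<star> \<xi> \<one>\<^bsub>G\<^esub> \<star> \<xi> \<one>\<^bsub>G\<^esub>" by simp
  also have "\<dots> = \<xi> \<one>\<^bsub>G\<^esub>"
    using comp_cancel[of g "\<xi> \<one>\<^bsub>G\<^esub>" "ide A" "\<xi> \<one>\<^bsub>G\<^esub>"] g inv[of "\<one>\<^bsub>G\<^esub>"] A
      by (auto simp: inverse_of_def)
  finally have "\<xi> \<one>\<^bsub>G\<^esub> = ide A" using g inv[of "\<one>\<^bsub>G\<^esub>"] A by (simp add: inverse_of_def)
  then show "eqobj A \<xi> \<and> \<xi> \<in> extensional (carrier G)"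
    using A ext inv Ar cocyc by (simp add: eqobj_def)
next
  assume a: "eqobj A \<xi> \<and> \<xi> \<in> extensional (carrier G)"
  then have "\<xi> \<gamma> \<in> cat_iso C (map (\<phi> \<gamma>) A) A" if "\<gamma> \<in> carrier G" for \<gamma>
    using that eqobj_inverse[of A \<xi> \<gamma>] eqobjD[of A \<xi>] by (subst cat_iso_iff) auto
  then show "(A, \<xi>) \<in> cat_obj \<FF>G"
    using a by (simp add: equivariant_cat_def eqobj_def PiE_def Pi_def)
qed

definition eqv :: "('g \<Rightarrow> ('x, 'r) mor) \<Rightarrow> ('g \<Rightarrow> ('x, 'r) mor) \<Rightarrow> ('x, 'r) mor \<Rightarrow> bool" where
  "eqv \<xi> \<eta> f \<longleftrightarrow> (\<forall>\<gamma>\<in>carrier G. f \<star> \<xi> \<gamma> = \<eta> \<gamma> \<star> act \<gamma> f)"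

lemma eqvD: "eqv \<xi> \<eta> f \<Longrightarrow> \<gamma> \<in> carrier G \<Longrightarrow> f \<star> \<xi> \<gamma> = \<eta> \<gamma> \<star> act \<gamma> f"
  by (simp add: eqv_def)

lemma FG_simps [simp]:
  "cat_comp \<FF>G = (\<star>)" "cat_id \<FF>G (A, \<xi>) = ide A" "cat_zero \<FF>G (A, \<xi>) (B, \<eta>) = null A B"
  "cat_add \<FF>G = (\<boxplus>)"
  by (simp_all add: equivariant_cat_def fun_eq_iff)

lemma FG_hom_iff:
  "A \<in> lists \<X> \<Longrightarrow> B \<in> lists \<X> \<Longrightarrow>
    f \<in> cat_hom \<FF>G (A, \<xi>) (B, \<eta>) \<longleftrightarrow> f \<in> Ar \<and> src f = A \<and> tgt f = B \<and> eqv \<xi> \<eta> f"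
  by (simp add: equivariant_cat_def hom_iff eqv_def)

lemma eqv_comp:
  assumes "eqobj A \<xi>" "eqobj B \<eta>" "eqobj D \<zeta>" "f \<in> Ar" "src f = A" "tgt f = B"
    and "g \<in> Ar" "src g = B" "tgt g = D" "eqv \<xi> \<eta> f" "eqv \<eta> \<zeta> g"
  shows "eqv \<xi> \<zeta> (g \<star> f)"
  unfolding eqv_def
proof
  fix \<gamma> assume G: "\<gamma> \<in> carrier G"
  note s = eqobjD(2-4)[OF assms(1) G] eqobjD(2-4)[OF assms(2) G] eqobjD(2-4)[OF assms(3) G]
  have "(g \<star> f) \<star> \<xi> \<gamma> = g \<star> (\<eta> \<gamma> \<star> act \<gamma> f)"
    using assms s G eqvD[OF assms(10) G] by simp
  also have "\<dots> = (\<zeta> \<gamma> \<star> act \<gamma> g) \<star> act \<gamma> f"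
    using assms s G eqvD[OF assms(11) G] by (simp flip: comp_assoc)
  also have "\<dots> = \<zeta> \<gamma> \<star> act \<gamma> (g \<star> f)"
    using assms s G by (simp add: act_comp)
  finally show "(g \<star> f) \<star> \<xi> \<gamma> = \<zeta> \<gamma> \<star> act \<gamma> (g \<star> f)" .
qed

lemma eqv_ide: "eqobj A \<xi> \<Longrightarrow> eqv \<xi> \<xi> (ide A)"
  using eqobjD[of A \<xi>] by (simp add: eqv_def)

lemma eqv_null: "eqobj A \<xi> \<Longrightarrow> eqobj B \<eta> \<Longrightarrow> eqv \<xi> \<eta> (null A B)"
  using eqobjD[of A \<xi>] eqobjD[of B \<eta>] by (simp add: eqv_def)

lemma eqv_plus:
  assumes "eqobj A \<xi>" "eqobj B \<eta>" "f \<in> Ar" "src f = A" "tgt f = B" "g \<in> Ar" "src g = A" "tgt g = B"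
    and "eqv \<xi> \<eta> f" "eqv \<xi> \<eta> g"
  shows "eqv \<xi> \<eta> (f \<boxplus> g)"
  using assms eqobjD[OF assms(1)] eqobjD[OF assms(2)]
  by (simp add: eqv_def comp_plus_left comp_plus_right act_plus)

lemma eqv_scal:
  assumes "eqobj A \<xi>" "eqobj B \<eta>" "f \<in> Ar" "src f = A" "tgt f = B" "eqv \<xi> \<eta> f" "r \<in> carrier R"
  shows "eqv \<xi> \<eta> (scal r f)"
  using assms eqobjD[OF assms(1)] eqobjD[OF assms(2)]
  by (simp add: eqv_def comp_scal_left comp_scal_right act_scal)

lemma eqv_inverse:
  assumes "eqobj A \<xi>" "eqobj B \<eta>" "src f = A" "tgt f = B" "eqv \<xi> \<eta> f" and inv: "inverse_of f g"
  shows "eqv \<eta> \<xi> g"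
  unfolding eqv_def
proof
  fix \<gamma> assume G: "\<gamma> \<in> carrier G"
  note s = eqobjD(2-4)[OF assms(1) G] eqobjD(2-4)[OF assms(2) G]
  note i = inv[unfolded inverse_of_def]
  have "act \<gamma> f \<star> act \<gamma> g = ide (map (\<phi> \<gamma>) B)"
    using act_comp[OF G, of g f] i assms(3,4) by simp
  then have "g \<star> \<eta> \<gamma> = g \<star> \<eta> \<gamma> \<star> act \<gamma> f \<star> act \<gamma> g"
    using s i assms G by simp
  also have "\<dots> = g \<star> (\<eta> \<gamma> \<star> act \<gamma> f) \<star> act \<gamma> g"
    using s i assms G by simp
  also have "\<dots> = g \<star> (f \<star> \<xi> \<gamma>) \<star> act \<gamma> g"
    using eqvD[OF assms(5) G] by simp
  also have "\<dots> = \<xi> \<gamma> \<star> act \<gamma> g"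
    using s i assms G comp_cancel[of g f _ "\<xi> \<gamma> \<star> act \<gamma> g"] by simp
  finally show "g \<star> \<eta> \<gamma> = \<xi> \<gamma> \<star> act \<gamma> g" .
qed

lemma category_FG: "category \<FF>G"
  unfolding category_def
proof (intro conjI ballI)
  fix P assume "P \<in> cat_obj \<FF>G"
  then show "cat_id \<FF>G P \<in> cat_hom \<FF>G P P"
    by (cases P) (auto simp: eqobj_iff eqobjD(1) FG_hom_iff eqv_ide)
next
  fix P Q S f g assume "P \<in> cat_obj \<FF>G" "Q \<in> cat_obj \<FF>G" "S \<in> cat_obj \<FF>G"
    "f \<in> cat_hom \<FF>G P Q" "g \<in> cat_hom \<FF>G Q S"
  then show "g \<circ>\<^bsub>\<FF>G\<^esub> f \<in> cat_hom \<FF>G P S"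
    by (cases P; cases Q; cases S) (auto simp: eqobj_iff eqobjD(1) FG_hom_iff intro: eqv_comp)
next
  fix P Q f assume "P \<in> cat_obj \<FF>G" "Q \<in> cat_obj \<FF>G" "f \<in> cat_hom \<FF>G P Q"
  then show "f \<circ>\<^bsub>\<FF>G\<^esub> cat_id \<FF>G P = f" "cat_id \<FF>G Q \<circ>\<^bsub>\<FF>G\<^esub> f = f"
    by (cases P; cases Q; auto simp: eqobj_iff eqobjD(1) FG_hom_iff)+
next
  fix P Q S T f g h assume "P \<in> cat_obj \<FF>G" "Q \<in> cat_obj \<FF>G" "S \<in> cat_obj \<FF>G" "T \<in> cat_obj \<FF>G"
    "f \<in> cat_hom \<FF>G P Q" "g \<in> cat_hom \<FF>G Q S" "h \<in> cat_hom \<FF>G S T"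
  then show "(h \<circ>\<^bsub>\<FF>G\<^esub> g) \<circ>\<^bsub>\<FF>G\<^esub> f = h \<circ>\<^bsub>\<FF>G\<^esub> (g \<circ>\<^bsub>\<FF>G\<^esub> f)"
    by (cases P; cases Q; cases S; cases T) (auto simp: eqobj_iff eqobjD(1) FG_hom_iff)
qed

lemma preadditive_FG: "preadditive \<FF>G"
  unfolding preadditive_def
proof (intro conjI ballI)
  show "category \<FF>G" by (rule category_FG)
next
  fix P Q assume PQ: "P \<in> cat_obj \<FF>G" "Q \<in> cat_obj \<FF>G"
  obtain A \<xi> B \<eta> where [simp]: "P = (A, \<xi>)" "Q = (B, \<eta>)" by (metis surj_pair)
  have o: "eqobj A \<xi>" "eqobj B \<eta>" using PQ by (auto simp: eqobj_iff)
  note [simp] = eqobjD(1)[OF o(1)] eqobjD(1)[OF o(2)]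
  show "comm_group \<lparr>carrier = cat_hom \<FF>G P Q, monoid.mult = cat_add \<FF>G, one = cat_zero \<FF>G P Q\<rparr>"
  proof (rule comm_groupI)
    fix f assume "f \<in> carrier \<lparr>carrier = cat_hom \<FF>G P Q, monoid.mult = cat_add \<FF>G, one = cat_zero \<FF>G P Q\<rparr>"
    then have f: "f \<in> Ar" "src f = A" "tgt f = B" "eqv \<xi> \<eta> f" by (simp_all add: FG_hom_iff)
    have "scal (\<ominus> \<one>) f \<in> cat_hom \<FF>G P Q"
      using f o by (auto simp: FG_hom_iff intro: eqv_scal)
    moreover have "scal (\<ominus> \<one>) f \<boxplus> f = null A B"
      using f by (auto intro!: mor_eqI simp: l_minus l_neg)
    ultimately show "\<exists>g\<in>carrier \<lparr>carrier = cat_hom \<FF>G P Q, monoid.mult = cat_add \<FF>G, one = cat_zero \<FF>G P Q\<rparr>.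
        g \<otimes>\<^bsub>\<lparr>carrier = cat_hom \<FF>G P Q, monoid.mult = cat_add \<FF>G, one = cat_zero \<FF>G P Q\<rparr>\<^esub> f =
        \<one>\<^bsub>\<lparr>carrier = cat_hom \<FF>G P Q, monoid.mult = cat_add \<FF>G, one = cat_zero \<FF>G P Q\<rparr>\<^esub>"
      by auto
  qed (use o in \<open>auto simp: FG_hom_iff eqv_plus eqv_null a_ac intro!: mor_eqI\<close>)
next
  fix P Q S f f' g g'
  assume *: "P \<in> cat_obj \<FF>G" "Q \<in> cat_obj \<FF>G" "S \<in> cat_obj \<FF>G" "f \<in> cat_hom \<FF>G P Q"
    "f' \<in> cat_hom \<FF>G P Q" "g \<in> cat_hom \<FF>G Q S" "g' \<in> cat_hom \<FF>G Q S"
  obtain A \<xi> B \<eta> D \<zeta> where [simp]: "P = (A, \<xi>)" "Q = (B, \<eta>)" "S = (D, \<zeta>)" by (metis surj_pair)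
  have o: "A \<in> lists \<X>" "B \<in> lists \<X>" "D \<in> lists \<X>"
    using *(1-3) eqobjD(1) by (auto simp: eqobj_iff)
  show "g \<circ>\<^bsub>\<FF>G\<^esub> cat_add \<FF>G f f' = cat_add \<FF>G (g \<circ>\<^bsub>\<FF>G\<^esub> f) (g \<circ>\<^bsub>\<FF>G\<^esub> f')"
    using *(4-7) o by (simp add: FG_hom_iff comp_plus_right)
  show "cat_add \<FF>G g g' \<circ>\<^bsub>\<FF>G\<^esub> f = cat_add \<FF>G (g \<circ>\<^bsub>\<FF>G\<^esub> f) (g' \<circ>\<^bsub>\<FF>G\<^esub> f)"
    using *(4-7) o by (simp add: FG_hom_iff comp_plus_left)
qed

end

section \<open>Induced objects\<close>

context cyclic_action
begin

abbreviation stab :: "'x \<Rightarrow> 'g set" where "stab x \<equiv> eff_stabilizer G c \<phi> x"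

lemma stab_iff: "\<beta> \<in> stab x \<longleftrightarrow> \<beta> \<in> carrier G \<and> cp_iso c (\<phi> \<beta> x) x"
  by (simp add: eff_stabilizer_def)

lemma stab_one [simp]: "x \<in> \<X> \<Longrightarrow> \<one>\<^bsub>G\<^esub> \<in> stab x"
  by (simp add: stab_iff)

lemma iso_translate:
  assumes "x \<in> \<X>" "\<alpha> \<in> carrier G" "\<beta> \<in> carrier G"
  shows "cp_iso c (\<phi> \<beta> x) (\<phi> \<alpha> x) \<longleftrightarrow> inv\<^bsub>G\<^esub> \<alpha> \<otimes>\<^bsub>G\<^esub> \<beta> \<in> stab x"
proof -
  have "\<phi> (inv\<^bsub>G\<^esub> \<alpha>) (\<phi> \<alpha> x) = x"
    using assms by (simp flip: \<phi>_mult)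
  then have "cp_iso c (\<phi> \<beta> x) (\<phi> \<alpha> x) \<longleftrightarrow> cp_iso c (\<phi> (inv\<^bsub>G\<^esub> \<alpha>) (\<phi> \<beta> x)) x"
    using \<phi>_iso[of "inv\<^bsub>G\<^esub> \<alpha>" "\<phi> \<beta> x" "\<phi> \<alpha> x"] assms by simp
  then show ?thesis using assms by (simp add: stab_iff \<phi>_mult)
qed

lemma stab_mult:
  assumes "x \<in> \<X>" "\<alpha> \<in> stab x" "\<beta> \<in> stab x"
  shows "\<alpha> \<otimes>\<^bsub>G\<^esub> \<beta> \<in> stab x"
proof -
  have "cp_iso c (\<phi> \<alpha> (\<phi> \<beta> x)) (\<phi> \<alpha> x)" "cp_iso c (\<phi> \<alpha> x) x"
    using assms by (auto simp: stab_iff \<phi>_iso)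
  then have "cp_iso c (\<phi> \<alpha> (\<phi> \<beta> x)) x"
    using assms iso_trans[of "\<phi> \<alpha> (\<phi> \<beta> x)" "\<phi> \<alpha> x" x] by (auto simp: stab_iff)
  then show ?thesis using assms by (auto simp: stab_iff \<phi>_mult)
qed

lemma stab_inv:
  assumes "x \<in> \<X>" "\<alpha> \<in> stab x"
  shows "inv\<^bsub>G\<^esub> \<alpha> \<in> stab x"
  using iso_translate[of x \<alpha> "\<one>\<^bsub>G\<^esub>"] iso_sym[of "\<phi> \<alpha> x" x] assms by (auto simp: stab_iff)

lemma stab_mult_iff:
  assumes "x \<in> \<X>" "\<alpha> \<in> carrier G" "\<beta> \<in> stab x"
  shows "\<alpha> \<otimes>\<^bsub>G\<^esub> \<beta> \<in> stab x \<longleftrightarrow> \<alpha> \<in> stab x"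
proof
  assume "\<alpha> \<otimes>\<^bsub>G\<^esub> \<beta> \<in> stab x"
  then have "(\<alpha> \<otimes>\<^bsub>G\<^esub> \<beta>) \<otimes>\<^bsub>G\<^esub> inv\<^bsub>G\<^esub> \<beta> \<in> stab x"
    using stab_mult stab_inv assms by blast
  moreover have "\<beta> \<in> carrier G" using assms(3) by (simp add: stab_iff)
  ultimately show "\<alpha> \<in> stab x" using assms(2) by (simp add: G.m_assoc)
qed (use stab_mult assms in blast)

lemma inv_cancel [simp]:
  assumes "a \<in> carrier G" "b \<in> carrier G"
  shows "a \<otimes>\<^bsub>G\<^esub> (inv\<^bsub>G\<^esub> a \<otimes>\<^bsub>G\<^esub> b) = b" "inv\<^bsub>G\<^esub> a \<otimes>\<^bsub>G\<^esub> (a \<otimes>\<^bsub>G\<^esub> b) = b"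
  using assms by (simp_all flip: G.m_assoc)

lemma stab_subset: "stab x \<subseteq> carrier G"
  by (auto simp: stab_iff)

end

locale induced_object = cyclic_action R u \<X> c G \<phi>
  for R :: "'r ring" (structure) and u :: 'r and \<X> :: "'x set" and c :: "'x \<Rightarrow> 'x \<Rightarrow> 'x \<Rightarrow> nat"
    and G :: "'g monoid" and \<phi> :: "'g \<Rightarrow> 'x \<Rightarrow> 'x" +
  fixes x :: 'x and \<sigma> :: "'g list" and \<theta> :: "'g \<Rightarrow> 'r"
  assumes x: "x \<in> \<X>" and reps: "left_coset_reps G (eff_stabilizer G c \<phi> x) \<sigma>"
    and \<theta>: "\<theta> \<in> hom (G\<lparr>carrier := eff_stabilizer G c \<phi> x\<rparr>) (units_of R)"
begin

abbreviation H :: "'g set" where "H \<equiv> stab x"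

text \<open>The two parts of the object \<open>S\<^sub>\<theta> x\<close>: its list of summands and its equivariant structure.\<close>

definition SA :: "'x list" where "SA = map (\<lambda>s. \<phi> s x) \<sigma>"

definition S\<xi> :: "'g \<Rightarrow> ('x, 'r) mor" where
  "S\<xi> = (\<lambda>\<gamma>\<in>carrier G. mk (map (\<phi> \<gamma>) SA) SA (\<lambda>j i.
     if inv\<^bsub>G\<^esub> (\<sigma> ! j) \<otimes>\<^bsub>G\<^esub> (\<gamma> \<otimes>\<^bsub>G\<^esub> \<sigma> ! i) \<in> H
     then \<theta> (inv\<^bsub>G\<^esub> (\<sigma> ! j) \<otimes>\<^bsub>G\<^esub> (\<gamma> \<otimes>\<^bsub>G\<^esub> \<sigma> ! i)) else \<zero>))"

lemma S_obj_eq: "S_obj R G c \<phi> \<sigma> \<theta> x = (SA, S\<xi>)"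
  by (simp add: S_obj_def SA_def S\<xi>_def mk_def Let_def)

lemma \<theta>_unit: "\<eta> \<in> H \<Longrightarrow> \<theta> \<eta> \<in> Units R"
  using \<theta> by (auto simp: hom_def units_of_def)

lemma \<theta>_closed [simp]: "\<eta> \<in> H \<Longrightarrow> \<theta> \<eta> \<in> carrier R"
  using \<theta>_unit by (rule Units_closed)

lemma \<theta>_mult: "\<alpha> \<in> H \<Longrightarrow> \<beta> \<in> H \<Longrightarrow> \<theta> (\<alpha> \<otimes>\<^bsub>G\<^esub> \<beta>) = \<theta> \<alpha> \<otimes> \<theta> \<beta>"
  using \<theta> by (auto simp: hom_def units_of_def)

lemma \<theta>_one [simp]: "\<theta> \<one>\<^bsub>G\<^esub> = \<one>"
proof -
  have 1: "\<one>\<^bsub>G\<^esub> \<in> H" using x by simp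
  have "\<theta> \<one>\<^bsub>G\<^esub> \<otimes> \<theta> \<one>\<^bsub>G\<^esub> = \<theta> \<one>\<^bsub>G\<^esub>" using \<theta>_mult[OF 1 1] by simp
  then show ?thesis
    using Units_l_cancel[OF \<theta>_unit[OF 1], of "\<theta> \<one>\<^bsub>G\<^esub>" \<one>] 1 by simp
qed

lemma \<sigma>_closed [simp]: "i < length \<sigma> \<Longrightarrow> \<sigma> ! i \<in> carrier G"
  using reps by (auto simp: left_coset_reps_def)

lemma SA_simps [simp]: "length SA = length \<sigma>" "i < length \<sigma> \<Longrightarrow> SA ! i = \<phi> (\<sigma> ! i) x" "SA \<in> lists \<X>"
  using x reps by (auto simp: SA_def left_coset_reps_def in_lists_conv_set)

lemma coset_ex1:
  assumes "\<gamma> \<in> carrier G"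
  shows "\<exists>!i. i < length \<sigma> \<and> inv\<^bsub>G\<^esub> (\<sigma> ! i) \<otimes>\<^bsub>G\<^esub> \<gamma> \<in> H"
proof -
  have "\<gamma> \<in> \<sigma> ! i <#\<^bsub>G\<^esub> H \<longleftrightarrow> inv\<^bsub>G\<^esub> (\<sigma> ! i) \<otimes>\<^bsub>G\<^esub> \<gamma> \<in> H" if i: "i < length \<sigma>" for i
  proof
    assume "\<gamma> \<in> \<sigma> ! i <#\<^bsub>G\<^esub> H"
    then obtain h where "h \<in> H" "\<gamma> = \<sigma> ! i \<otimes>\<^bsub>G\<^esub> h" by (auto simp: l_coset_def)
    moreover from this have "h \<in> carrier G" using stab_subset by blast
    ultimately show "inv\<^bsub>G\<^esub> (\<sigma> ! i) \<otimes>\<^bsub>G\<^esub> \<gamma> \<in> H" using i by (simp flip: G.m_assoc)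
  next
    assume h: "inv\<^bsub>G\<^esub> (\<sigma> ! i) \<otimes>\<^bsub>G\<^esub> \<gamma> \<in> H"
    have "\<gamma> = \<sigma> ! i \<otimes>\<^bsub>G\<^esub> (inv\<^bsub>G\<^esub> (\<sigma> ! i) \<otimes>\<^bsub>G\<^esub> \<gamma>)" using i assms by (simp flip: G.m_assoc)
    with h show "\<gamma> \<in> \<sigma> ! i <#\<^bsub>G\<^esub> H" unfolding l_coset_def by blast
  qed
  then show ?thesis using reps assms unfolding left_coset_reps_def by metis
qed

lemma coset_unique:
  assumes "i < length \<sigma>" "j < length \<sigma>" "\<gamma> \<in> carrier G"
    and "inv\<^bsub>G\<^esub> (\<sigma> ! i) \<otimes>\<^bsub>G\<^esub> \<gamma> \<in> H" "inv\<^bsub>G\<^esub> (\<sigma> ! j) \<otimes>\<^bsub>G\<^esub> \<gamma> \<in> H"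
  shows "i = j"
  using coset_ex1[OF assms(3)] assms by blast

lemma coset_same: "i < length \<sigma> \<Longrightarrow> j < length \<sigma> \<Longrightarrow> inv\<^bsub>G\<^esub> (\<sigma> ! j) \<otimes>\<^bsub>G\<^esub> \<sigma> ! i \<in> H \<longleftrightarrow> i = j"
  using coset_unique[of i j "\<sigma> ! i"] x by auto

lemma SA_iso: "i < length \<sigma> \<Longrightarrow> j < length \<sigma> \<Longrightarrow> cp_iso c (SA ! i) (SA ! j) \<longleftrightarrow> i = j"
  using iso_translate[OF x, of "\<sigma> ! j" "\<sigma> ! i"] coset_same[of i j] by simp

lemma \<sigma>_nonempty: "0 < length \<sigma>"
  using coset_ex1[OF G.one_closed] by auto

lemma S\<xi>_simps:
  assumes "\<gamma> \<in> carrier G"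
  shows "src (S\<xi> \<gamma>) = map (\<phi> \<gamma>) SA" "tgt (S\<xi> \<gamma>) = SA" "S\<xi> \<gamma> \<in> Ar"
    and "i < length \<sigma> \<Longrightarrow> j < length \<sigma> \<Longrightarrow> ent (S\<xi> \<gamma>) j i =
      (if inv\<^bsub>G\<^esub> (\<sigma> ! j) \<otimes>\<^bsub>G\<^esub> (\<gamma> \<otimes>\<^bsub>G\<^esub> \<sigma> ! i) \<in> H
       then \<theta> (inv\<^bsub>G\<^esub> (\<sigma> ! j) \<otimes>\<^bsub>G\<^esub> (\<gamma> \<otimes>\<^bsub>G\<^esub> \<sigma> ! i)) else \<zero>)"
  using assms by (auto simp: S\<xi>_def intro!: Ar_mk simp del: map_map)

text \<open>Each \<open>S\<xi> \<gamma>\<close> is a monomial matrix: in column \<open>i\<close> only the row \<open>j\<close> with \<open>\<gamma> \<sigma>\<^sub>i \<in> \<sigma>\<^sub>j H\<close> is nonzero. So an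
  entry of a product is a product of two entries, and \<open>\<theta>\<close> is multiplicative.\<close>

lemma S_eqobj: "eqobj SA S\<xi>"
  unfolding eqobj_def
proof (intro conjI ballI)
  show "S\<xi> \<one>\<^bsub>G\<^esub> = ide SA"
    by (rule mor_eqI) (auto simp: S\<xi>_simps coset_same)
next
  fix \<alpha> \<beta> assume G: "\<alpha> \<in> carrier G" "\<beta> \<in> carrier G"
  then have \<alpha>\<beta>: "\<alpha> \<otimes>\<^bsub>G\<^esub> \<beta> \<in> carrier G" by simp
  show "S\<xi> (\<alpha> \<otimes>\<^bsub>G\<^esub> \<beta>) = S\<xi> \<alpha> \<star> act \<alpha> (S\<xi> \<beta>)"
  proof (rule mor_eqI)
    fix k i assume "k < length (tgt (S\<xi> \<alpha> \<star> act \<alpha> (S\<xi> \<beta>)))" "i < length (src (S\<xi> \<alpha> \<star> act \<alpha> (S\<xi> \<beta>)))"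
    then have ki: "k < length \<sigma>" "i < length \<sigma>" using G by (simp_all add: S\<xi>_simps)
    have \<beta>i: "\<beta> \<otimes>\<^bsub>G\<^esub> \<sigma> ! i \<in> carrier G" using G ki by simp
    then obtain j where j: "j < length \<sigma>" "inv\<^bsub>G\<^esub> (\<sigma> ! j) \<otimes>\<^bsub>G\<^esub> (\<beta> \<otimes>\<^bsub>G\<^esub> \<sigma> ! i) \<in> H"
      using coset_ex1 by blast
    let ?h = "inv\<^bsub>G\<^esub> (\<sigma> ! j) \<otimes>\<^bsub>G\<^esub> (\<beta> \<otimes>\<^bsub>G\<^esub> \<sigma> ! i)" and ?h' = "inv\<^bsub>G\<^esub> (\<sigma> ! k) \<otimes>\<^bsub>G\<^esub> (\<alpha> \<otimes>\<^bsub>G\<^esub> \<sigma> ! j)"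
    have prod: "inv\<^bsub>G\<^esub> (\<sigma> ! k) \<otimes>\<^bsub>G\<^esub> (\<alpha> \<otimes>\<^bsub>G\<^esub> \<beta> \<otimes>\<^bsub>G\<^esub> \<sigma> ! i) = ?h' \<otimes>\<^bsub>G\<^esub> ?h"
      using G ki j(1) by (simp add: G.m_assoc)
    have mem: "?h' \<otimes>\<^bsub>G\<^esub> ?h \<in> H \<longleftrightarrow> ?h' \<in> H"
      using stab_mult_iff[OF x _ j(2), of ?h'] G ki j(1) by simp
    have iso: "cp_iso c (\<phi> \<alpha> (\<phi> \<beta> (\<phi> (\<sigma> ! i) x))) (\<phi> \<alpha> (\<phi> (\<sigma> ! j) x))"
      using iso_translate[OF x, of "\<sigma> ! j" "\<beta> \<otimes>\<^bsub>G\<^esub> \<sigma> ! i"] j G ki x by (simp add: \<phi>_mult \<phi>_iso)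
    have "ent (S\<xi> \<alpha> \<star> act \<alpha> (S\<xi> \<beta>)) k i =
        u [^] c (\<phi> \<alpha> (\<phi> \<beta> (\<phi> (\<sigma> ! i) x))) (\<phi> \<alpha> (\<phi> (\<sigma> ! j) x)) (\<phi> (\<sigma> ! k) x) \<otimes>
          (ent (S\<xi> \<alpha>) k j \<otimes> ent (S\<xi> \<beta>) j i)"
    proof (subst ent_comp_single[where j = j])
      fix j' assume "j' < length (tgt (act \<alpha> (S\<xi> \<beta>)))" "j' \<noteq> j"
      then have "j' < length \<sigma>" "inv\<^bsub>G\<^esub> (\<sigma> ! j') \<otimes>\<^bsub>G\<^esub> (\<beta> \<otimes>\<^bsub>G\<^esub> \<sigma> ! i) \<notin> H"
        using coset_unique[OF j(1) _ \<beta>i j(2), of j'] G by (auto simp: S\<xi>_simps)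
      then show "ent (S\<xi> \<alpha>) k j' = \<zero> \<or> ent (act \<alpha> (S\<xi> \<beta>)) j' i = \<zero>"
        using G ki by (simp add: S\<xi>_simps)
    qed (use G ki j in \<open>simp_all add: S\<xi>_simps\<close>)
    also have "\<dots> = ent (S\<xi> \<alpha>) k j \<otimes> ent (S\<xi> \<beta>) j i"
      using G ki j x iso by (simp add: cocycle_iso12 S\<xi>_simps)
    also have "\<dots> = ent (S\<xi> (\<alpha> \<otimes>\<^bsub>G\<^esub> \<beta>)) k i"
      using G \<alpha>\<beta> ki j prod mem by (simp add: S\<xi>_simps \<theta>_mult)
    finally show "ent (S\<xi> (\<alpha> \<otimes>\<^bsub>G\<^esub> \<beta>)) k i = ent (S\<xi> \<alpha> \<star> act \<alpha> (S\<xi> \<beta>)) k i" ..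
  qed (use G \<alpha>\<beta> map_\<phi>_mult[OF G] in \<open>simp_all add: S\<xi>_simps del: map_map\<close>)
qed (auto simp: S\<xi>_simps)

lemma S_in_FG: "(SA, S\<xi>) \<in> cat_obj \<FF>G"
  using S_eqobj by (simp add: eqobj_iff) (simp add: S\<xi>_def)

text \<open>Translation by \<open>\<sigma>\<^sub>s \<sigma>\<^sub>0\<^sup>-\<^sup>1\<close> carries the first diagonal entry of an equivariant
  endomorphism to the one at \<open>s\<close>.\<close>

lemma endo_diagonal:
  assumes f: "f \<in> Ar" "src f = SA" "tgt f = SA" "eqv S\<xi> S\<xi> f" and s: "s < length \<sigma>"
  shows "ent f s s = ent f 0 0"
proof -
  let ?\<gamma> = "\<sigma> ! s \<otimes>\<^bsub>G\<^esub> inv\<^bsub>G\<^esub> (\<sigma> ! 0)"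
  note n = \<sigma>_nonempty
  have G: "?\<gamma> \<in> carrier G" using s n by simp
  have g0: "?\<gamma> \<otimes>\<^bsub>G\<^esub> \<sigma> ! 0 = \<sigma> ! s" using s n by (simp add: G.m_assoc)
  have gj: "inv\<^bsub>G\<^esub> (\<sigma> ! s) \<otimes>\<^bsub>G\<^esub> (?\<gamma> \<otimes>\<^bsub>G\<^esub> \<sigma> ! j) = inv\<^bsub>G\<^esub> (\<sigma> ! 0) \<otimes>\<^bsub>G\<^esub> \<sigma> ! j" if "j < length \<sigma>" for j
    using s n that by (simp add: G.m_assoc G.inv_solve_left')
  have \<phi>0: "\<phi> ?\<gamma> (\<phi> (\<sigma> ! 0) x) = \<phi> (\<sigma> ! s) x" using G n x g0 by (simp flip: \<phi>_mult)
  have "ent (f \<star> S\<xi> ?\<gamma>) s 0 = ent f s s"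
    using f s n G g0 x \<phi>0
    by (subst ent_comp_single[where j = s]) (auto simp: S\<xi>_simps coset_same)
  moreover have "ent (S\<xi> ?\<gamma> \<star> act ?\<gamma> f) s 0 = ent f 0 0"
    using f s n G x gj \<phi>0
    by (subst ent_comp_single[where j = 0]) (auto simp: S\<xi>_simps coset_same)
  ultimately show ?thesis using eqvD[OF f(4) G] by simp
qed

text \<open>An endomorphism whose first diagonal entry is a nonunit is radical, because all its diagonal
  entries are equal and its other components connect non-isomorphic elements.\<close>

lemma endo_unit_iff:
  assumes "f \<in> carrier (end_ring \<FF>G (SA, S\<xi>))"
  shows "f \<in> Units (end_ring \<FF>G (SA, S\<xi>)) \<longleftrightarrow> ent f 0 0 \<in> Units R"
proof
  have f: "f \<in> Ar" "src f = SA" "tgt f = SA" "eqv S\<xi> S\<xi> f" using assms by (simp_all add: FG_hom_iff)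
  show "ent f 0 0 \<in> Units R" if "f \<in> Units (end_ring \<FF>G (SA, S\<xi>))"
  proof (rule ccontr)
    obtain g where g: "g \<in> Ar" "src g = SA" "tgt g = SA" "g \<star> f = ide SA"
      using \<open>f \<in> Units _\<close> by (auto simp: Units_def FG_hom_iff)
    assume "ent f 0 0 \<notin> Units R"
    then have "rad f"
      unfolding rad_def using f endo_diagonal[OF f] by (auto simp: SA_iso simp del: SA_simps(2))
    then have "rad (ide SA)" using rad_comp_right[of f g] f g by simp
    then show False using not_rad_ide[of SA] \<sigma>_nonempty SA_simps(1,3) by fastforce
  qed
  show "f \<in> Units (end_ring \<FF>G (SA, S\<xi>))" if "ent f 0 0 \<in> Units R"
  proof -
    have "\<exists>g. inverse_of f g"
      by (rule unit_diagonal_invertible)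
        (use f endo_diagonal[OF f] that in \<open>auto simp: SA_iso simp del: SA_simps(2)\<close>)
    then obtain g where g: "inverse_of f g" by blast
    then have "eqv S\<xi> S\<xi> g" using eqv_inverse[OF S_eqobj S_eqobj f(2-4)] by blast
    then show ?thesis
      using f g unfolding Units_def by (auto simp: FG_hom_iff inverse_of_def intro!: bexI[of _ g])
  qed
qed

text \<open>Invertibility is detected by the first diagonal entry, which is additive, so that locality is
  inherited from \<open>R\<close>.\<close>

lemma S_strongly_indecomposable: "strongly_indecomposable \<FF>G (SA, S\<xi>)"
  unfolding strongly_indecomposable_def local_ring_def
proof (intro conjI ballI)
  let ?E = "end_ring \<FF>G (SA, S\<xi>)"
  show "(SA, S\<xi>) \<in> cat_obj \<FF>G" by (rule S_in_FG)
  show ring: "ring ?E" by (rule end_ring_ring[OF preadditive_FG S_in_FG])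
  have "ent (ide SA) 0 0 \<noteq> ent (null SA SA) 0 0" using \<sigma>_nonempty by simp
  then show "\<one>\<^bsub>?E\<^esub> \<noteq> \<zero>\<^bsub>?E\<^esub>" by auto
  fix f g assume "f \<in> carrier ?E - Units ?E" "g \<in> carrier ?E - Units ?E"
  then have f: "f \<in> carrier ?E" "f \<notin> Units ?E" and g: "g \<in> carrier ?E" "g \<notin> Units ?E" by auto
  interpret E: ring ?E by (rule ring)
  have fg: "f \<in> Ar" "src f = SA" "tgt f = SA" "g \<in> Ar" "src g = SA" "tgt g = SA"
    using f g by (simp_all add: FG_hom_iff)
  have "ent f 0 0 \<oplus> ent g 0 0 \<notin> Units R"
    using f g fg \<sigma>_nonempty by (intro nonunit_add) (auto simp: endo_unit_iff)
  then have "ent (f \<oplus>\<^bsub>?E\<^esub> g) 0 0 \<notin> Units R" using fg \<sigma>_nonempty by simp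
  then show "f \<oplus>\<^bsub>?E\<^esub> g \<notin> Units ?E"
    using endo_unit_iff[OF E.a_closed[OF f(1) g(1)]] by simp
qed

end

section \<open>Splitting off an induced object\<close>

context cyclic_action
begin

subsection \<open>Averaging\<close>

lemma act_msum:
  assumes "\<delta> \<in> carrier G" "A \<in> lists \<X>" "B \<in> lists \<X>" "finite I"
    and "\<And>i. i \<in> I \<Longrightarrow> F i \<in> Ar \<and> src (F i) = A \<and> tgt (F i) = B"
  shows "act \<delta> (msum A B F I) = msum (map (\<phi> \<delta>) A) (map (\<phi> \<delta>) B) (\<lambda>i. act \<delta> (F i)) I"
  by (rule finsum_additive[where h = "act \<delta>"])
    (use assms module.axioms(2)[OF Hom_module] in \<open>auto simp: hom_iff act_plus\<close>)

lemma msum_ide: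
  assumes "A \<in> lists \<X>" "finite I"
  shows "msum A A (\<lambda>i. ide A) I = scal ([card I] \<cdot> \<one>) (ide A)"
proof -
  have const: "(\<Oplus>i\<in>I. \<one>) = [card I] \<cdot> \<one>" by (rule add.finprod_const) simp
  interpret module R "Hom A A" using assms Hom_module by blast
  have "msum A A (\<lambda>i. ide A) I = msum A A (\<lambda>i. scal \<one> (ide A)) I"
    using assms smult_one[of "ide A"] by (intro M.finsum_cong') (auto simp: hom_iff)
  also have "\<dots> = scal (\<Oplus>i\<in>I. \<one>) (ide A)"
    using assms finsum_smult_rdistr[of I "\<lambda>_. \<one>" "ide A"] by (simp add: hom_iff)
  finally show ?thesis unfolding const .
qed

text \<open>Maschke's argument: conjugating a retraction of an equivariant morphism by the group elements
  gives further retractions, and their mean is equivariant.\<close>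

lemma equivariant_retraction:
  assumes A: "eqobj A \<xi>" and B: "eqobj B \<eta>"
    and \<iota>: "\<iota> \<in> Ar" "src \<iota> = B" "tgt \<iota> = A" "eqv \<eta> \<xi> \<iota>"
    and r: "r \<in> Ar" "src r = A" "tgt r = B" "r \<star> \<iota> = ide B"
  shows "\<exists>\<pi>. \<pi> \<in> Ar \<and> src \<pi> = A \<and> tgt \<pi> = B \<and> eqv \<xi> \<eta> \<pi> \<and> \<pi> \<star> \<iota> = ide B"
proof -
  note DA = eqobjD[OF A] and DB = eqobjD[OF B]
  define m where "m \<gamma> = \<eta> \<gamma> \<star> act \<gamma> (r \<star> \<xi> (inv\<^bsub>G\<^esub> \<gamma>))" for \<gamma>
  have untwist: "map (\<phi> \<gamma>) (map (\<phi> (inv\<^bsub>G\<^esub> \<gamma>)) L) = L" if "\<gamma> \<in> carrier G" "L \<in> lists \<X>" for \<gamma> L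
    using map_\<phi>_mult[of \<gamma> "inv\<^bsub>G\<^esub> \<gamma>" L] that by (simp del: map_map)
  have act_back: "act \<gamma> (act (inv\<^bsub>G\<^esub> \<gamma>) f) = f" if "\<gamma> \<in> carrier G" "f \<in> Ar" for \<gamma> f
    using act_mult[of \<gamma> "inv\<^bsub>G\<^esub> \<gamma>" f] that by simp
  have m: "m \<gamma> \<in> Ar \<and> src (m \<gamma>) = A \<and> tgt (m \<gamma>) = B" if "\<gamma> \<in> carrier G" for \<gamma>
    using that DA DB r untwist by (simp add: m_def del: map_map)
  have m\<iota>: "m \<gamma> \<star> \<iota> = ide B" if G: "\<gamma> \<in> carrier G" for \<gamma>
  proof -
    have i: "inv\<^bsub>G\<^esub> \<gamma> \<in> carrier G" using G by simp
    have s: "r \<star> \<xi> (inv\<^bsub>G\<^esub> \<gamma>) \<in> Ar" "src (r \<star> \<xi> (inv\<^bsub>G\<^esub> \<gamma>)) = map (\<phi> (inv\<^bsub>G\<^esub> \<gamma>)) A"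
      "act (inv\<^bsub>G\<^esub> \<gamma>) \<iota> \<in> Ar" "tgt (act (inv\<^bsub>G\<^esub> \<gamma>) \<iota>) = map (\<phi> (inv\<^bsub>G\<^esub> \<gamma>)) A"
      using i DA r \<iota> by simp_all
    have "(r \<star> \<xi> (inv\<^bsub>G\<^esub> \<gamma>)) \<star> act (inv\<^bsub>G\<^esub> \<gamma>) \<iota> = r \<star> \<iota> \<star> \<eta> (inv\<^bsub>G\<^esub> \<gamma>)"
      using eqvD[OF \<iota>(4) i] i DA r \<iota> by simp
    also have "\<dots> = \<eta> (inv\<^bsub>G\<^esub> \<gamma>)"
      using comp_cancel[OF r(4) \<iota>(1) r(1), of "\<eta> (inv\<^bsub>G\<^esub> \<gamma>)"] i DB r \<iota> by simp
    finally have e: "(r \<star> \<xi> (inv\<^bsub>G\<^esub> \<gamma>)) \<star> act (inv\<^bsub>G\<^esub> \<gamma>) \<iota> = \<eta> (inv\<^bsub>G\<^esub> \<gamma>)" .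
    have "act \<gamma> (r \<star> \<xi> (inv\<^bsub>G\<^esub> \<gamma>)) \<star> \<iota> = act \<gamma> (r \<star> \<xi> (inv\<^bsub>G\<^esub> \<gamma>)) \<star> act \<gamma> (act (inv\<^bsub>G\<^esub> \<gamma>) \<iota>)"
      using act_back[OF G \<iota>(1)] by simp
    also have "\<dots> = act \<gamma> (\<eta> (inv\<^bsub>G\<^esub> \<gamma>))"
      using act_comp[OF G s(3) s(1)] s e by simp
    finally have "act \<gamma> (r \<star> \<xi> (inv\<^bsub>G\<^esub> \<gamma>)) \<star> \<iota> = act \<gamma> (\<eta> (inv\<^bsub>G\<^esub> \<gamma>))" .
    moreover have "m \<gamma> \<star> \<iota> = \<eta> \<gamma> \<star> act \<gamma> (r \<star> \<xi> (inv\<^bsub>G\<^esub> \<gamma>)) \<star> \<iota>"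
      unfolding m_def using G DA DB r \<iota> s untwist by (intro comp_assoc) (simp_all del: map_map)
    ultimately show ?thesis using DB(5) DB(6)[OF G i] G by simp
  qed
  have shift: "m (\<delta> \<otimes>\<^bsub>G\<^esub> \<gamma>) \<star> \<xi> \<delta> = \<eta> \<delta> \<star> act \<delta> (m \<gamma>)" if G: "\<delta> \<in> carrier G" "\<gamma> \<in> carrier G" for \<delta> \<gamma>
  proof -
    have i: "inv\<^bsub>G\<^esub> \<gamma> \<in> carrier G" "inv\<^bsub>G\<^esub> \<delta> \<in> carrier G" and dg: "\<delta> \<otimes>\<^bsub>G\<^esub> \<gamma> \<in> carrier G" using G by simp_all
    let ?z = "r \<star> \<xi> (inv\<^bsub>G\<^esub> \<gamma>)"
    have z: "?z \<in> Ar" "src ?z = map (\<phi> (inv\<^bsub>G\<^esub> \<gamma>)) A" "tgt ?z = B" using i DA r by simp_all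
    have z': "act (inv\<^bsub>G\<^esub> \<gamma>) (\<xi> (inv\<^bsub>G\<^esub> \<delta>)) \<in> Ar"
        "tgt (act (inv\<^bsub>G\<^esub> \<gamma>) (\<xi> (inv\<^bsub>G\<^esub> \<delta>))) = map (\<phi> (inv\<^bsub>G\<^esub> \<gamma>)) A"
      using i DA by simp_all
    have "r \<star> \<xi> (inv\<^bsub>G\<^esub> (\<delta> \<otimes>\<^bsub>G\<^esub> \<gamma>)) = ?z \<star> act (inv\<^bsub>G\<^esub> \<gamma>) (\<xi> (inv\<^bsub>G\<^esub> \<delta>))"
      using G i DA r by (simp add: G.inv_mult_group)
    then have "act (\<delta> \<otimes>\<^bsub>G\<^esub> \<gamma>) (r \<star> \<xi> (inv\<^bsub>G\<^esub> (\<delta> \<otimes>\<^bsub>G\<^esub> \<gamma>))) =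
        act (\<delta> \<otimes>\<^bsub>G\<^esub> \<gamma>) ?z \<star> act (\<delta> \<otimes>\<^bsub>G\<^esub> \<gamma>) (act (inv\<^bsub>G\<^esub> \<gamma>) (\<xi> (inv\<^bsub>G\<^esub> \<delta>)))"
      using act_comp[OF dg z'(1) z(1)] z z' by simp
    also have "act (\<delta> \<otimes>\<^bsub>G\<^esub> \<gamma>) (act (inv\<^bsub>G\<^esub> \<gamma>) (\<xi> (inv\<^bsub>G\<^esub> \<delta>))) = act \<delta> (\<xi> (inv\<^bsub>G\<^esub> \<delta>))"
      using G i DA(2)[OF i(2)] act_back by (simp add: act_mult)
    also have "act (\<delta> \<otimes>\<^bsub>G\<^esub> \<gamma>) ?z = act \<delta> (act \<gamma> ?z)"
      using G z by (simp add: act_mult)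
    finally have "m (\<delta> \<otimes>\<^bsub>G\<^esub> \<gamma>) = (\<eta> \<delta> \<star> act \<delta> (\<eta> \<gamma>)) \<star> act \<delta> (act \<gamma> ?z) \<star> act \<delta> (\<xi> (inv\<^bsub>G\<^esub> \<delta>))"
      using G DB(6) by (simp add: m_def)
    moreover have zz: "act \<gamma> ?z \<in> Ar" "src (act \<gamma> ?z) = A" "tgt (act \<gamma> ?z) = map (\<phi> \<gamma>) B"
      using G z untwist DA(1) by (simp_all del: map_map)
    moreover have inv: "inverse_of (\<xi> \<delta>) (act \<delta> (\<xi> (inv\<^bsub>G\<^esub> \<delta>)))" using eqobj_inverse[OF A G(1)] .
    ultimately have "m (\<delta> \<otimes>\<^bsub>G\<^esub> \<gamma>) \<star> \<xi> \<delta> = \<eta> \<delta> \<star> act \<delta> (\<eta> \<gamma>) \<star> act \<delta> (act \<gamma> ?z)"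
      using G DB DA(3,4)[OF G(1)] by (simp add: inverse_of_def)
    also have "act \<delta> (\<eta> \<gamma>) \<star> act \<delta> (act \<gamma> ?z) = act \<delta> (m \<gamma>)"
      unfolding m_def using G zz DB by (intro act_comp[symmetric]) simp_all
    finally show ?thesis .
  qed
  have AB: "A \<in> lists \<X>" "B \<in> lists \<X>" using DA(1) DB(1) .
  let ?s = "msum A B m (carrier G)"
  let ?n = "[order G] \<cdot> \<one>"
  have s: "?s \<in> Ar" "src ?s = A" "tgt ?s = B" using msum_closed[OF AB, of "carrier G" m] m by auto
  have "?s \<star> \<xi> \<delta> = \<eta> \<delta> \<star> act \<delta> ?s" if G: "\<delta> \<in> carrier G" for \<delta>
  proof -
    note \<xi>\<delta> = DA(2-4)[OF G] and \<eta>\<delta> = DB(2-4)[OF G]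
    have d: "map (\<phi> \<delta>) A \<in> lists \<X>" "map (\<phi> \<delta>) B \<in> lists \<X>" using AB G by simp_all
    interpret module R "Hom (map (\<phi> \<delta>) A) B" using AB d Hom_module by blast
    have img: "(\<lambda>\<gamma>. \<delta> \<otimes>\<^bsub>G\<^esub> \<gamma>) ` carrier G = carrier G"
      using G.surj_const_mult[OF G] by simp
    have "?s \<star> \<xi> \<delta> = msum (map (\<phi> \<delta>) A) B (\<lambda>\<gamma>. m \<gamma> \<star> \<xi> \<delta>) (carrier G)"
      using msum_comp(2)[OF AB G_finite m \<xi>\<delta>(1) \<xi>\<delta>(3)] \<xi>\<delta>(2) by simp
    also have "\<dots> = msum (map (\<phi> \<delta>) A) B (\<lambda>\<gamma>. m \<gamma> \<star> \<xi> \<delta>) ((\<lambda>\<gamma>. \<delta> \<otimes>\<^bsub>G\<^esub> \<gamma>) ` carrier G)"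
      by (simp add: img)
    also have "\<dots> = msum (map (\<phi> \<delta>) A) B (\<lambda>\<gamma>. m (\<delta> \<otimes>\<^bsub>G\<^esub> \<gamma>) \<star> \<xi> \<delta>) (carrier G)"
      using m \<xi>\<delta> d AB G by (intro M.finsum_reindex) (auto simp: hom_iff inj_on_def)
    also have "\<dots> = msum (map (\<phi> \<delta>) A) B (\<lambda>\<gamma>. \<eta> \<delta> \<star> act \<delta> (m \<gamma>)) (carrier G)"
      using shift[OF G] m \<eta>\<delta> d AB G by (intro M.finsum_cong') (auto simp: hom_iff)
    also have "\<dots> = \<eta> \<delta> \<star> msum (map (\<phi> \<delta>) A) (map (\<phi> \<delta>) B) (\<lambda>\<gamma>. act \<delta> (m \<gamma>)) (carrier G)"
      using msum_comp(1)[OF d G_finite, of "\<lambda>\<gamma>. act \<delta> (m \<gamma>)" "\<eta> \<delta>"] m \<eta>\<delta> G by simp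
    also have "\<dots> = \<eta> \<delta> \<star> act \<delta> ?s"
      using act_msum[OF G AB G_finite m] by simp
    finally show ?thesis .
  qed
  then have "eqv \<xi> \<eta> ?s" by (simp add: eqv_def)
  moreover have "?s \<star> \<iota> = scal ?n (ide B)"
  proof -
    interpret module R "Hom B B" using AB Hom_module by blast
    have "?s \<star> \<iota> = msum B B (\<lambda>\<gamma>. m \<gamma> \<star> \<iota>) (carrier G)"
      using msum_comp(2)[OF AB G_finite m \<iota>(1,3)] \<iota>(2) by simp
    also have "\<dots> = msum B B (\<lambda>\<gamma>. ide B) (carrier G)"
      using m\<iota> AB by (intro M.finsum_cong') (auto simp: hom_iff)
    finally show ?thesis using msum_ide[OF AB(2) G_finite] by (simp add: order_def)
  qed
  moreover have "scal (inv ?n) (scal ?n (ide B)) = ide B"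
    using order_unit AB by (intro mor_eqI) (auto simp: Units_closed)
  ultimately show ?thesis
    using s \<iota> order_unit A B
    by (intro exI[of _ "scal (inv ?n) ?s"]) (auto simp: comp_scal_left intro: eqv_scal)
qed

subsection \<open>Complements\<close>

text \<open>The structure \<open>\<xi>\<close> is transported to the retract \<open>A'\<close> as \<open>p \<circ> \<xi>\<^sub>\<gamma> \<circ> \<gamma> \<kappa>\<close>. The cocycle condition holds
  because the idempotent \<open>\<kappa> p\<close>, which appears in the middle of a product of two such morphisms, is
  equivariant and can be moved to the outside.\<close>

lemma equivariant_complement:
  assumes A: "eqobj A \<xi>" and A': "A' \<in> lists \<X>"
    and \<kappa>: "\<kappa> \<in> Ar" "src \<kappa> = A'" "tgt \<kappa> = A" and p: "p \<in> Ar" "src p = A" "tgt p = A'"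
    and p\<kappa>: "p \<star> \<kappa> = ide A'" and eqv: "eqv \<xi> \<xi> (\<kappa> \<star> p)"
  shows "\<exists>\<xi>'. (A', \<xi>') \<in> cat_obj \<FF>G \<and> eqv \<xi>' \<xi> \<kappa> \<and> eqv \<xi> \<xi>' p"
proof -
  note D = eqobjD[OF A]
  define \<xi>' where "\<xi>' = (\<lambda>\<gamma>\<in>carrier G. p \<star> \<xi> \<gamma> \<star> act \<gamma> \<kappa>)"
  have \<xi>': "\<xi>' \<gamma> = p \<star> \<xi> \<gamma> \<star> act \<gamma> \<kappa>" if "\<gamma> \<in> carrier G" for \<gamma> using that by (simp add: \<xi>'_def)
  have pkp: "p \<star> \<kappa> \<star> z = z" if "z \<in> Ar" "tgt z = A'" for z
    using comp_cancel[OF p\<kappa> \<kappa>(1) p(1), of z] that p \<kappa> by simp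
  have kpk: "\<kappa> \<star> p \<star> \<kappa> = \<kappa>" using p\<kappa> \<kappa> by simp
  have move: "\<kappa> \<star> p \<star> \<xi> \<gamma> \<star> z = \<xi> \<gamma> \<star> act \<gamma> \<kappa> \<star> act \<gamma> p \<star> z"
    if "\<gamma> \<in> carrier G" "z \<in> Ar" "tgt z = map (\<phi> \<gamma>) A" for \<gamma> z
  proof -
    have "(\<kappa> \<star> p) \<star> \<xi> \<gamma> = \<xi> \<gamma> \<star> act \<gamma> \<kappa> \<star> act \<gamma> p"
      using eqvD[OF eqv that(1)] act_comp[OF that(1) p(1) \<kappa>(1)] p \<kappa> by simp
    then have "((\<kappa> \<star> p) \<star> \<xi> \<gamma>) \<star> z = (\<xi> \<gamma> \<star> act \<gamma> \<kappa> \<star> act \<gamma> p) \<star> z" by simp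
    then show ?thesis using that D p \<kappa> by simp
  qed
  have k: "\<kappa> \<star> \<xi>' \<gamma> = \<xi> \<gamma> \<star> act \<gamma> \<kappa>" if G: "\<gamma> \<in> carrier G" for \<gamma>
  proof -
    have "act \<gamma> \<kappa> \<star> act \<gamma> p \<star> act \<gamma> \<kappa> = act \<gamma> \<kappa>"
      using act_comp[OF G \<kappa>(1) p(1), symmetric] p\<kappa> p \<kappa> G by simp
    then show ?thesis using move[OF G, of "act \<gamma> \<kappa>"] \<xi>'[OF G] G \<kappa> by simp
  qed
  have pe: "p \<star> \<xi> \<gamma> = \<xi>' \<gamma> \<star> act \<gamma> p" if G: "\<gamma> \<in> carrier G" for \<gamma>
  proof -
    have "\<xi>' \<gamma> \<star> act \<gamma> p = p \<star> \<kappa> \<star> p \<star> \<xi> \<gamma> \<star> ide (map (\<phi> \<gamma>) A)"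
      using move[OF G, of "ide (map (\<phi> \<gamma>) A)"] \<xi>'[OF G] G D p \<kappa> by simp
    also have "\<dots> = p \<star> \<xi> \<gamma>"
      using pkp[of "p \<star> \<xi> \<gamma>"] G D p by simp
    finally show ?thesis ..
  qed
  have ob: "\<xi>' \<gamma> \<in> Ar \<and> src (\<xi>' \<gamma>) = map (\<phi> \<gamma>) A' \<and> tgt (\<xi>' \<gamma>) = A'" if "\<gamma> \<in> carrier G" for \<gamma>
    using that \<xi>' D p \<kappa> by simp
  have "eqobj A' \<xi>'"
    unfolding eqobj_def
  proof (intro conjI ballI)
    show "\<xi>' \<one>\<^bsub>G\<^esub> = ide A'" using \<xi>' D p \<kappa> p\<kappa> by simp
  next
    fix \<alpha> \<beta> assume G: "\<alpha> \<in> carrier G" "\<beta> \<in> carrier G"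
    then have ab: "\<alpha> \<otimes>\<^bsub>G\<^esub> \<beta> \<in> carrier G" by simp
    have "\<xi>' \<alpha> \<star> act \<alpha> (\<xi>' \<beta>) = p \<star> \<xi> \<alpha> \<star> act \<alpha> \<kappa> \<star> act \<alpha> (\<xi>' \<beta>)"
      using G \<xi>' D p \<kappa> ob by simp
    also have "act \<alpha> \<kappa> \<star> act \<alpha> (\<xi>' \<beta>) = act \<alpha> (\<xi> \<beta> \<star> act \<beta> \<kappa>)"
      using act_comp[OF G(1), of "\<xi>' \<beta>" \<kappa>] ob[OF G(2)] \<kappa> k[OF G(2)] by simp
    also have "\<dots> = act \<alpha> (\<xi> \<beta>) \<star> act (\<alpha> \<otimes>\<^bsub>G\<^esub> \<beta>) \<kappa>"
      using act_comp[OF G(1), of "act \<beta> \<kappa>" "\<xi> \<beta>"] G D \<kappa> by (simp add: act_mult)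
    also have "p \<star> \<xi> \<alpha> \<star> act \<alpha> (\<xi> \<beta>) \<star> act (\<alpha> \<otimes>\<^bsub>G\<^esub> \<beta>) \<kappa> = \<xi>' (\<alpha> \<otimes>\<^bsub>G\<^esub> \<beta>)"
      using G ab D \<kappa> \<xi>' map_\<phi>_mult[OF G D(1)] by simp
    finally show "\<xi>' (\<alpha> \<otimes>\<^bsub>G\<^esub> \<beta>) = \<xi>' \<alpha> \<star> act \<alpha> (\<xi>' \<beta>)" ..
  qed (use A' ob in auto)
  moreover have "\<xi>' \<in> extensional (carrier G)" by (simp add: \<xi>'_def)
  ultimately show ?thesis
    using k pe by (auto simp: eqobj_iff eqv_def)
qed

subsection \<open>Eigenmorphisms\<close>

text \<open>The basic morphisms of \<open>\<P>(\<X>)\<close>.\<close>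

definition bas :: "'x \<Rightarrow> 'x \<Rightarrow> ('x, 'r) mor" where
  "bas x y = mk [x] [y] (\<lambda>_ _. \<one>)"

lemma bas_simps [simp]: "src (bas x y) = [x]" "tgt (bas x y) = [y]" "ent (bas x y) 0 0 = \<one>"
  "act \<gamma> (bas x y) = bas (\<phi> \<gamma> x) (\<phi> \<gamma> y)"
  by (auto simp: bas_def act_mor_def mk_def)

lemma bas_Ar [simp]: "x \<in> \<X> \<Longrightarrow> y \<in> \<X> \<Longrightarrow> bas x y \<in> Ar"
  unfolding bas_def by (rule Ar_mk) auto

lemma bas_comp:
  assumes "x \<in> \<X>" "y \<in> \<X>" "z \<in> \<X>" "cp_iso c x y"
  shows "bas y z \<star> bas x y = bas x z"
proof (rule mor_eqI)
  fix k i assume "k < length (tgt (bas x z))" "i < length (src (bas x z))"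
  then have "k = 0" "i = 0" by simp_all
  moreover have "ent (bas y z \<star> bas x y) 0 0 = \<one>"
    using assms by (subst ent_comp_single[where j = 0]) (auto simp: cocycle_iso12)
  ultimately show "ent (bas y z \<star> bas x y) k i = ent (bas x z) k i" by simp
qed (use assms in auto)

lemma bas_ide: "x \<in> \<X> \<Longrightarrow> bas x x = ide [x]"
  by (rule mor_eqI) auto

text \<open>For \<open>h\<close> in the stabilizer of \<open>x\<close>, translation by \<open>h\<close> yields a morphism \<open>h x \<rightarrow> h A\<close>; the structure
  \<open>\<xi>\<close> and the basic isomorphism \<open>x \<rightarrow> h x\<close> bring it back to a morphism \<open>x \<rightarrow> A\<close>.\<close>

definition stab_act :: "('g \<Rightarrow> ('x, 'r) mor) \<Rightarrow> 'x \<Rightarrow> 'g \<Rightarrow> ('x, 'r) mor \<Rightarrow> ('x, 'r) mor" where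
  "stab_act \<xi> x h a = \<xi> h \<star> act h a \<star> bas x (\<phi> h x)"

context
  fixes A \<xi> x
  assumes A: "eqobj A \<xi>" and x: "x \<in> \<X>"
begin

lemma stab_act_simps:
  assumes "h \<in> stab x" "a \<in> Ar" "src a = [x]" "tgt a = A"
  shows "stab_act \<xi> x h a \<in> Ar" "src (stab_act \<xi> x h a) = [x]" "tgt (stab_act \<xi> x h a) = A"
  using assms eqobjD[OF A] x by (auto simp: stab_act_def stab_iff)

lemma stab_act_mult:
  assumes "h \<in> stab x" "k \<in> stab x" "a \<in> Ar" "src a = [x]" "tgt a = A"
  shows "stab_act \<xi> x h (stab_act \<xi> x k a) = stab_act \<xi> x (h \<otimes>\<^bsub>G\<^esub> k) a"
proof -
  have G: "h \<in> carrier G" "k \<in> carrier G" "h \<otimes>\<^bsub>G\<^esub> k \<in> carrier G" using assms by (auto simp: stab_iff)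
  have X: "\<phi> h x \<in> \<X>" "\<phi> k x \<in> \<X>" "\<phi> h (\<phi> k x) \<in> \<X>" using G x by auto
  note D = eqobjD[OF A]
  have iso: "cp_iso c x (\<phi> h x)" using assms(1) x X iso_sym by (auto simp: stab_iff)
  have b: "bas (\<phi> h x) (\<phi> h (\<phi> k x)) \<star> bas x (\<phi> h x) = bas x (\<phi> (h \<otimes>\<^bsub>G\<^esub> k) x)"
    using bas_comp[OF x X(1,3) iso] G x by (simp add: \<phi>_mult)
  have "stab_act \<xi> x h (stab_act \<xi> x k a) =
      \<xi> h \<star> act h (\<xi> k) \<star> act (h \<otimes>\<^bsub>G\<^esub> k) a \<star> bas (\<phi> h x) (\<phi> h (\<phi> k x)) \<star> bas x (\<phi> h x)"
    using G X D assms x by (simp add: stab_act_def act_comp act_mult)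
  also have "\<dots> = stab_act \<xi> x (h \<otimes>\<^bsub>G\<^esub> k) a"
    unfolding b using G X D assms x map_\<phi>_mult[OF G(1,2) D(1)] by (simp add: stab_act_def \<phi>_mult)
  finally show ?thesis .
qed

lemma stab_act_one: "a \<in> Ar \<Longrightarrow> src a = [x] \<Longrightarrow> tgt a = A \<Longrightarrow> stab_act \<xi> x \<one>\<^bsub>G\<^esub> a = a"
  using eqobjD[OF A] x by (simp add: stab_act_def bas_ide)

lemma stab_act_pow:
  assumes "h \<in> stab x" "a \<in> Ar" "src a = [x]" "tgt a = A"
  shows "(stab_act \<xi> x h ^^ k) a = stab_act \<xi> x (h [^]\<^bsub>G\<^esub> k) a \<and> h [^]\<^bsub>G\<^esub> k \<in> stab x"
proof (induction k)
  case 0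
  then show ?case using assms x by (simp add: stab_act_one)
next
  case (Suc k)
  have h: "h \<in> carrier G" using assms by (simp add: stab_iff)
  have "h [^]\<^bsub>G\<^esub> Suc k = h \<otimes>\<^bsub>G\<^esub> h [^]\<^bsub>G\<^esub> k" using G.nat_pow_Suc2[OF h] .
  then show ?case using Suc assms stab_act_mult[of h "h [^]\<^bsub>G\<^esub> k" a] stab_mult[OF x] by simp
qed

text \<open>The eigenvalue of \<open>h\<close> is multiplicative in \<open>h\<close> because an eigenvector outside the radical has
  a unit among its entries.\<close>

lemma exists_eigenmorphism:
  assumes comm: "\<And>h k. h \<in> stab x \<Longrightarrow> k \<in> stab x \<Longrightarrow> h \<otimes>\<^bsub>G\<^esub> k = k \<otimes>\<^bsub>G\<^esub> h"
    and roots: "card {\<zeta> \<in> carrier R. \<zeta> [^] order G = \<one>} = order G"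
    and a: "a \<in> Ar" "src a = [x]" "tgt a = A" "\<not> rad a"
  shows "\<exists>b. \<exists>\<theta>\<in>hom (G\<lparr>carrier := stab x\<rparr>) (units_of R).
    b \<in> Ar \<and> src b = [x] \<and> tgt b = A \<and> \<not> rad b \<and>
    (\<forall>h\<in>stab x. \<xi> h \<star> act h b = scal (\<theta> h) (b \<star> bas (\<phi> h x) x))"
proof -
  note D = eqobjD[OF A]
  have xA: "[x] \<in> lists \<X>" "A \<in> lists \<X>" using x D(1) by auto
  let ?M = "Hom [x] A" and ?T = "stab_act \<xi> x"
  interpret M: module R ?M using Hom_module[OF xA] .
  have M: "f \<in> carrier ?M \<longleftrightarrow> f \<in> Ar \<and> src f = [x] \<and> tgt f = A" for f using xA by (simp add: hom_iff)
  have hG: "h \<in> carrier G" if "h \<in> stab x" for h using that by (simp add: stab_iff)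
  interpret T: operators_of_finite_order R ?M "order G" "stab x" ?T
  proof unfold_locales
    show "0 < order G" using G.order_gt_0_iff_finite G_finite by blast
    show "[order G] \<cdot> \<one> \<in> Units R" by (rule order_unit)
    show "card {\<zeta> \<in> carrier R. \<zeta> [^] order G = \<one>} = order G" by (rule roots)
  next
    fix h f assume h: "h \<in> stab x" and f: "f \<in> carrier ?M"
    show "?T h f \<in> carrier ?M" using stab_act_simps[OF h] f unfolding M by blast
    show "(?T h ^^ order G) f = f"
      using stab_act_pow[OF h, of f "order G"] f stab_act_one[of f] G.pow_order_eq_1[OF hG[OF h]]
      unfolding M by simp
    show "?T h (r \<odot>\<^bsub>?M\<^esub> f) = r \<odot>\<^bsub>?M\<^esub> ?T h f" if r: "r \<in> carrier R" for r
      using f h hG[OF h] r D x unfolding M by (simp add: stab_act_def act_scal comp_scal_left comp_scal_right)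
    fix k g assume g: "g \<in> carrier ?M"
    show "?T h (f \<oplus>\<^bsub>?M\<^esub> g) = ?T h f \<oplus>\<^bsub>?M\<^esub> ?T h g"
      using f g h hG[OF h] D x unfolding M by (simp add: stab_act_def act_plus comp_plus_left comp_plus_right)
    show "?T h (?T k f) = ?T k (?T h f)" if k: "k \<in> stab x"
      using f stab_act_mult[OF h k, of f] stab_act_mult[OF k h, of f] comm[OF h k] unfolding M by simp
  qed
  let ?N = "{f \<in> carrier ?M. rad f}"
  have "submodule ?N R ?M"
  proof (rule M.submoduleI)
    fix f assume f: "f \<in> ?N"
    have "\<ominus>\<^bsub>?M\<^esub> f = scal (\<ominus> \<one>) f"
    proof (rule M.M.minus_equality)
      show "scal (\<ominus> \<one>) f \<oplus>\<^bsub>?M\<^esub> f = \<zero>\<^bsub>?M\<^esub>"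
        using f xA unfolding mem_Collect_eq M by (auto intro!: mor_eqI simp: l_minus l_neg)
    qed (use f xA in \<open>auto simp: M hom_iff\<close>)
    then show "\<ominus>\<^bsub>?M\<^esub> f \<in> ?N" using f rad_scal[of f "\<ominus> \<one>"] unfolding mem_Collect_eq M by simp
  qed (use xA in \<open>auto simp: hom_iff rad_plus rad_scal\<close>, simp add: rad_def)
  moreover have "a \<in> carrier ?M - ?N" using a xA by (simp add: hom_iff)
  moreover have "finite (stab x)" using G_finite stab_subset finite_subset by blast
  ultimately obtain b where b: "b \<in> carrier ?M - ?N" "\<forall>h\<in>stab x. \<exists>\<zeta>\<in>Units R. ?T h b = scal \<zeta> b"
    using T.common_eigenvector[of ?N a "stab x"] by auto
  then have bA: "b \<in> Ar" "src b = [x]" "tgt b = A" "\<not> rad b" using M[of b] by auto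
  from b(2) obtain \<theta> where \<theta>: "\<And>h. h \<in> stab x \<Longrightarrow> \<theta> h \<in> Units R \<and> ?T h b = scal (\<theta> h) b" by metis
  from bA obtain i where i: "i < length A" "ent b i 0 \<in> Units R" unfolding rad_def by auto
  have "\<theta> (h \<otimes>\<^bsub>G\<^esub> k) = \<theta> h \<otimes> \<theta> k" if hk: "h \<in> stab x" "k \<in> stab x" for h k
  proof -
    have hk': "h \<otimes>\<^bsub>G\<^esub> k \<in> stab x" using stab_mult[OF x] hk .
    have cl: "\<theta> h \<in> carrier R" "\<theta> k \<in> carrier R" "\<theta> (h \<otimes>\<^bsub>G\<^esub> k) \<in> carrier R"
      using \<theta> hk hk' Units_closed by blast+
    have "scal (\<theta> (h \<otimes>\<^bsub>G\<^esub> k)) b = ?T h (?T k b)"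
      using \<theta>[OF hk'] stab_act_mult[OF hk bA(1-3)] by simp
    also have "\<dots> = scal (\<theta> k) (?T h b)"
      using \<theta> hk cl T.T_smult[of h "\<theta> k" b] b(1) by simp
    also have "\<dots> = scal (\<theta> k) (scal (\<theta> h) b)" using \<theta> hk by simp
    finally have "ent (scal (\<theta> (h \<otimes>\<^bsub>G\<^esub> k)) b) i 0 = ent (scal (\<theta> k) (scal (\<theta> h) b)) i 0" by simp
    then have "ent b i 0 \<otimes> \<theta> (h \<otimes>\<^bsub>G\<^esub> k) = ent b i 0 \<otimes> (\<theta> h \<otimes> \<theta> k)"
      using bA i cl Units_closed[OF i(2)] by (simp add: m_ac)
    then show ?thesis using Units_l_cancel[OF i(2)] cl by simp
  qed
  then have "\<theta> \<in> hom (G\<lparr>carrier := stab x\<rparr>) (units_of R)"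
    using \<theta> by (auto simp: hom_def units_of_def)
  moreover have "\<xi> h \<star> act h b = scal (\<theta> h) (b \<star> bas (\<phi> h x) x)" if h: "h \<in> stab x" for h
  proof -
    have X: "\<phi> h x \<in> \<X>" "cp_iso c (\<phi> h x) x" using hG[OF h] h x by (auto simp: stab_iff)
    have "scal (\<theta> h) b \<star> bas (\<phi> h x) x = ?T h b \<star> bas (\<phi> h x) x" using \<theta>[OF h] by simp
    also have "\<dots> = \<xi> h \<star> act h b \<star> bas x (\<phi> h x) \<star> bas (\<phi> h x) x"
      using D hG[OF h] X x bA by (simp add: stab_act_def)
    also have "bas x (\<phi> h x) \<star> bas (\<phi> h x) x = ide [\<phi> h x]"
      using bas_comp[OF X(1) x X(1) X(2)] X by (simp add: bas_ide)
    also have "\<xi> h \<star> act h b \<star> ide [\<phi> h x] = \<xi> h \<star> act h b"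
      using D hG[OF h] bA by simp
    finally show ?thesis
      using bA X x \<theta>[OF h] by (simp add: comp_scal_left Units_closed)
  qed
  ultimately show ?thesis using bA by blast
qed

end

end

subsection \<open>Embedding an induced object\<close>

text \<open>Comparing columns, as morphisms, avoids the sums in the entries of composites.\<close>

lemma (in cyclic_hull) mor_eq_columns:
  assumes "f \<in> Ar" "g \<in> Ar" "src f = src g" "tgt f = tgt g"
    and "\<And>i. i < length (src g) \<Longrightarrow> f \<star> inc (src g) [i] = g \<star> inc (src g) [i]"
  shows "f = g"
proof (rule mor_eqI)
  fix j i assume ji: "j < length (tgt g)" "i < length (src g)"
  have "ent (f \<star> inc (src g) [i]) j 0 = ent (g \<star> inc (src g) [i]) j 0"
    using assms(5)[OF ji(2)] by simp
  then show "ent f j i = ent g j i" using ji assms(1-4) by simp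
qed (use assms in auto)

lemma (in cyclic_action) act_inc:
  "set ks \<subseteq> {..<length A} \<Longrightarrow> act \<gamma> (inc A ks) = inc (map (\<phi> \<gamma>) A) ks"
  by (auto simp: act_mor_def inc_def mk_def subset_iff)

context induced_object
begin


text \<open>A morphism \<open>b : x \<rightarrow> A\<close> on which the stabilizer acts by \<open>\<theta>\<close> extends to an equivariant
  morphism on the induced object, namely by the translate of \<open>b\<close> under \<open>\<sigma>\<^sub>s\<close> on the summand
  \<open>\<sigma>\<^sub>s x\<close>.\<close>

context
  fixes A \<xi> b
  assumes A: "eqobj A \<xi>" and b: "b \<in> Ar" "src b = [x]" "tgt b = A"
    and eigen: "\<And>h. h \<in> H \<Longrightarrow> \<xi> h \<star> act h b = scal (\<theta> h) (b \<star> bas (\<phi> h x) x)"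
begin


definition col :: "nat \<Rightarrow> ('x, 'r) mor" where
  "col s = \<xi> (\<sigma> ! s) \<star> act (\<sigma> ! s) b"

definition emb :: "('x, 'r) mor" where
  "emb = mk SA A (\<lambda>j s. ent (col s) j 0)"

lemma col_simps: "s < length \<sigma> \<Longrightarrow> col s \<in> Ar \<and> src (col s) = [\<phi> (\<sigma> ! s) x] \<and> tgt (col s) = A"
  using eqobjD[OF A] b by (simp add: col_def)

lemma emb_simps: "emb \<in> Ar" "src emb = SA" "tgt emb = A"
  "j < length A \<Longrightarrow> s < length \<sigma> \<Longrightarrow> ent emb j s = ent (col s) j 0"
  using col_simps eqobjD(1)[OF A] by (auto simp: emb_def)

lemma emb_column: "s < length \<sigma> \<Longrightarrow> emb \<star> inc SA [s] = col s"
  by (rule mor_eqI) (use emb_simps col_simps in auto)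

lemma S\<xi>_column:
  assumes "\<gamma> \<in> carrier G" "i < length \<sigma>" "j < length \<sigma>"
    and h: "inv\<^bsub>G\<^esub> (\<sigma> ! j) \<otimes>\<^bsub>G\<^esub> (\<gamma> \<otimes>\<^bsub>G\<^esub> \<sigma> ! i) \<in> H"
  shows "S\<xi> \<gamma> \<star> inc (map (\<phi> \<gamma>) SA) [i] =
    scal (\<theta> (inv\<^bsub>G\<^esub> (\<sigma> ! j) \<otimes>\<^bsub>G\<^esub> (\<gamma> \<otimes>\<^bsub>G\<^esub> \<sigma> ! i)))
      (inc SA [j] \<star> bas (\<phi> \<gamma> (\<phi> (\<sigma> ! i) x)) (\<phi> (\<sigma> ! j) x))"
    (is "?l = scal ?t (?e \<star> ?b)")
proof -
  have X: "\<phi> \<gamma> (\<phi> (\<sigma> ! i) x) \<in> \<X>" "\<phi> (\<sigma> ! j) x \<in> \<X>" using assms x by auto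
  have B: "map (\<phi> \<gamma>) SA \<in> lists \<X>" using assms by simp
  have e: "?e \<in> Ar" "src ?e = [\<phi> (\<sigma> ! j) x]" "tgt ?e = SA" and bb: "?b \<in> Ar" using assms X by auto
  have iso: "cp_iso c (\<phi> \<gamma> (\<phi> (\<sigma> ! i) x)) (\<phi> (\<sigma> ! j) x)"
    using iso_translate[OF x, of "\<sigma> ! j" "\<gamma> \<otimes>\<^bsub>G\<^esub> \<sigma> ! i"] assms x by (simp add: \<phi>_mult)
  show ?thesis
  proof (rule mor_eqI)
    fix k l assume "k < length (tgt (scal ?t (?e \<star> ?b)))" "l < length (src (scal ?t (?e \<star> ?b)))"
    then have k: "k < length \<sigma>" and l: "l = 0" by simp_all
    have "ent (?e \<star> ?b) k 0 = ent ?e k 0"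
      using k e bb X iso u_closed by (subst ent_comp_single[where j = 0]) (auto simp: cocycle_iso12)
    then have "ent (scal ?t (?e \<star> ?b)) k 0 = ?t \<otimes> (if k = j then \<one> else \<zero>)"
      using k assms(3) by simp
    moreover have "ent ?l k 0 = ent (S\<xi> \<gamma>) k i"
      using k assms B S\<xi>_simps(1-3)[OF assms(1)] by simp
    moreover have "ent (S\<xi> \<gamma>) k i = ?t \<otimes> (if k = j then \<one> else \<zero>)"
    proof (cases "k = j")
      case True
      then show ?thesis using S\<xi>_simps(4)[OF assms(1,2) k] h by simp
    next
      case False
      then have "inv\<^bsub>G\<^esub> (\<sigma> ! k) \<otimes>\<^bsub>G\<^esub> (\<gamma> \<otimes>\<^bsub>G\<^esub> \<sigma> ! i) \<notin> H"
        using coset_unique[OF k assms(3) _ _ h] assms(1,2) by auto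
      then show ?thesis using S\<xi>_simps(4)[OF assms(1,2) k] h False by simp
    qed
    ultimately show "ent ?l k l = ent (scal ?t (?e \<star> ?b)) k l"
      unfolding l by simp
  qed (use assms e bb B in \<open>auto simp: S\<xi>_simps\<close>)
qed

text \<open>If \<open>\<gamma> \<sigma>\<^sub>i = \<sigma>\<^sub>j \<eta>\<close> with \<open>\<eta> \<in> H\<close>, then the \<open>i\<close>-th columns of both sides are \<open>\<theta> \<eta>\<close> times the translate of
  \<open>b\<close> under \<open>\<sigma>\<^sub>j\<close>: on the right, \<open>\<eta>\<close> is absorbed by the eigenvector property.\<close>

lemma emb_eqv: "eqv S\<xi> \<xi> emb"
  unfolding eqv_def
proof
  fix \<gamma> assume G: "\<gamma> \<in> carrier G"
  note D = eqobjD[OF A] and S = S\<xi>_simps(1-3)[OF G]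
  show "emb \<star> S\<xi> \<gamma> = \<xi> \<gamma> \<star> act \<gamma> emb"
  proof (rule mor_eq_columns)
    fix i assume "i < length (src (\<xi> \<gamma> \<star> act \<gamma> emb))"
    then have i: "i < length \<sigma>" by (simp add: emb_simps)
    let ?B = "map (\<phi> \<gamma>) SA"
    have B: "src (\<xi> \<gamma> \<star> act \<gamma> emb) = ?B" by (simp add: emb_simps)
    have inc: "inc ?B [i] \<in> Ar" "tgt (inc ?B [i]) = ?B" "inc ?B [i] = act \<gamma> (inc SA [i])"
      "inc SA [i] \<in> Ar" "tgt (inc SA [i]) = SA"
      using G i act_inc[of "[i]" SA \<gamma>] by auto
    have gi: "\<gamma> \<otimes>\<^bsub>G\<^esub> \<sigma> ! i \<in> carrier G" using G i by simp
    obtain j where j: "j < length \<sigma>" "inv\<^bsub>G\<^esub> (\<sigma> ! j) \<otimes>\<^bsub>G\<^esub> (\<gamma> \<otimes>\<^bsub>G\<^esub> \<sigma> ! i) \<in> H"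
      using coset_ex1[OF gi] by blast
    let ?h = "inv\<^bsub>G\<^esub> (\<sigma> ! j) \<otimes>\<^bsub>G\<^esub> (\<gamma> \<otimes>\<^bsub>G\<^esub> \<sigma> ! i)"
    have h: "?h \<in> carrier G" and sh: "\<sigma> ! j \<otimes>\<^bsub>G\<^esub> ?h = \<gamma> \<otimes>\<^bsub>G\<^esub> \<sigma> ! i"
      and sj: "\<sigma> ! j \<in> carrier G" and si: "\<sigma> ! i \<in> carrier G"
      using G i j gi by simp_all
    let ?y = "\<phi> \<gamma> (\<phi> (\<sigma> ! i) x)" and ?z = "\<phi> (\<sigma> ! j) x"
    have X: "?y \<in> \<X>" "?z \<in> \<X>" "\<phi> ?h x \<in> \<X>" using G h si sj x by auto
    have y: "\<phi> (\<sigma> ! j) (\<phi> ?h x) = ?y"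
      using \<phi>_mult[OF sj h x] \<phi>_mult[OF G si x] sh by simp
    have t: "\<theta> ?h \<in> carrier R" using j(2) by simp
    have "act \<gamma> emb \<star> inc ?B [i] = act \<gamma> (col i)"
      using act_comp[OF G inc(4) emb_simps(1)] inc(3,5) emb_simps(2) emb_column[OF i] by simp
    also have "\<dots> = act \<gamma> (\<xi> (\<sigma> ! i)) \<star> act (\<gamma> \<otimes>\<^bsub>G\<^esub> \<sigma> ! i) b"
      unfolding col_def using G i D b by (simp add: act_comp act_mult)
    finally have 1: "act \<gamma> emb \<star> inc ?B [i] = act \<gamma> (\<xi> (\<sigma> ! i)) \<star> act (\<gamma> \<otimes>\<^bsub>G\<^esub> \<sigma> ! i) b" .
    have "(\<xi> \<gamma> \<star> act \<gamma> emb) \<star> inc ?B [i] = \<xi> \<gamma> \<star> act \<gamma> emb \<star> inc ?B [i]"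
      using inc(1,2) G D emb_simps(1-3) by simp
    also have "\<dots> = \<xi> (\<gamma> \<otimes>\<^bsub>G\<^esub> \<sigma> ! i) \<star> act (\<gamma> \<otimes>\<^bsub>G\<^esub> \<sigma> ! i) b"
      unfolding 1 using G i gi D b map_\<phi>_mult[OF G si D(1)] by simp
    also have "\<dots> = \<xi> (\<sigma> ! j) \<star> act (\<sigma> ! j) (\<xi> ?h) \<star> act (\<sigma> ! j) (act ?h b)"
      using D(6)[OF sj h] act_mult[OF sj h b(1)] sj h D b unfolding sh by simp
    finally have l: "(\<xi> \<gamma> \<star> act \<gamma> emb) \<star> inc ?B [i] =
        \<xi> (\<sigma> ! j) \<star> act (\<sigma> ! j) (\<xi> ?h) \<star> act (\<sigma> ! j) (act ?h b)" .
    have "act (\<sigma> ! j) (\<xi> ?h) \<star> act (\<sigma> ! j) (act ?h b) = act (\<sigma> ! j) (\<xi> ?h \<star> act ?h b)"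
      using sj h D b by (intro act_comp[symmetric]) simp_all
    also have "\<dots> = scal (\<theta> ?h) (act (\<sigma> ! j) b \<star> bas ?y ?z)"
      unfolding eigen[OF j(2)] using sj b X(3) x y by (simp add: act_scal act_comp)
    finally have 2: "act (\<sigma> ! j) (\<xi> ?h) \<star> act (\<sigma> ! j) (act ?h b) = scal (\<theta> ?h) (act (\<sigma> ! j) b \<star> bas ?y ?z)" .
    have "\<xi> (\<sigma> ! j) \<star> scal (\<theta> ?h) (act (\<sigma> ! j) b \<star> bas ?y ?z) = scal (\<theta> ?h) (col j \<star> bas ?y ?z)"
      using sj D b X t by (simp add: col_def comp_scal_right)
    also have "col j \<star> bas ?y ?z = emb \<star> inc SA [j] \<star> bas ?y ?z"
      using emb_simps(1,2) j(1) X comp_cancel[OF emb_column[OF j(1)], of "bas ?y ?z"] by simp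
    also have "scal (\<theta> ?h) (emb \<star> inc SA [j] \<star> bas ?y ?z) = emb \<star> S\<xi> \<gamma> \<star> inc ?B [i]"
      unfolding S\<xi>_column[OF G i j] using emb_simps(1,2) j(1) X t by (simp add: comp_scal_right)
    also have "\<dots> = (emb \<star> S\<xi> \<gamma>) \<star> inc ?B [i]"
      using emb_simps(1,2) S inc(1,2) by simp
    finally show "(emb \<star> S\<xi> \<gamma>) \<star> inc (src (\<xi> \<gamma> \<star> act \<gamma> emb)) [i] =
        (\<xi> \<gamma> \<star> act \<gamma> emb) \<star> inc (src (\<xi> \<gamma> \<star> act \<gamma> emb)) [i]"
      unfolding B l 2 by (rule sym)
  qed (use D G S emb_simps in \<open>auto simp del: map_map\<close>)
qed

text \<open>A non-radical \<open>b\<close> makes all columns non-radical, and unit entries in different columns lie in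
  non-isomorphic rows. So the projection of the embedding to the rows with chosen unit entries is
  invertible.\<close>

lemma emb_rows:
  assumes "\<not> rad b"
  shows "\<exists>ks t. distinct ks \<and> length ks = length \<sigma> \<and> set ks \<subseteq> {..<length A} \<and> inverse_of (prj A ks \<star> emb) t"
proof -
  note D = eqobjD[OF A]
  have nr: "\<not> rad (col s)" if s: "s < length \<sigma>" for s
  proof
    have G: "\<sigma> ! s \<in> carrier G" using s by simp
    assume "rad (col s)"
    obtain g where g: "inverse_of (\<xi> (\<sigma> ! s)) g" using eqobj_inverse[OF A G] by blast
    have "act (\<sigma> ! s) b = g \<star> col s"
      unfolding col_def using g G D b comp_cancel[of g "\<xi> (\<sigma> ! s)" _ "act (\<sigma> ! s) b"]
      by (simp add: inverse_of_def)
    then have "rad (act (\<sigma> ! s) b)"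
      using rad_comp_right[of "col s" g] \<open>rad (col s)\<close> g G D col_simps[OF s] by (simp add: inverse_of_def)
    then show False using assms rad_act[OF G b(1)] by simp
  qed
  have "\<exists>k<length A. cp_iso c (SA ! s) (A ! k) \<and> ent (col s) k 0 \<in> Units R" if "s < length \<sigma>" for s
    using that col_simps[OF that] nr[OF that] unfolding rad_def by auto
  then obtain k where k: "\<And>s. s < length \<sigma> \<Longrightarrow> k s < length A \<and> cp_iso c (SA ! s) (A ! k s) \<and> ent (col s) (k s) 0 \<in> Units R"
    by metis
  have inj: "s = s'" if "s < length \<sigma>" "s' < length \<sigma>" "k s = k s'" for s s'
  proof -
    have X: "SA ! s \<in> \<X>" "SA ! s' \<in> \<X>" "A ! k s \<in> \<X>" using that k D(1) by (auto simp del: SA_simps(2))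
    have "cp_iso c (SA ! s) (SA ! s')"
      using k[OF that(1)] k[OF that(2)] that(3) iso_trans[OF X(1,3,2)] iso_sym[OF X(2,3)] by simp
    then show ?thesis using SA_iso that by blast
  qed
  let ?ks = "map k [0..<length \<sigma>]"
  have ks: "distinct ?ks" "set ?ks \<subseteq> {..<length A}"
    using inj k by (auto simp: distinct_map inj_on_def)
  have "\<exists>t. inverse_of (prj A ?ks \<star> emb) t"
    by (rule unit_diagonal_invertible)
      (use ks k emb_simps D(1) in \<open>auto simp: SA_iso simp del: SA_simps(2)\<close>)
  then show ?thesis using ks by (intro exI[of _ ?ks]) auto
qed

text \<open>With \<open>\<rho>\<close> a non-equivariant retraction of the embedding \<open>\<iota>\<close> that is supported on the chosen rows,
  and \<open>\<pi>\<close> an equivariant one, \<open>1 - \<iota>\<rho>\<close> identifies the kernel of \<open>\<pi>\<close> with the sum of the remaining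
  components of \<open>A\<close>.\<close>

lemma splitting:
  assumes "\<not> rad b"
  shows "\<exists>A' \<xi>' \<pi> \<kappa> p. length A' < length A \<and> (A', \<xi>') \<in> cat_obj \<FF>G \<and>
    \<pi> \<in> cat_hom \<FF>G (A, \<xi>) (SA, S\<xi>) \<and> \<kappa> \<in> cat_hom \<FF>G (A', \<xi>') (A, \<xi>) \<and> p \<in> cat_hom \<FF>G (A, \<xi>) (A', \<xi>') \<and>
    emb \<in> cat_hom \<FF>G (SA, S\<xi>) (A, \<xi>) \<and>
    \<pi> \<star> emb = ide SA \<and> p \<star> \<kappa> = ide A' \<and> p \<star> emb = null SA A' \<and> \<pi> \<star> \<kappa> = null A' SA \<and>
    (emb \<star> \<pi>) \<boxplus> (\<kappa> \<star> p) = ide A"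
proof -
  note D = eqobjD[OF A] and \<iota> = emb_simps(1-3) emb_eqv
  obtain ks t where ks: "distinct ks" "length ks = length \<sigma>" "set ks \<subseteq> {..<length A}"
    and t: "inverse_of (prj A ks \<star> emb) t"
    using emb_rows[OF assms] by blast
  define ls where "ls = filter (\<lambda>i. i \<notin> set ks) [0..<length A]"
  have ls: "distinct ls" "set ls \<subseteq> {..<length A}" "set ks \<inter> set ls = {}" "{..<length A} \<subseteq> set ks \<union> set ls"
    by (auto simp: ls_def)
  define q where "q = prj A ks"
  define q' where "q' = prj A ls"
  define e' where "e' = inc A ls"
  define e where "e = inc A ks"
  define A' where "A' = sub A ls"
  have A': "A' \<in> lists \<X>" using D(1) ls by (simp add: A'_def)
  have q: "q \<in> Ar" "src q = A" "q' \<in> Ar" "src q' = A" "tgt q' = A'" "e' \<in> Ar" "src e' = A'" "tgt e' = A"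
      "e \<in> Ar" "tgt e = A" "src e = tgt q"
    using D(1) ks ls by (simp_all add: q_def q'_def e'_def e_def A'_def)
  have qe': "q \<star> e' = null A' (tgt q)" and q'e': "q' \<star> e' = ide A'"
      and part: "(e \<star> q) \<boxplus> (e' \<star> q') = ide A"
    using prj_inc_disjoint[OF D(1) ks(3) ls(2,3)] prj_inc[OF D(1) ls(2,1)]
      inc_prj_partition[OF D(1) ks(3) ls(2,3,4) ks(1) ls(1)]
    by (simp_all add: q_def q'_def e'_def e_def A'_def)
  have tA: "t \<in> Ar" "src t = tgt q" "tgt t = SA" "t \<star> q \<star> emb = ide SA" "q \<star> emb \<star> t = ide (tgt q)"
    using t \<iota> q unfolding inverse_of_def q_def[symmetric] by auto
  define \<rho> where "\<rho> = t \<star> q"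
  have \<rho>: "\<rho> \<in> Ar" "src \<rho> = A" "tgt \<rho> = SA" using tA q by (auto simp: \<rho>_def)
  have \<rho>\<iota>: "\<rho> \<star> emb = ide SA" and \<rho>e': "\<rho> \<star> e' = null A' SA" and q\<iota>\<rho>: "q \<star> emb \<star> \<rho> = q"
  proof -
    show "\<rho> \<star> emb = ide SA" using tA q \<iota> by (simp add: \<rho>_def)
    show "\<rho> \<star> e' = null A' SA" using tA q qe' A' by (simp add: \<rho>_def)
    have "q \<star> emb \<star> t \<star> q = (q \<star> emb \<star> t) \<star> q" using tA(1-3) q \<iota> by simp
    then show "q \<star> emb \<star> \<rho> = q" unfolding tA(5) using q by (simp add: \<rho>_def)
  qed
  obtain \<pi> where \<pi>: "\<pi> \<in> Ar" "src \<pi> = A" "tgt \<pi> = SA" "eqv \<xi> S\<xi> \<pi>" "\<pi> \<star> emb = ide SA"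
    using equivariant_retraction[OF A S_eqobj \<iota> \<rho> \<rho>\<iota>] by blast
  \<comment> \<open>The projections along the image of the embedding that belong to the two retractions.\<close>
  define cpl where "cpl \<tau> = ide A \<boxplus> scal (\<ominus> \<one>) (emb \<star> \<tau>)" for \<tau>
  have cpl: "cpl \<tau> \<in> Ar" "src (cpl \<tau>) = A" "tgt (cpl \<tau>) = A"
    if "\<tau> \<in> Ar" "src \<tau> = A" "tgt \<tau> = SA" for \<tau>
    using that \<iota> D(1) by (auto simp: cpl_def)
  have comp_cpl: "f \<star> cpl \<tau> = f \<boxplus> scal (\<ominus> \<one>) (f \<star> emb \<star> \<tau>)"
    if "\<tau> \<in> Ar" "src \<tau> = A" "tgt \<tau> = SA" "f \<in> Ar" "src f = A" for \<tau> f
    using that \<iota> D(1) by (simp add: cpl_def comp_plus_right comp_scal_right)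
  have cpl_comp: "cpl \<tau> \<star> f = f \<boxplus> scal (\<ominus> \<one>) (emb \<star> \<tau> \<star> f)"
    if "\<tau> \<in> Ar" "src \<tau> = A" "tgt \<tau> = SA" "f \<in> Ar" "tgt f = A" for \<tau> f
    using that \<iota> D(1) by (simp add: cpl_def comp_plus_left comp_scal_left)
  have cancel: "f \<boxplus> scal (\<ominus> \<one>) f = null (src f) (tgt f)" if "f \<in> Ar" for f
    using that by (auto intro!: mor_eqI simp: l_minus r_neg)
  have neg_null: "scal (\<ominus> \<one>) (null K L) = null K L" if "K \<in> lists \<X>" "L \<in> lists \<X>" for K L
    using that by (auto intro!: mor_eqI)
  have cpl_emb: "cpl \<tau> \<star> emb = null SA A" if "\<tau> \<in> Ar" "src \<tau> = A" "tgt \<tau> = SA" "\<tau> \<star> emb = ide SA" for \<tau>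
    using cpl_comp[OF that(1-3) \<iota>(1,3)] that(4) \<iota> cancel[OF \<iota>(1)] by simp
  have cpl_cpl: "cpl \<tau> \<star> cpl \<tau>' = cpl \<tau>"
    if "\<tau> \<in> Ar" "src \<tau> = A" "tgt \<tau> = SA" "\<tau> \<star> emb = ide SA" "\<tau>' \<in> Ar" "src \<tau>' = A" "tgt \<tau>' = SA" for \<tau> \<tau>'
  proof -
    have "cpl \<tau> \<star> emb \<star> \<tau>' = null A A"
      using comp_cancel[OF cpl_emb[OF that(1-4)], of \<tau>'] that \<iota> cpl[OF that(1-3)] D(1) by simp
    then show ?thesis
      using comp_cpl[OF that(5-7) cpl(1,2)[OF that(1-3)]] cpl[OF that(1-3)] D(1) neg_null by simp
  qed
  define \<kappa> where "\<kappa> = cpl \<pi> \<star> e'"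
  define p where "p = q' \<star> cpl \<rho>"
  note c\<pi> = cpl[OF \<pi>(1-3)] and c\<rho> = cpl[OF \<rho>]
  have \<kappa>: "\<kappa> \<in> Ar" "src \<kappa> = A'" "tgt \<kappa> = A" and p: "p \<in> Ar" "src p = A" "tgt p = A'"
    using q c\<pi> c\<rho> by (auto simp: \<kappa>_def p_def)
  have p\<kappa>: "p \<star> \<kappa> = ide A'"
  proof -
    have "p \<star> \<kappa> = q' \<star> (cpl \<rho> \<star> cpl \<pi>) \<star> e'"
      using q c\<pi> c\<rho> by (simp add: \<kappa>_def p_def)
    also have "\<dots> = q' \<star> cpl \<rho> \<star> e'" using cpl_cpl[OF \<rho> \<rho>\<iota> \<pi>(1-3)] by simp
    also have "cpl \<rho> \<star> e' = e'"
      using cpl_comp[OF \<rho> q(6,8)] \<rho>e' \<iota> A' q D(1) neg_null by simp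
    finally show ?thesis using q'e' by simp
  qed
  have \<kappa>p: "\<kappa> \<star> p = cpl \<pi>"
  proof -
    have "q \<star> cpl \<rho> = null A (tgt q)"
      using comp_cpl[OF \<rho> q(1,2)] q\<iota>\<rho> cancel[OF q(1)] q by simp
    then have eq0: "(e \<star> q) \<star> cpl \<rho> = null A A"
      using q c\<rho> D(1) by simp
    have "cpl \<rho> = ((e \<star> q) \<boxplus> (e' \<star> q')) \<star> cpl \<rho>" unfolding part using c\<rho> by simp
    also have "\<dots> = (e' \<star> q') \<star> cpl \<rho>"
      using eq0 q c\<rho> by (simp add: comp_plus_left)
    finally have e'q': "e' \<star> q' \<star> cpl \<rho> = cpl \<rho>" using q c\<rho> by simp
    have "\<kappa> \<star> p = cpl \<pi> \<star> e' \<star> q' \<star> cpl \<rho>" using q c\<pi> c\<rho> by (simp add: \<kappa>_def p_def)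
    then show ?thesis using e'q' cpl_cpl[OF \<pi>(1-3,5) \<rho>] by simp
  qed
  have "eqv \<xi> \<xi> (emb \<star> \<pi>)"
    by (rule eqv_comp[OF A S_eqobj A \<pi>(1-3) \<iota>(1-3) \<pi>(4) \<iota>(4)])
  then have "eqv \<xi> \<xi> (scal (\<ominus> \<one>) (emb \<star> \<pi>))"
    using \<iota> \<pi> by (simp add: eqv_scal[OF A A])
  then have eqv: "eqv \<xi> \<xi> (\<kappa> \<star> p)"
    unfolding \<kappa>p cpl_def using \<iota> \<pi> D(1) eqv_ide[OF A] by (simp add: eqv_plus[OF A A])
  obtain \<xi>' where \<xi>': "(A', \<xi>') \<in> cat_obj \<FF>G" "eqv \<xi>' \<xi> \<kappa>" "eqv \<xi> \<xi>' p"
    using equivariant_complement[OF A A' \<kappa> p p\<kappa> eqv] by blast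
  have p\<iota>: "p \<star> emb = null SA A'"
    using cpl_emb[OF \<rho> \<rho>\<iota>] q c\<rho> \<iota> by (simp add: p_def)
  have "\<pi> \<star> cpl \<pi> = null A SA"
    using comp_cpl[OF \<pi>(1-3) \<pi>(1,2)] comp_cancel[OF \<pi>(5), of \<pi>] cancel[OF \<pi>(1)] \<pi> \<iota> by simp
  then have \<pi>\<kappa>: "\<pi> \<star> \<kappa> = null A' SA"
    using comp_cancel[of \<pi> "cpl \<pi>" "null A SA" e'] q c\<pi> \<pi> by (simp add: \<kappa>_def)
  have sum: "(emb \<star> \<pi>) \<boxplus> (\<kappa> \<star> p) = ide A"
    unfolding \<kappa>p cpl_def using \<iota> \<pi> D(1) by (auto intro!: mor_eqI simp: l_minus r_neg a_lcomm)
  have "length A' < length A"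
  proof -
    have "ks ! 0 < length A" "0 < length ks" using ks \<sigma>_nonempty by auto
    moreover from this have "ks ! 0 \<notin> set ls" using ls(3) nth_mem[of 0 ks] by blast
    ultimately have "ks ! 0 \<in> {..<length A} - set ls" by simp
    then have "set ls \<subset> {..<length A}" using ls(2) by blast
    then have "card (set ls) < length A" using psubset_card_mono[of "{..<length A}" "set ls"] by simp
    then show ?thesis using distinct_card[OF ls(1)] by (simp add: A'_def)
  qed
  then show ?thesis
    using \<xi>' \<pi> \<kappa> p p\<kappa> p\<iota> \<pi>\<kappa> sum \<iota> D(1) A'
    by (intro exI[of _ A'] exI[of _ \<xi>'] exI[of _ \<pi>] exI[of _ \<kappa>] exI[of _ p]) (simp add: FG_hom_iff)
qed

end

end

section \<open>The decomposition\<close>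

context cyclic_action
begin


lemma zero_length_direct_sum:
  assumes "([], \<xi>) \<in> cat_obj \<FF>G"
  shows "direct_sum \<FF>G [] ([], \<xi>)"
proof -
  interpret E: ring "end_ring \<FF>G ([], \<xi>)" by (rule end_ring_ring[OF preadditive_FG assms])
  have "null [] [] = ide []" by (rule mor_eqI) auto
  then show ?thesis using assms by (simp add: direct_sum_def)
qed

text \<open>Induction on the number of components. The inclusion of the first one is a non-radical morphism
  to start the search for an eigenvector with.\<close>

lemma decomposition:
  assumes comm: "\<And>x h k. x \<in> \<X> \<Longrightarrow> h \<in> stab x \<Longrightarrow> k \<in> stab x \<Longrightarrow> h \<otimes>\<^bsub>G\<^esub> k = k \<otimes>\<^bsub>G\<^esub> h"
    and roots: "card {\<zeta> \<in> carrier R. \<zeta> [^] order G = \<one>} = order G"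
    and reps: "\<And>x. x \<in> \<X> \<Longrightarrow> left_coset_reps G (stab x) (\<sigma> x)"
    and "(A, \<xi>) \<in> cat_obj \<FF>G"
  shows "\<exists>Ss. (\<forall>S\<in>set Ss. strongly_indecomposable \<FF>G S \<and>
       (\<exists>x\<in>\<X>. \<exists>\<theta>\<in>hom (G\<lparr>carrier := stab x\<rparr>) (units_of R). S = S_obj R G c \<phi> (\<sigma> x) \<theta> x)) \<and>
    direct_sum \<FF>G Ss (A, \<xi>)"
  using assms(4)
proof (induction "length A" arbitrary: A \<xi> rule: less_induct)
  case less
  show ?case
  proof (cases "A = []")
    case True
    then show ?thesis using zero_length_direct_sum less.prems by (intro exI[of _ "[]"]) simp
  next
    case False
    have ob: "eqobj A \<xi>" using less.prems by (simp add: eqobj_iff)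
    define x where "x = A ! 0"
    have A: "A \<in> lists \<X>" "0 < length A" "x \<in> \<X>" using eqobjD(1)[OF ob] False by (auto simp: x_def)
    have a: "inc A [0] \<in> Ar" "src (inc A [0]) = [x]" "tgt (inc A [0]) = A" "\<not> rad (inc A [0])"
      using A by (auto simp: x_def rad_def intro!: exI[of _ 0])
    obtain b \<theta> where \<theta>: "\<theta> \<in> hom (G\<lparr>carrier := stab x\<rparr>) (units_of R)"
      and b: "b \<in> Ar" "src b = [x]" "tgt b = A" "\<not> rad b"
      and eigen: "\<And>h. h \<in> stab x \<Longrightarrow> \<xi> h \<star> act h b = scal (\<theta> h) (b \<star> bas (\<phi> h x) x)"
      using exists_eigenmorphism[OF ob A(3) comm[OF A(3)] roots a] by blast
    interpret S: induced_object R u \<X> c G \<phi> x "\<sigma> x" \<theta>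
      by unfold_locales (use A(3) reps \<theta> in auto)
    note emb = S.splitting[OF ob b(1-3) eigen b(4)]
    let ?\<iota> = "S.emb A \<xi> b"
    obtain A' \<xi>' \<pi> \<kappa> p where split: "length A' < length A" "(A', \<xi>') \<in> cat_obj \<FF>G"
        "\<pi> \<in> cat_hom \<FF>G (A, \<xi>) (S.SA, S.S\<xi>)" "\<kappa> \<in> cat_hom \<FF>G (A', \<xi>') (A, \<xi>)"
        "p \<in> cat_hom \<FF>G (A, \<xi>) (A', \<xi>')" "?\<iota> \<in> cat_hom \<FF>G (S.SA, S.S\<xi>) (A, \<xi>)"
        "\<pi> \<star> ?\<iota> = ide S.SA" "p \<star> \<kappa> = ide A'" "p \<star> ?\<iota> = null S.SA A'" "\<pi> \<star> \<kappa> = null A' S.SA"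
        "(?\<iota> \<star> \<pi>) \<boxplus> (\<kappa> \<star> p) = ide A"
      using emb by blast
    obtain Ss where Ss: "\<forall>S\<in>set Ss. strongly_indecomposable \<FF>G S \<and>
       (\<exists>x\<in>\<X>. \<exists>\<theta>\<in>hom (G\<lparr>carrier := stab x\<rparr>) (units_of R). S = S_obj R G c \<phi> (\<sigma> x) \<theta> x)"
       "direct_sum \<FF>G Ss (A', \<xi>')"
      using less.hyps[OF split(1,2)] by blast
    have "direct_sum \<FF>G ((S.SA, S.S\<xi>) # Ss) (A, \<xi>)"
      by (rule direct_sum_Cons[OF preadditive_FG less.prems S.S_in_FG split(6,3) _ split(4,5) _ _ _ _ Ss(2)])
        (use split in simp_all)
    moreover have "strongly_indecomposable \<FF>G (S.SA, S.S\<xi>)" by (rule S.S_strongly_indecomposable)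
    moreover have "\<exists>x\<in>\<X>. \<exists>\<theta>\<in>hom (G\<lparr>carrier := stab x\<rparr>) (units_of R). (S.SA, S.S\<xi>) = S_obj R G c \<phi> (\<sigma> x) \<theta> x"
      using S.S_obj_eq[symmetric] A(3) \<theta> by (intro bexI[of _ x] bexI[of _ \<theta>])
    ultimately show ?thesis
      using Ss(1) by (intro exI[of _ "(S.SA, S.S\<xi>) # Ss"]) simp
  qed
qed

lemma decomposition_up_to_iso:
  assumes comm: "\<And>x. x \<in> \<X> \<Longrightarrow> comm_group (G\<lparr>carrier := stab x\<rparr>)"
    and roots: "contains_roots_of_unity R (order G)"
    and reps: "\<And>x. x \<in> \<X> \<Longrightarrow> left_coset_reps G (stab x) (\<sigma> x)"
    and A: "A \<in> cat_obj \<FF>G"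
  shows "\<exists>Ss B. (\<forall>S\<in>set Ss. strongly_indecomposable \<FF>G S \<and>
       (\<exists>x\<in>\<X>. \<exists>\<theta>\<in>hom (G\<lparr>carrier := stab x\<rparr>) (units_of R). S = S_obj R G c \<phi> (\<sigma> x) \<theta> x)) \<and>
    direct_sum \<FF>G Ss B \<and> isomorphic \<FF>G A B"
proof -
  obtain A0 \<xi> where A0: "A = (A0, \<xi>)" by (cases A)
  have ob: "(A0, \<xi>) \<in> cat_obj \<FF>G" using A unfolding A0 .
  have commute: "h \<otimes>\<^bsub>G\<^esub> k = k \<otimes>\<^bsub>G\<^esub> h" if "x \<in> \<X>" "h \<in> stab x" "k \<in> stab x" for x h k
    using comm_groupE(4)[OF comm[OF that(1)], of h k] that(2,3) by simp
  have card: "card {\<zeta> \<in> carrier R. \<zeta> [^] order G = \<one>} = order G"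
    using roots by (simp add: contains_roots_of_unity_def)
  have "\<exists>Ss. (\<forall>S\<in>set Ss. strongly_indecomposable \<FF>G S \<and>
       (\<exists>x\<in>\<X>. \<exists>\<theta>\<in>hom (G\<lparr>carrier := stab x\<rparr>) (units_of R). S = S_obj R G c \<phi> (\<sigma> x) \<theta> x)) \<and>
     direct_sum \<FF>G Ss A"
    unfolding A0 by (rule decomposition[OF commute card reps ob])
  then obtain Ss where Ss: "(\<forall>S\<in>set Ss. strongly_indecomposable \<FF>G S \<and>
       (\<exists>x\<in>\<X>. \<exists>\<theta>\<in>hom (G\<lparr>carrier := stab x\<rparr>) (units_of R). S = S_obj R G c \<phi> (\<sigma> x) \<theta> x)) \<and>
     direct_sum \<FF>G Ss A"
    by (rule exE)
  have "ide A0 \<in> cat_iso \<FF>G A A"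
    using ob eqv_ide eqobjD(1) unfolding A0
    by (auto simp: cat_iso_def eqobj_iff FG_hom_iff intro!: bexI[of _ "ide A0"])
  then have iso: "isomorphic \<FF>G A A" unfolding isomorphic_def by blast
  show ?thesis
    by (rule exI[of _ Ss], rule exI[of _ A]) (rule conjI[OF conjunct1[OF Ss] conjI[OF conjunct2[OF Ss] iso]])
qed

end

theorem theorem1p5p9:
  fixes G :: "'g monoid" and R :: "'r ring" and u :: 'r
    and \<X> \<X>\<^sub>0 :: "'x set" and c :: "'x \<Rightarrow> 'x \<Rightarrow> 'x \<Rightarrow> nat"
    and \<phi> :: "'g \<Rightarrow> 'x \<Rightarrow> 'x" and \<sigma> :: "'x \<Rightarrow> 'g list"
  assumes "group G" and "finite (carrier G)"
    and "frobenius_cyclic_poset TYPE('r) \<X> c \<X>\<^sub>0"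
    and "cp_action G \<X> c \<X>\<^sub>0 \<phi>"
    and "discrete_valuation_ring R" and "uniformizer R u"
    and "\<not> ring_characteristic (residue_field R) dvd order G"
    and "contains_roots_of_unity R (order G)"
    and "\<And>x. x \<in> \<X> \<Longrightarrow> comm_group (G\<lparr>carrier := eff_stabilizer G c \<phi> x\<rparr>)"
    and "\<And>x. x \<in> \<X> \<Longrightarrow> left_coset_reps G (eff_stabilizer G c \<phi> x) (\<sigma> x)"
    and "A \<in> cat_obj (FG R u \<X> c G \<phi>)"
  shows "\<exists>Ss B.
    (\<forall>S\<in>set Ss. strongly_indecomposable (FG R u \<X> c G \<phi>) S \<and>
       (\<exists>x\<in>\<X>. \<exists>\<theta>\<in>hom (G\<lparr>carrier := eff_stabilizer G c \<phi> x\<rparr>) (units_of R).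
          S = S_obj R G c \<phi> (\<sigma> x) \<theta> x)) \<and>
    direct_sum (FG R u \<X> c G \<phi>) Ss B \<and> isomorphic (FG R u \<X> c G \<phi>) A B"
proof -
  obtain \<E> where "frobenius_structure (addP R u \<X> c) \<E>"
    using assms(3,5,6) unfolding frobenius_cyclic_poset_def by blast
  then have "preadditive (addP R u \<X> c)"
    by (simp add: frobenius_structure_def exact_structure_def additive_def)
  moreover have "cyclic_poset \<X> c" using assms(3) by (simp add: frobenius_cyclic_poset_def)
  moreover have "domain R"
    using assms(5) by (simp add: discrete_valuation_ring_def principal_domain.axioms(1))
  ultimately have "cyclic_hull R u \<X> c"
    using assms(6) uniformizer_nonunit[OF assms(5,6)] nonunits_add_closed[OF assms(5)]
    by (intro cyclic_hull.intro cyclic_hull_axioms.intro) (simp_all add: uniformizer_def)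
  then have "cyclic_action R u \<X> c G \<phi>"
    using assms(1,2,4) of_nat_unit[OF assms(5,7)]
    by (intro cyclic_action.intro cyclic_action_axioms.intro) (simp_all add: cp_action_def)
  then show ?thesis
    by (rule cyclic_action.decomposition_up_to_iso[OF _ assms(9,8,10,11)])
qed

end
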